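(* Let $X$ be a curve of genus $g$ over a finite field, $P,Q$ distinct rational points and $B$ a divisor. Then \[ \mathcal{D}_B(P,Q)=\{B+iP+\sigma(i)Q : i\in\mathbb{Z}\}=\{B+\tau(j)P+jQ : j\in\mathbb{Z}\}. \] In particular $\sigma=\sigma_B$ and $\tau=\tau_B$ are mutually inverse permutations of $\mathbb{Z}$. If $\deg B=0$, then $-i\leq\sigma(i)\leq 2g-i$ and $-i\leq\tau(i)\leq 2g-i$ for all $i\in\mathbb{Z}$. If $m$ is an integer with $mP\sim mQ$, then $i+\sigma(i)$ and $j+\tau(j)$ depend only on $i$ and $j$ modulo $m$, and $\sigma,\tau$ are determined by their values on a full set of representatives of $\mathbb{Z}/m\mathbb{Z}$.
   Context: $L(E)=\{f:(f)+E\ge0\}\cup\{0\}$; $\Gamma_P=\{A:L(A)\ne L(A-P)\}$. The set of discrepancies $\mathcal{D}(P,Q)$ is the set of divisor classes $A$ with $L(A)\neq L(A-P)$ and $L(A-Q)=L(A-Q-P)$; $\mathcal{D}_B(P,Q)=\{B+iP+jQ:i,j\in\mathbb{Z}\}\cap\mathcal{D}(P,Q)$. The functions $\sigma=\sigma_B,\tau=\tau_B:\mathbb{Z}\to\mathbb{Z}$ are defined by: $B+iP+jQ\in\Gamma_P\iff j\geq\sigma(i)$, and $B+iP+jQ\in\Gamma_Q\iff i\geq\tau(j)$. *)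

theory Defs
  imports
    "HOL-Computational_Algebra.Polynomial"
    "HOL-Library.Function_Algebras"
    "HOL-Library.FuncSet"
    "HOL-Number_Theory.Cong"
begin

text \<open>
  A (smooth, projective, absolutely irreducible) curve over the finite field \<open>'k\<close> is given by its
  function field: a field \<open>'a\<close> with an embedding \<open>\<iota>\<close> of the constants \<open>'k\<close>. Its closed points are
  the normalized discrete valuations of \<open>'a\<close> that are trivial on the constants.
\<close>

definition algebraic_elt :: "('k::field \<Rightarrow> 'a::field) \<Rightarrow> 'a \<Rightarrow> bool" where
  "algebraic_elt \<iota> x \<longleftrightarrow> (\<exists>p. p \<noteq> 0 \<and> poly (map_poly \<iota> p) x = 0)"

text \<open>The subfield generated by the constants and \<open>x\<close>, for \<open>x\<close> transcendental.\<close>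

definition rational_functions_in :: "('k::field \<Rightarrow> 'a::field) \<Rightarrow> 'a \<Rightarrow> 'a set" where
  "rational_functions_in \<iota> x =
     {poly (map_poly \<iota> p) x / poly (map_poly \<iota> q) x | p q. q \<noteq> 0}"

text \<open>The last assumption says that \<open>'k\<close> is the full constant field; as \<open>'k\<close> is perfect, this is
  absolute irreducibility.\<close>

locale curve =
  fixes \<iota> :: "'k::{field,finite} \<Rightarrow> 'a::field"
  assumes embed_one: "\<iota> 1 = 1"
    and embed_add: "\<iota> (a + b) = \<iota> a + \<iota> b"
    and embed_mult: "\<iota> (a * b) = \<iota> a * \<iota> b"
    and finite_over_rational:
      "\<exists>x. \<not> algebraic_elt \<iota> x \<and>
         (\<exists>S. finite S \<and>
            (\<forall>y. \<exists>c. (\<forall>s\<in>S. c s \<in> rational_functions_in \<iota> x) \<and> y = (\<Sum>s\<in>S. c s * s)))"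
    and full_constants: "algebraic_elt \<iota> x \<Longrightarrow> x \<in> range \<iota>"

text \<open>The value at \<open>0\<close>, which should be infinite, is fixed to be the junk value \<open>0\<close>, so that equal
  points are equal functions.\<close>

definition points :: "('k::field \<Rightarrow> 'a::field) \<Rightarrow> ('a \<Rightarrow> int) set" where
  "points \<iota> = {v. v 0 = 0
     \<and> (\<forall>f h. f \<noteq> 0 \<longrightarrow> h \<noteq> 0 \<longrightarrow> v (f * h) = v f + v h)
     \<and> (\<forall>f h. f \<noteq> 0 \<longrightarrow> h \<noteq> 0 \<longrightarrow> f + h \<noteq> 0 \<longrightarrow> min (v f) (v h) \<le> v (f + h))
     \<and> (\<forall>c. c \<noteq> 0 \<longrightarrow> v (\<iota> c) = 0)
     \<and> (\<exists>t. t \<noteq> 0 \<and> v t = 1)}"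

definition local_ring :: "('a::field \<Rightarrow> int) \<Rightarrow> 'a set" where
  "local_ring v = {f. f = 0 \<or> 0 \<le> v f}"

definition maximal_ideal :: "('a::field \<Rightarrow> int) \<Rightarrow> 'a set" where
  "maximal_ideal v = {f. f = 0 \<or> 0 < v f}"

text \<open>The residue classes of \<open>S\<close> form a basis of the residue field over the constants.\<close>

definition residue_basis :: "('k::field \<Rightarrow> 'a::field) \<Rightarrow> ('a \<Rightarrow> int) \<Rightarrow> 'a set \<Rightarrow> bool" where
  "residue_basis \<iota> v S \<longleftrightarrow> finite S \<and> S \<subseteq> local_ring v \<and>
     (\<forall>f\<in>local_ring v. \<exists>!c. c \<in> S \<rightarrow>\<^sub>E UNIV \<and> f - (\<Sum>s\<in>S. \<iota> (c s) * s) \<in> maximal_ideal v)"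

definition point_degree :: "('k::field \<Rightarrow> 'a::field) \<Rightarrow> ('a \<Rightarrow> int) \<Rightarrow> nat" where
  "point_degree \<iota> v =
     (if \<exists>S. residue_basis \<iota> v S then card (SOME S. residue_basis \<iota> v S) else 0)"

definition rational_points :: "('k::field \<Rightarrow> 'a::field) \<Rightarrow> ('a \<Rightarrow> int) set" where
  "rational_points \<iota> = {v \<in> points \<iota>. point_degree \<iota> v = 1}"

type_synonym 'a divisor = "('a \<Rightarrow> int) \<Rightarrow> int"

definition divisors :: "('k::field \<Rightarrow> 'a::field) \<Rightarrow> 'a divisor set" where
  "divisors \<iota> = {D. finite {R. D R \<noteq> 0} \<and> {R. D R \<noteq> 0} \<subseteq> points \<iota>}"

definition pt :: "int \<Rightarrow> ('a \<Rightarrow> int) \<Rightarrow> 'a divisor" where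
  "pt n P = (\<lambda>R. if R = P then n else 0)"

definition deg :: "('k::field \<Rightarrow> 'a::field) \<Rightarrow> 'a divisor \<Rightarrow> int" where
  "deg \<iota> D = (\<Sum>R | D R \<noteq> 0. D R * int (point_degree \<iota> R))"

definition principal :: "('k::field \<Rightarrow> 'a::field) \<Rightarrow> 'a \<Rightarrow> 'a divisor" where
  "principal \<iota> f = (\<lambda>R. if R \<in> points \<iota> then R f else 0)"

definition L :: "('k::field \<Rightarrow> 'a::field) \<Rightarrow> 'a divisor \<Rightarrow> 'a set" where
  "L \<iota> E = {f. f \<noteq> 0 \<and> principal \<iota> f + E \<ge> 0} \<union> {0}"

definition ell :: "('k::field \<Rightarrow> 'a::field) \<Rightarrow> 'a divisor \<Rightarrow> nat" where
  "ell \<iota> E = vector_space.dim (\<lambda>c f. \<iota> c * f) (L \<iota> E)"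

definition genus :: "('k::field \<Rightarrow> 'a::field) \<Rightarrow> int" where
  "genus \<iota> = (GREATEST n. \<exists>A\<in>divisors \<iota>. n = deg \<iota> A - int (ell \<iota> A) + 1)"

definition lin_equiv :: "('k::field \<Rightarrow> 'a::field) \<Rightarrow> 'a divisor rel" where
  "lin_equiv \<iota> = {(A, A'). A \<in> divisors \<iota> \<and> A' \<in> divisors \<iota> \<and>
     (\<exists>f. f \<noteq> 0 \<and> A - A' = principal \<iota> f)}"

definition div_class :: "('k::field \<Rightarrow> 'a::field) \<Rightarrow> 'a divisor \<Rightarrow> 'a divisor set" where
  "div_class \<iota> A = lin_equiv \<iota> `` {A}"

definition Gam :: "('k::field \<Rightarrow> 'a::field) \<Rightarrow> ('a \<Rightarrow> int) \<Rightarrow> 'a divisor set" where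
  "Gam \<iota> P = {A \<in> divisors \<iota>. L \<iota> A \<noteq> L \<iota> (A - pt 1 P)}"

text \<open>Being a discrepancy is invariant under linear equivalence. \<open>discrepancy_divisors\<close> is the
  set of divisors whose class lies in the set \<open>discrepancies\<close> of divisor classes.\<close>

definition discrepancy_divisors ::
    "('k::field \<Rightarrow> 'a::field) \<Rightarrow> ('a \<Rightarrow> int) \<Rightarrow> ('a \<Rightarrow> int) \<Rightarrow> 'a divisor set" where
  "discrepancy_divisors \<iota> P Q = {A \<in> divisors \<iota>.
     L \<iota> A \<noteq> L \<iota> (A - pt 1 P) \<and> L \<iota> (A - pt 1 Q) = L \<iota> (A - pt 1 Q - pt 1 P)}"

definition discrepancies ::
    "('k::field \<Rightarrow> 'a::field) \<Rightarrow> ('a \<Rightarrow> int) \<Rightarrow> ('a \<Rightarrow> int) \<Rightarrow> 'a divisor set set" where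
  "discrepancies \<iota> P Q = div_class \<iota> ` discrepancy_divisors \<iota> P Q"

definition discrepancies_on ::
    "('k::field \<Rightarrow> 'a::field) \<Rightarrow> 'a divisor \<Rightarrow> ('a \<Rightarrow> int) \<Rightarrow> ('a \<Rightarrow> int) \<Rightarrow> 'a divisor set set" where
  "discrepancies_on \<iota> B P Q =
     {div_class \<iota> (B + pt i P + pt j Q) | i j. True} \<inter> discrepancies \<iota> P Q"

definition sigma ::
    "('k::field \<Rightarrow> 'a::field) \<Rightarrow> 'a divisor \<Rightarrow> ('a \<Rightarrow> int) \<Rightarrow> ('a \<Rightarrow> int) \<Rightarrow> int \<Rightarrow> int" where
  "sigma \<iota> B P Q i = (THE s. \<forall>j. B + pt i P + pt j Q \<in> Gam \<iota> P \<longleftrightarrow> j \<ge> s)"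

definition tau ::
    "('k::field \<Rightarrow> 'a::field) \<Rightarrow> 'a divisor \<Rightarrow> ('a \<Rightarrow> int) \<Rightarrow> ('a \<Rightarrow> int) \<Rightarrow> int \<Rightarrow> int" where
  "tau \<iota> B P Q j = (THE t. \<forall>i. B + pt i P + pt j Q \<in> Gam \<iota> Q \<longleftrightarrow> i \<ge> t)"

definition shift_periodic :: "int \<Rightarrow> (int \<Rightarrow> int) \<Rightarrow> bool" where
  "shift_periodic m s \<longleftrightarrow> (\<forall>i i'. [i = i'] (mod m) \<longrightarrow> i + s i = i' + s i')"

definition full_representatives :: "int \<Rightarrow> int set \<Rightarrow> bool" where
  "full_representatives m S \<longleftrightarrow> (\<forall>i. \<exists>!r. r \<in> S \<and> [r = i] (mod m))"

end

theory Submission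
  imports Defs "HOL-Library.Cardinality"
begin

text \<open>
  The theorem needs two facts on the sets \<open>\<Gamma>\<^sub>P\<close>: no divisor of negative degree lies in \<open>\<Gamma>\<^sub>P\<close>, and
  every divisor of degree at least \<open>2 g\<close> does. Given these, \<open>\<sigma>\<close> and \<open>\<tau>\<close> are well defined with the
  stated bounds. A discrepancy is a divisor \<open>A \<in> \<Gamma>\<^sub>P\<close> with \<open>A - Q \<notin> \<Gamma>\<^sub>P\<close>, that is
  \<open>j = \<sigma> i\<close> on the grid; this condition is symmetric in \<open>P\<close> and \<open>Q\<close>, so that it also reads
  \<open>i = \<tau> j\<close>.

  The first fact says that principal divisors have degree \<open>0\<close>. The second one needs no Riemann--Roch
  theorem, but only Riemann's inequality \<open>\<ell>(A) \<ge> deg A + 1 - g\<close>: as \<open>\<Gamma>\<^sub>P\<close> is closed under addition,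
  a divisor \<open>A \<notin> \<Gamma>\<^sub>P\<close> of degree \<open>k\<close> splits in \<open>k + 1\<close> ways as \<open>s P + (A - s P)\<close>, and in each of them one
  summand is outside \<open>\<Gamma>\<^sub>P\<close>, while Riemann's inequality for \<open>k P\<close> and for \<open>A\<close> bounds the number of
  these exceptions.

  Both facts follow from the boundedness of \<open>deg A - \<ell>(A)\<close>. It is proved over \<open>K(x)\<close>: a divisor \<open>A\<close> is
  dominated by some \<open>E\<close>, the zeros of a polynomial \<open>p(x)\<close> plus \<open>k\<close> times the poles of \<open>x\<close>, weak
  approximation bounds \<open>deg E\<close> by \<open>n (deg p + k)\<close>, where \<open>n\<close> is the degree of the function field over \<open>K(x)\<close>,
  and the functions \<open>x\<^sup>i w / p(x)\<close>, with \<open>w\<close> in a basis, are enough elements of \<open>L(E)\<close>. Then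
  \<open>\<ell>(n (f)) = 1\<close> for all \<open>n\<close> gives \<open>deg (f) = 0\<close>. As \<open>K\<close> is finite, dimensions are compared by counting.
\<close>

section \<open>Polynomials in an element and degrees over rational subfields\<close>

context curve
begin

section \<open>The constants as a subfield\<close>

lemma embed_zero [simp]: "\<iota> 0 = 0"
  using embed_add[of 0 0] by (metis add.right_neutral add_cancel_right_right)

lemma embed_uminus: "\<iota> (- a) = - \<iota> a"
  using embed_add[of a "- a"] by (simp add: eq_neg_iff_add_eq_0 add.commute)

lemma embed_diff: "\<iota> (a - b) = \<iota> a - \<iota> b"
  using embed_add[of a "- b"] by (simp add: embed_uminus)

lemma embed_eq_0_iff [simp]: "\<iota> a = 0 \<longleftrightarrow> a = 0"
proof
  assume "\<iota> a = 0"
  show "a = 0"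
  proof (rule ccontr)
    assume "a \<noteq> 0"
    then have "\<iota> a * \<iota> (inverse a) = 1"
      by (simp flip: embed_mult add: embed_one)
    with \<open>\<iota> a = 0\<close> show False by simp
  qed
qed simp

lemma embed_inverse: "\<iota> (inverse a) = inverse (\<iota> a)"
proof (cases "a = 0")
  case False
  then have "\<iota> a * \<iota> (inverse a) = 1"
    by (simp flip: embed_mult add: embed_one)
  then show ?thesis using inverse_unique by metis
qed simp

section \<open>Evaluation of polynomials over the constants\<close>

definition ev :: "'k poly \<Rightarrow> 'a \<Rightarrow> 'a" where
  "ev p x = poly (map_poly \<iota> p) x"

lemma ev_0 [simp]: "ev 0 x = 0"
  by (simp add: ev_def)

lemma ev_pCons [simp]: "ev (pCons a p) x = \<iota> a + x * ev p x"
  by (simp add: ev_def map_poly_pCons)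

lemma ev_1 [simp]: "ev 1 x = 1"
  by (simp add: one_pCons embed_one)

lemma ev_add: "ev (p + q) x = ev p x + ev q x"
  by (induction p q rule: poly_induct2) (simp_all add: embed_add algebra_simps)

lemma ev_smult: "ev (smult a p) x = \<iota> a * ev p x"
  by (induction p) (simp_all add: embed_mult algebra_simps)

lemma ev_mult: "ev (p * q) x = ev p x * ev q x"
  by (induction p) (simp_all add: ev_add ev_smult algebra_simps)

lemma ev_uminus: "ev (- p) x = - ev p x"
  using ev_smult[of "-1" p x] by (simp add: embed_uminus embed_one)

lemma ev_diff: "ev (p - q) x = ev p x - ev q x"
  using ev_add[of p "- q" x] by (simp add: ev_uminus)

lemma ev_sum: "ev (sum p A) x = (\<Sum>i\<in>A. ev (p i) x)"
  by (induction A rule: infinite_finite_induct) (simp_all add: ev_add)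

lemma ev_prod: "ev (prod p A) x = (\<Prod>i\<in>A. ev (p i) x)"
  by (induction A rule: infinite_finite_induct) (simp_all add: ev_mult)

lemma ev_power: "ev (p ^ n) x = ev p x ^ n"
  by (induction n) (simp_all add: ev_mult)

lemma ev_monom: "ev (monom a n) x = \<iota> a * x ^ n"
  by (induction n) (simp_all add: monom_Suc monom_0 algebra_simps)

lemma ev_eq_sum:
  assumes "degree p \<le> m"
  shows "ev p x = (\<Sum>i\<le>m. \<iota> (coeff p i) * x ^ i)"
proof -
  have "ev p x = ev (\<Sum>i\<le>m. monom (coeff p i) i) x"
    using poly_as_sum_of_monoms'[OF assms] by simp
  then show ?thesis by (simp add: ev_sum ev_monom)
qed

lemma algebraic_elt_iff_ev: "algebraic_elt \<iota> x \<longleftrightarrow> (\<exists>p. p \<noteq> 0 \<and> ev p x = 0)"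
  by (simp add: algebraic_elt_def ev_def)

text \<open>The degree of the function field over the subfield generated by \<open>y\<close> is at most \<open>N\<close>;
  denominators are cleared, so that no vector space over that subfield is needed.\<close>

definition rank_le :: "'a \<Rightarrow> nat \<Rightarrow> bool" where
  "rank_le y N \<longleftrightarrow> (\<forall>Z. finite Z \<longrightarrow> N < card Z \<longrightarrow>
     (\<exists>a. (\<exists>z\<in>Z. a z \<noteq> 0) \<and> (\<Sum>z\<in>Z. ev (a z) y * z) = 0))"

text \<open>The denominator \<open>b\<close> makes this spanning over the field \<open>K(x)\<close>,
  while every coefficient stays a polynomial.\<close>

definition spans :: "'a \<Rightarrow> 'a set \<Rightarrow> bool" where
  "spans x S \<longleftrightarrow> finite S \<and>
     (\<forall>y. \<exists>b c. b \<noteq> 0 \<and> ev b x * y = (\<Sum>s\<in>S. ev (c s) x * s))"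

text \<open>A finite piece of the \<open>K[x]\<close>-lattice on \<open>S\<close>. How fast its size
  grows with \<open>m\<close> is what the counting arguments compare.\<close>

definition Lam :: "'a \<Rightarrow> 'a set \<Rightarrow> nat \<Rightarrow> 'a set" where
  "Lam x S m = {\<Sum>s\<in>S. ev (p s) x * s | p. \<forall>s\<in>S. degree (p s) \<le> m}"

lemma Lam_mono: "m \<le> m' \<Longrightarrow> Lam x S m \<subseteq> Lam x S m'"
  by (fastforce simp: Lam_def)

lemma Lam_0: "0 \<in> Lam x S m"
  by (auto simp: Lam_def intro!: exI[of _ "\<lambda>_. 0"])

lemma Lam_add:
  assumes "h \<in> Lam x S m" "h' \<in> Lam x S m"
  shows "h + h' \<in> Lam x S m"
proof -
  obtain p p' where "h = (\<Sum>s\<in>S. ev (p s) x * s)" "\<forall>s\<in>S. degree (p s) \<le> m"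
     "h' = (\<Sum>s\<in>S. ev (p' s) x * s)" "\<forall>s\<in>S. degree (p' s) \<le> m"
    using assms by (auto simp: Lam_def)
  then show ?thesis
    by (auto simp: Lam_def ev_add distrib_right sum.distrib degree_add_le
        intro!: exI[of _ "\<lambda>s. p s + p' s"])
qed

lemma Lam_sum: "(\<And>i. i \<in> A \<Longrightarrow> h i \<in> Lam x S m) \<Longrightarrow> sum h A \<in> Lam x S m"
  by (induction A rule: infinite_finite_induct) (auto intro: Lam_add Lam_0)

lemma Lam_ev:
  assumes "h \<in> Lam x S m" "degree b + m \<le> m'"
  shows "ev b x * h \<in> Lam x S m'"
proof -
  obtain p where p: "h = (\<Sum>s\<in>S. ev (p s) x * s)" "\<forall>s\<in>S. degree (p s) \<le> m"
    using assms by (auto simp: Lam_def)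
  have "degree (b * p s) \<le> m'" if "s \<in> S" for s
    using degree_mult_le[of b "p s"] p(2) that assms(2) by force
  then show ?thesis
    using p by (auto simp: Lam_def ev_mult sum_distrib_left mult.assoc
        intro!: exI[of _ "\<lambda>s. b * p s"])
qed

lemma Lam_embed: "h \<in> Lam x S m \<Longrightarrow> \<iota> c * h \<in> Lam x S m"
  using Lam_ev[of h x S m "[:c:]" m] by simp

text \<open>An element is given by \<open>card S * (m + 1)\<close> coefficients; \<open>S\<close>
  may be dependent, so the count is only an upper bound.\<close>

lemma card_Lam_le:
  assumes "finite S"
  shows "finite (Lam x S m)" "card (Lam x S m) \<le> CARD('k) ^ (card S * (m + 1))"
proof -
  let ?D = "S \<times> {..m}"
  let ?F = "?D \<rightarrow>\<^sub>E (UNIV :: 'k set)"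
  let ?e = "\<lambda>c. \<Sum>s\<in>S. (\<Sum>i\<le>m. \<iota> (c (s, i)) * x ^ i) * s"
  have fin: "finite ?F" using assms by (intro finite_PiE) auto
  have sub: "Lam x S m \<subseteq> ?e ` ?F"
  proof
    fix h assume "h \<in> Lam x S m"
    then obtain p where p: "h = (\<Sum>s\<in>S. ev (p s) x * s)" "\<forall>s\<in>S. degree (p s) \<le> m"
      by (auto simp: Lam_def)
    let ?c = "restrict (\<lambda>(s, i). coeff (p s) i) ?D"
    have "h = ?e ?c"
      unfolding p(1) using p(2) by (intro sum.cong refl arg_cong2[where f = "(*)"])
        (simp add: ev_eq_sum[of _ m])
    moreover have "?c \<in> ?F" by (rule restrict_PiE_iff[THEN iffD2]) simp
    ultimately show "h \<in> ?e ` ?F" by (rule image_eqI)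
  qed
  show "finite (Lam x S m)"
    using finite_subset[OF sub] fin by blast
  have "card (Lam x S m) \<le> card (?e ` ?F)"
    using sub fin by (intro card_mono) auto
  also have "\<dots> \<le> card ?F" by (rule card_image_le[OF fin])
  also have "\<dots> = CARD('k) ^ (card S * (m + 1))"
    using assms by (subst card_PiE) (simp_all add: card_cartesian_product)
  finally show "card (Lam x S m) \<le> CARD('k) ^ (card S * (m + 1))" .
qed

lemma card_constants_ge_2: "2 \<le> CARD('k)"
proof -
  have "card {0, 1 :: 'k} \<le> CARD('k)" by (intro card_mono) auto
  then show ?thesis by simp
qed

lemma ev_nonzero: "\<not> algebraic_elt \<iota> x \<Longrightarrow> p \<noteq> 0 \<Longrightarrow> ev p x \<noteq> 0"
  by (auto simp: algebraic_elt_iff_ev)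

lemma common_denominator:
  assumes "spans x S" "finite Z"
  shows "\<exists>b C. b \<noteq> 0 \<and> (\<forall>z\<in>Z. ev b x * z \<in> Lam x S C)"
proof -
  have "\<forall>z. \<exists>b c. b \<noteq> 0 \<and> ev b x * z = (\<Sum>s\<in>S. ev (c s) x * s)"
    using assms(1) by (auto simp: spans_def)
  then obtain b c where bc: "\<And>z. b z \<noteq> 0" "\<And>z. ev (b z) x * z = (\<Sum>s\<in>S. ev (c z s) x * s)"
    by metis
  have finS: "finite S" using assms(1) by (simp add: spans_def)
  \<comment> \<open>The product of all denominators. For each \<open>z\<close> the remaining factors
    only raise degrees, within the bound \<open>C\<close>.\<close>
  define B where "B = prod b Z"
  define C where "C = degree B + (\<Sum>z\<in>Z. \<Sum>s\<in>S. degree (c z s))"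
  have "ev B x * z \<in> Lam x S C" if "z \<in> Z" for z
  proof -
    have B: "B = prod b (Z - {z}) * b z"
      using that assms(2) by (simp add: B_def prod.remove[of Z z] mult.commute)
    let ?m = "\<Sum>s\<in>S. degree (c z s)"
    have "ev (b z) x * z \<in> Lam x S ?m"
      unfolding bc(2) Lam_def using finS by (auto intro!: exI[of _ "c z"] member_le_sum)
    moreover have "?m \<le> (\<Sum>z\<in>Z. \<Sum>s\<in>S. degree (c z s))"
      using that assms(2) by (intro member_le_sum[of z Z "\<lambda>z. \<Sum>s\<in>S. degree (c z s)"]) auto
    moreover have "degree (prod b (Z - {z})) \<le> degree B"
    proof -
      have "B \<noteq> 0" using bc(1) assms(2) by (simp add: B_def)
      then show ?thesis unfolding B by (subst degree_mult_eq) auto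
    qed
    ultimately have "ev (prod b (Z - {z})) x * (ev (b z) x * z) \<in> Lam x S C"
      by (rule_tac Lam_ev) (auto simp: C_def)
    then show ?thesis by (simp add: B ev_mult mult.assoc)
  qed
  moreover have "B \<noteq> 0" using bc(1) assms(2) by (simp add: B_def)
  ultimately show ?thesis by blast
qed

text \<open>Pigeonhole: the combinations of the \<open>f ^ a * z\<close> with \<open>a \<le> T\<close> outnumber the lattice points
  that they can hit, if \<open>T\<close> is large.\<close>

lemma rank_le_if_lattice:
  assumes x: "\<not> algebraic_elt \<iota> x" and S: "spans x S" and d: "d \<noteq> 0" "degree d \<le> C"
    and f: "\<And>m h. h \<in> Lam x S m \<Longrightarrow> ev d x * f * h \<in> Lam x S (m + C)"
  shows "rank_le f (card S * C)"
  unfolding rank_le_def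
proof (intro allI impI)
  fix Z :: "'a set" assume Z: "finite Z" "card S * C < card Z"
  have finS: "finite S" using S by (simp add: spans_def)
  obtain b C0 where b: "b \<noteq> 0" "\<forall>z\<in>Z. ev b x * z \<in> Lam x S C0"
    using common_denominator[OF S Z(1)] by blast
  \<comment> \<open>Then \<open>card S * (C0 + T * C + 1) = card S * C * T + T\<close>, which stays
    below \<open>(card S * C + 1) * (T + 1)\<close>, hence below
    \<open>card Z * (T + 1)\<close>.\<close>
  define T where "T = card S * (C0 + 1)"
  \<comment> \<open>Each factor \<open>d(x)\<close> either absorbs one factor \<open>f\<close> or
    merely multiplies; both raise the degree by at most \<open>C\<close>. So \<open>k\<close>
    factors handle all exponents up to \<open>k\<close> at once.\<close>
  have lat: "a \<le> k \<Longrightarrow> ev d x ^ k * ev b x * (f ^ a * z) \<in> Lam x S (C0 + k * C)"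
    if z: "z \<in> Z" for a k z
  proof (induction k arbitrary: a)
    case 0
    then show ?case using b(2) z by simp
  next
    case (Suc k)
    show ?case
    proof (cases "a \<le> k")
      case True
      have "ev d x * (ev d x ^ k * ev b x * (f ^ a * z)) \<in> Lam x S (C0 + Suc k * C)"
        using Suc.IH[OF True] d(2) by (rule_tac Lam_ev) auto
      then show ?thesis by (simp add: mult.assoc)
    next
      case False
      then have a: "a = Suc k" using Suc.prems by simp
      have "ev d x * f * (ev d x ^ k * ev b x * (f ^ k * z)) \<in> Lam x S (C0 + k * C + C)"
        by (intro f Suc.IH) simp
      then show ?thesis by (simp add: a ac_simps)
    qed
  qed
  define E where "E = ev d x ^ T * ev b x"
  have E: "E \<noteq> 0" using ev_nonzero[OF x] b(1) d(1) by (simp add: E_def)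
  let ?D = "Z \<times> {..T}"
  let ?F = "?D \<rightarrow>\<^sub>E (UNIV :: 'k set)"
  define \<Phi> where "\<Phi> c = E * (\<Sum>(z, a)\<in>?D. \<iota> (c (z, a)) * (f ^ a * z))" for c
  have "\<Phi> c \<in> Lam x S (C0 + T * C)" for c
  proof -
    have "\<Phi> c = (\<Sum>(z, a)\<in>?D. \<iota> (c (z, a)) * (ev d x ^ T * ev b x * (f ^ a * z)))"
      by (simp add: \<Phi>_def E_def sum_distrib_left case_prod_unfold ac_simps)
    also have "\<dots> \<in> Lam x S (C0 + T * C)"
      by (intro Lam_sum) (auto intro!: Lam_embed lat)
    finally show ?thesis .
  qed
  then have "card (\<Phi> ` ?F) \<le> card (Lam x S (C0 + T * C))"
    using card_Lam_le(1)[OF finS] by (intro card_mono) auto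
  also have "\<dots> \<le> CARD('k) ^ (card S * (C0 + T * C + 1))"
    by (rule card_Lam_le(2)[OF finS])
  also have "\<dots> < CARD('k) ^ (card Z * (T + 1))"
  proof (rule power_strict_increasing)
    have "card S * (C0 + T * C + 1) = card S * C * T + T"
      by (simp add: T_def algebra_simps)
    also have "\<dots> < (card S * C + 1) * (T + 1)" by simp
    also have "\<dots> \<le> card Z * (T + 1)"
      using Z(2) by (intro mult_right_mono) auto
    finally show "card S * (C0 + T * C + 1) < card Z * (T + 1)" .
  qed (use card_constants_ge_2 in linarith)
  also have "\<dots> = card ?F"
    using Z(1) by (subst card_PiE) (simp_all add: card_cartesian_product)
  finally have "\<not> inj_on \<Phi> ?F" by (rule pigeonhole)
  then obtain c c' where c: "c \<in> ?F" "c' \<in> ?F" "c \<noteq> c'" "\<Phi> c = \<Phi> c'"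
    by (auto simp: inj_on_def)
  \<comment> \<open>Two colliding coefficient families differ by a relation with polynomial
    coefficients in \<open>f\<close>.\<close>
  define a where "a z = (\<Sum>i\<le>T. monom (c (z, i) - c' (z, i)) i)" for z
  have "\<exists>z\<in>Z. a z \<noteq> 0"
  proof (rule ccontr)
    assume neg: "\<not> (\<exists>z\<in>Z. a z \<noteq> 0)"
    have "c (z, i) = c' (z, i)" if "z \<in> Z" "i \<le> T" for z i
    proof -
      have "coeff (a z) i = c (z, i) - c' (z, i)"
        using that by (simp add: a_def coeff_sum if_distrib sum.delta cong: if_cong)
      then show ?thesis using neg that by simp
    qed
    then have "c = c'" using c by (intro PiE_ext[of c _ _ c']) auto
    with c show False by simp
  qed
  moreover have "(\<Sum>z\<in>Z. ev (a z) f * z) = 0"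
  proof -
    have "(\<Sum>z\<in>Z. ev (a z) f * z) =
      (\<Sum>(z, i)\<in>?D. \<iota> (c (z, i)) * (f ^ i * z)) - (\<Sum>(z, i)\<in>?D. \<iota> (c' (z, i)) * (f ^ i * z))"
      by (simp add: a_def ev_sum ev_monom embed_diff sum_distrib_right sum_distrib_left algebra_simps
          sum.cartesian_product[symmetric] sum_subtractf)
    then show ?thesis using c(4) E by (simp add: \<Phi>_def)
  qed
  ultimately show "\<exists>a. (\<exists>z\<in>Z. a z \<noteq> 0) \<and> (\<Sum>z\<in>Z. ev (a z) f * z) = 0" by blast
qed

text \<open>The case \<open>d = 1\<close>, \<open>C = degree p\<close>: multiplication by
  \<open>p(x)\<close> raises lattice degrees by at most \<open>degree p\<close>.\<close>

lemma rank_le_ev: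
  assumes "\<not> algebraic_elt \<iota> x" "spans x S"
  shows "rank_le (ev p x) (card S * degree p)"
  by (rule rank_le_if_lattice[OF assms, of 1]) (auto intro!: Lam_ev)

text \<open>The case \<open>d = X\<close>, \<open>C = 1\<close>: the factor \<open>x\<close> cancels
  \<open>inverse x\<close>, so lattice degrees do not grow.\<close>

lemma rank_le_inverse:
  assumes "\<not> algebraic_elt \<iota> x" "spans x S"
  shows "rank_le (inverse x) (card S)"
proof -
  have "x \<noteq> 0"
    using ev_nonzero[OF assms(1), of "[:0, 1:]"] by (simp add: embed_one)
  then have "ev [:0, 1:] x * inverse x * h \<in> Lam x S (m + 1)" if "h \<in> Lam x S m" for h m
    using Lam_mono[of m "m + 1" x S] that by (auto simp: embed_one)
  then have "rank_le (inverse x) (card S * 1)"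
    by (rule rank_le_if_lattice[OF assms, rotated 2]) auto
  then show ?thesis by simp
qed

text \<open>Here \<open>d\<close> clears the denominators of multiplication by \<open>f\<close> on
  the generators \<open>S\<close>; later only the finiteness of the bound matters.\<close>

lemma rank_le_exists:
  assumes x: "\<not> algebraic_elt \<iota> x" and S: "spans x S"
  shows "\<exists>N. rank_le f N"
proof -
  have finS: "finite S" using S by (simp add: spans_def)
  obtain b C where b: "b \<noteq> 0" "\<forall>z\<in>(\<lambda>s. f * s) ` S. ev b x * z \<in> Lam x S C"
    using common_denominator[OF S, of "(\<lambda>s. f * s) ` S"] finS by blast
  let ?C = "C + degree b"
  have "ev b x * f * h \<in> Lam x S (m + ?C)" if h: "h \<in> Lam x S m" for m h
  proof -
    obtain p where p: "h = (\<Sum>s\<in>S. ev (p s) x * s)" "\<forall>s\<in>S. degree (p s) \<le> m"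
      using h by (auto simp: Lam_def)
    have "ev b x * f * h = (\<Sum>s\<in>S. ev (p s) x * (ev b x * (f * s)))"
      by (simp add: p sum_distrib_left ac_simps)
    also have "\<dots> \<in> Lam x S (m + ?C)"
    proof (rule Lam_sum)
      fix s assume s: "s \<in> S"
      have "ev b x * (f * s) \<in> Lam x S C" using b(2) s by blast
      then show "ev (p s) x * (ev b x * (f * s)) \<in> Lam x S (m + ?C)"
        by (rule Lam_ev) (use p(2) s in force)
    qed
    finally show ?thesis .
  qed
  then show ?thesis using rank_le_if_lattice[OF x S b(1), of ?C f] by auto
qed

section \<open>Generators and bases over \<open>K(x)\<close>\<close>

lemma ex_spans:
  obtains x S where "\<not> algebraic_elt \<iota> x" "spans x S"
proof -
  obtain x S where x: "\<not> algebraic_elt \<iota> x" "finite S"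
    "\<forall>y. \<exists>c. (\<forall>s\<in>S. c s \<in> rational_functions_in \<iota> x) \<and> y = (\<Sum>s\<in>S. c s * s)"
    using finite_over_rational by (elim exE conjE)
  have "\<exists>b c. b \<noteq> 0 \<and> ev b x * y = (\<Sum>s\<in>S. ev (c s) x * s)" for y
  proof -
    obtain c where c: "\<forall>s\<in>S. c s \<in> rational_functions_in \<iota> x" "y = (\<Sum>s\<in>S. c s * s)"
      using x(3) by metis
    have "\<forall>s\<in>S. \<exists>p q. q \<noteq> 0 \<and> c s = ev p x / ev q x"
    proof
      fix s assume "s \<in> S"
      then have "c s \<in> rational_functions_in \<iota> x" using c(1) by blast
      then obtain p q where "q \<noteq> 0" "c s = ev p x / ev q x"
        unfolding rational_functions_in_def ev_def by blast
      then show "\<exists>p q. q \<noteq> 0 \<and> c s = ev p x / ev q x" by blast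
    qed
    then obtain p where "\<forall>s\<in>S. \<exists>q. q \<noteq> 0 \<and> c s = ev (p s) x / ev q x"
      unfolding bchoice_iff by blast
    then obtain q where pq: "\<And>s. s \<in> S \<Longrightarrow> q s \<noteq> 0 \<and> c s = ev (p s) x / ev (q s) x"
      unfolding bchoice_iff by blast
    have "ev (prod q S) x * y = (\<Sum>s\<in>S. ev (p s * prod q (S - {s})) x * s)"
      unfolding c(2) sum_distrib_left
    proof (rule sum.cong)
      fix s assume s: "s \<in> S"
      have "ev (prod q S) x = ev (q s) x * ev (prod q (S - {s})) x"
        using s x(2) by (simp add: prod.remove[of S s] ev_mult)
      then show "ev (prod q S) x * (c s * s) = ev (p s * prod q (S - {s})) x * s"
        using pq[OF s] ev_nonzero[OF x(1), of "q s"] by (simp add: ev_mult)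
    qed simp
    moreover have "prod q S \<noteq> 0" using pq x(2) by simp
    ultimately show ?thesis by (intro exI conjI)
  qed
  then have "spans x S" using x(2) by (simp add: spans_def)
  with x(1) that show thesis by blast
qed

text \<open>A spanning set of least size is independent: a relation with
  \<open>c r \<noteq> 0\<close> eliminates \<open>r\<close> after multiplication by
  \<open>c r\<close>.\<close>

lemma ex_basis:
  obtains x S where "\<not> algebraic_elt \<iota> x" "spans x S"
    "\<forall>c. (\<Sum>s\<in>S. ev (c s) x * s) = 0 \<longrightarrow> (\<forall>s\<in>S. c s = 0)"
proof -
  obtain x S0 where x: "\<not> algebraic_elt \<iota> x" and S0: "spans x S0" using ex_spans .
  obtain S where S: "spans x S" and min: "\<And>S'. spans x S' \<Longrightarrow> card S \<le> card S'"
    using ex_has_least_nat[of "spans x" S0 card] S0 by blast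
  have finS: "finite S" using S by (simp add: spans_def)
  have "\<forall>s\<in>S. c s = 0" if c: "(\<Sum>s\<in>S. ev (c s) x * s) = 0" for c
  proof (rule ccontr)
    assume "\<not> (\<forall>s\<in>S. c s = 0)"
    then obtain r where r: "r \<in> S" "c r \<noteq> 0" by blast
    have "\<exists>b a. b \<noteq> 0 \<and> ev b x * y = (\<Sum>s\<in>S - {r}. ev (a s) x * s)" for y
    proof -
      obtain b a where ba: "b \<noteq> 0" "ev b x * y = (\<Sum>s\<in>S. ev (a s) x * s)"
        using S by (metis spans_def)
      have "ev (c r * b) x * y
          = ev (c r) x * (\<Sum>s\<in>S. ev (a s) x * s) - ev (a r) x * (\<Sum>s\<in>S. ev (c s) x * s)"
        using c by (simp add: ev_mult mult.assoc ba)
      also have "\<dots> = (\<Sum>s\<in>S. ev (c r * a s - a r * c s) x * s)"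
        by (simp add: sum_distrib_left ev_diff ev_mult algebra_simps sum_subtractf)
      also have "\<dots> = (\<Sum>s\<in>S - {r}. ev (c r * a s - a r * c s) x * s)"
        using finS r(1) by (subst sum.remove[of S r]) (auto simp: mult.commute)
      finally show ?thesis using r ba(1) by (intro exI[of _ "c r * b"] exI) auto
    qed
    then have "spans x (S - {r})" using finS by (simp add: spans_def)
    then have "card S \<le> card (S - {r})" by (rule min)
    then show False using r finS by (meson card_Diff1_less not_less)
  qed
  with x S that show thesis by blast
qed

lemma ex_rank_le: "\<exists>N. rank_le f N"
  using ex_spans rank_le_exists by metis

section \<open>Linear dependence modulo \<open>y\<close> in modules over \<open>K[y]\<close>\<close>

lemma ev_closed:
  assumes "0 \<in> W" "\<And>a b. a \<in> W \<Longrightarrow> b \<in> W \<Longrightarrow> a + b \<in> W"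
    "\<And>c a. a \<in> W \<Longrightarrow> \<iota> c * a \<in> W" "\<And>a. a \<in> W \<Longrightarrow> y * a \<in> W" "w \<in> W"
  shows "ev p y * w \<in> W"
proof (induction p)
  case (pCons c p)
  have "\<iota> c * w + y * (ev p y * w) \<in> W" using assms pCons by blast
  then show ?case by (simp add: algebra_simps)
qed (use assms in simp)

lemma sum_closed:
  assumes "0 \<in> W" "\<And>a b. a \<in> W \<Longrightarrow> b \<in> W \<Longrightarrow> a + b \<in> W" "\<And>i. i \<in> A \<Longrightarrow> h i \<in> W"
  shows "sum h A \<in> (W :: 'a set)"
  using assms(3) by (induction A rule: infinite_finite_induct) (auto intro: assms(1,2))

text \<open>A relation with coefficients in \<open>K[y]\<close>, divided by the largest possible power of \<open>y\<close>,
  remains nontrivial modulo \<open>y\<close>.\<close>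

lemma dependent_mod:
  assumes y: "rank_le y N" "y \<noteq> 0"
    and W: "0 \<in> W" "\<And>a b. a \<in> W \<Longrightarrow> b \<in> W \<Longrightarrow> a + b \<in> W"
      "\<And>c a. a \<in> W \<Longrightarrow> \<iota> c * a \<in> W" "\<And>a. a \<in> W \<Longrightarrow> y * a \<in> W"
    and Z: "finite Z" "Z \<subseteq> W" "N < card Z"
  shows "\<exists>c. (\<exists>z\<in>Z. c z \<noteq> 0) \<and> (\<exists>w\<in>W. (\<Sum>z\<in>Z. \<iota> (c z) * z) = y * w)"
proof -
  have "\<exists>a. (\<exists>z\<in>Z. a z \<noteq> 0) \<and> (\<Sum>z\<in>Z. ev (a z) y * z) = 0"
    using y(1) Z by (simp add: rank_le_def)
  then obtain a0 where a0: "\<exists>z\<in>Z. a0 z \<noteq> 0" "(\<Sum>z\<in>Z. ev (a0 z) y * z) = 0" by blast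
  \<comment> \<open>Least total degree replaces division by a power of \<open>y\<close>: were all
    constant terms zero, the quotients \<open>p z\<close> would form a smaller relation.\<close>
  then obtain a where a: "\<exists>z\<in>Z. a z \<noteq> 0" "(\<Sum>z\<in>Z. ev (a z) y * z) = 0"
    and min: "\<And>a'. \<exists>z\<in>Z. a' z \<noteq> 0 \<Longrightarrow> (\<Sum>z\<in>Z. ev (a' z) y * z) = 0 \<Longrightarrow>
      (\<Sum>z\<in>Z. degree (a z)) \<le> (\<Sum>z\<in>Z. degree (a' z))"
    using ex_has_least_nat[of "\<lambda>a. (\<exists>z\<in>Z. a z \<noteq> 0) \<and> (\<Sum>z\<in>Z. ev (a z) y * z) = 0" a0
        "\<lambda>a. \<Sum>z\<in>Z. degree (a z)"] by blast
  have "\<forall>z. \<exists>c p. a z = pCons c p" using pCons_cases by metis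
  then obtain c p where cp: "\<And>z. a z = pCons (c z) (p z)" by metis
  let ?w = "\<Sum>z\<in>Z. ev (p z) y * z"
  have w: "(\<Sum>z\<in>Z. \<iota> (c z) * z) + y * ?w = 0"
    using a(2) by (simp add: cp sum_distrib_left algebra_simps sum.distrib)
  have "\<exists>z\<in>Z. c z \<noteq> 0"
  proof (rule ccontr)
    assume neg: "\<not> (\<exists>z\<in>Z. c z \<noteq> 0)"
    then have ne: "\<exists>z\<in>Z. p z \<noteq> 0" using a(1) cp by auto
    have "?w = 0" using w neg y(2) by simp
    then have "(\<Sum>z\<in>Z. degree (a z)) \<le> (\<Sum>z\<in>Z. degree (p z))" using min ne by blast
    moreover have "(\<Sum>z\<in>Z. degree (p z)) < (\<Sum>z\<in>Z. degree (a z))"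
      using Z(1) ne by (intro sum_strict_mono_ex1) (auto simp: cp)
    ultimately show False by simp
  qed
  moreover have "- ?w \<in> W"
  proof -
    have "\<iota> (-1) * ?w \<in> W"
      using Z(2) W by (intro W(3) sum_closed W(1,2) ev_closed) auto
    then show ?thesis by (simp add: embed_uminus embed_one)
  qed
  moreover have "(\<Sum>z\<in>Z. \<iota> (c z) * z) = y * - ?w"
    using w by (simp add: eq_neg_iff_add_eq_0)
  ultimately show ?thesis by blast
qed

end

section \<open>Existence of zeros\<close>

text \<open>A valuation ring containing the constants, not yet known to be discrete; discreteness
  will come from \<open>rank_le\<close>.\<close>

locale val_ring = curve \<iota> for \<iota> :: "'k::{field,finite} \<Rightarrow> 'a::field" +
  fixes M :: "'a set"
  assumes M_embed: "\<iota> c \<in> M"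
    and M_add: "a \<in> M \<Longrightarrow> b \<in> M \<Longrightarrow> a + b \<in> M"
    and M_mult: "a \<in> M \<Longrightarrow> b \<in> M \<Longrightarrow> a * b \<in> M"
    and M_total: "u \<in> M \<or> inverse u \<in> M"
begin

text \<open>The maximal ideal of \<open>M\<close>. Zero is listed separately because
  \<open>inverse 0 = 0\<close> lies in \<open>M\<close>.\<close>

definition nonunits :: "'a set" where
  "nonunits = {u \<in> M. u = 0 \<or> inverse u \<notin> M}"

lemma M_0: "0 \<in> M" and M_1: "1 \<in> M"
  using M_embed[of 0] M_embed[of 1] by (simp_all add: embed_one)

lemma M_power: "a \<in> M \<Longrightarrow> a ^ n \<in> M"
  by (induction n) (auto intro: M_mult M_1)

lemma nonunits_0: "0 \<in> nonunits"
  by (simp add: nonunits_def M_0)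

lemma nonunits_M: "a \<in> nonunits \<Longrightarrow> a \<in> M"
  by (simp add: nonunits_def)

lemma nonunits_mult:
  assumes "a \<in> nonunits" "r \<in> M"
  shows "a * r \<in> nonunits" "r * a \<in> nonunits"
proof -
  show "a * r \<in> nonunits"
  proof (cases "a * r = 0")
    case False
    have "inverse a \<in> M" if "inverse (a * r) \<in> M"
      using M_mult[OF assms(2) that] False by (simp add: field_simps)
    then show ?thesis using assms False M_mult by (auto simp: nonunits_def)
  qed (use M_0 in \<open>auto simp: nonunits_def\<close>)
  then show "r * a \<in> nonunits" by (simp add: mult.commute)
qed

text \<open>By totality one of \<open>a / b\<close>, \<open>b / a\<close> lies in \<open>M\<close>,
  so the sum is an \<open>M\<close>-multiple of one of the summands.\<close>

lemma nonunits_add: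
  assumes "a \<in> nonunits" "b \<in> nonunits"
  shows "a + b \<in> nonunits"
proof -
  have *: "a + b \<in> nonunits" if ab: "b \<in> nonunits" "b \<noteq> 0" "a / b \<in> M" for a b
  proof -
    have "b * (a / b + 1) \<in> nonunits"
      using ab by (intro nonunits_mult M_add M_1) auto
    moreover have "b * (a / b + 1) = a + b" using ab by (simp add: distrib_left)
    ultimately show ?thesis by simp
  qed
  consider "a = 0" | "b = 0" | "a \<noteq> 0" "b \<noteq> 0" "a / b \<in> M" | "a \<noteq> 0" "b \<noteq> 0" "b / a \<in> M"
    using M_total[of "a / b"] by auto
  then show ?thesis
    using assms *[of a b] *[of b a] by cases (auto simp: add.commute)
qed

lemma nonunits_sum: "(\<And>i. i \<in> A \<Longrightarrow> h i \<in> nonunits) \<Longrightarrow> sum h A \<in> nonunits"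
  by (rule sum_closed) (auto intro: nonunits_0 nonunits_add)

lemma nonunits_uminus: "a \<in> nonunits \<Longrightarrow> - a \<in> nonunits"
  using nonunits_mult(2)[of a "\<iota> (-1)"] M_embed[of "-1"] by (simp add: embed_uminus embed_one)

lemma embed_nonunits: "\<iota> c \<in> nonunits \<longleftrightarrow> c = 0"
  using M_embed[of "inverse c"] by (auto simp: nonunits_def M_0 embed_inverse)

lemma divide_nonunits_if_not_M: "u / t \<notin> M \<Longrightarrow> t / u \<in> nonunits"
  using M_total[of "u / t"] by (auto simp: nonunits_def)

text \<open>Otherwise a sequence in the ideal starts at \<open>z\<close> and has strictly decreasing
  values. Finite degree over \<open>K(z)\<close> makes \<open>N + 1\<close> of its members dependent
  modulo \<open>z\<close> times the ideal, and dividing by the dominant term puts a nonzero constant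
  into the ideal.\<close>

lemma ex_uniformizer:
  assumes z: "z \<in> nonunits" "z \<noteq> 0"
  shows "\<exists>t. t \<in> nonunits \<and> t \<noteq> 0 \<and> (\<forall>u\<in>nonunits. u / t \<in> M)"
proof (rule ccontr)
  assume neg: "\<not> ?thesis"
  have step: "\<exists>u. (u \<in> nonunits \<and> u \<noteq> 0) \<and> t / u \<in> nonunits"
    if t: "t \<in> nonunits \<and> t \<noteq> 0" for t
  proof -
    obtain u where u: "u \<in> nonunits" "u / t \<notin> M" using neg t by blast
    then have "u \<noteq> 0" using M_0 by auto
    then show ?thesis using u divide_nonunits_if_not_M by blast
  qed
  obtain x where x: "\<And>n. x n \<in> nonunits \<and> x n \<noteq> 0" "\<And>n. x n / x (Suc n) \<in> nonunits" "x 0 = z"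
    using dependent_nat_choice[of "\<lambda>n u. u \<in> nonunits \<and> u \<noteq> 0 \<and> (n = 0 \<longrightarrow> u = z)"
        "\<lambda>n t u. t / u \<in> nonunits"] z step by (metis nat.simps(3))
  have chain: "x i / x (i + Suc k) \<in> nonunits" for i k
  proof (induction k)
    case (Suc k)
    have "x i / x (i + Suc k) * (x (i + Suc k) / x (i + Suc (Suc k))) \<in> nonunits"
      using x(2)[of "i + Suc k"] by (intro nonunits_mult(1) Suc.IH nonunits_M) simp
    then show ?case using x(1) by simp
  qed (use x(2) in simp)
  have less: "x i / x j \<in> nonunits" if "i < j" for i j
    using chain[of i "j - i - 1"] that by simp
  have one: "1 \<notin> nonunits" using embed_nonunits[of 1] by (simp add: embed_one)
  have inj: "inj x"
  proof (rule linorder_injI)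
    fix i j :: nat assume "i < j"
    then show "x i \<noteq> x j" using less[of i j] one x(1) by auto
  qed
  obtain N where N: "rank_le z N" using ex_rank_le by blast
  let ?Z = "x ` {..N}"
  have "\<exists>c. (\<exists>u\<in>?Z. c u \<noteq> 0) \<and> (\<exists>w\<in>nonunits. (\<Sum>u\<in>?Z. \<iota> (c u) * u) = z * w)"
    using x(1) inj z
    by (intro dependent_mod[OF N] nonunits_0 nonunits_add nonunits_mult M_embed)
      (auto simp: card_image inj_on_subset nonunits_M)
  then obtain c w where c: "\<exists>u\<in>?Z. c u \<noteq> 0" and w: "w \<in> nonunits"
    and sum: "(\<Sum>i\<le>N. \<iota> (c (x i)) * x i) = z * w"
    using inj by (auto simp: sum.reindex inj_on_subset)
  let ?J = "{i. i \<le> N \<and> c (x i) \<noteq> 0}"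
  \<comment> \<open>Values decrease with the index, so the last term with a nonzero coefficient
    dominates, while \<open>z / x j\<close> stays in \<open>M\<close>.\<close>
  define j where "j = Max ?J"
  have fin: "finite ?J" and ne: "?J \<noteq> {}" using c by auto
  have j: "j \<le> N" "c (x j) \<noteq> 0" using Max_in[OF fin ne] by (auto simp: j_def)
  have jmax: "c (x i) = 0" if "j < i" "i \<le> N" for i
    using Max_ge[OF fin, of i] that unfolding j_def[symmetric] by auto
  have "(\<Sum>i\<le>N. \<iota> (c (x i)) * x i) = \<iota> (c (x j)) * x j + (\<Sum>i\<in>{..N} - {j}. \<iota> (c (x i)) * x i)"
    using j by (subst sum.remove[of _ j]) auto
  then have "\<iota> (c (x j)) * x j = z * w - (\<Sum>i\<in>{..N} - {j}. \<iota> (c (x i)) * x i)"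
    using sum by (simp add: algebra_simps)
  then have "\<iota> (c (x j)) = (z * w - (\<Sum>i\<in>{..N} - {j}. \<iota> (c (x i)) * x i)) / x j"
    using x(1) by (simp add: field_simps)
  also have "\<dots> = w * (z / x j) + - (\<Sum>i\<in>{..N} - {j}. \<iota> (c (x i)) * (x i / x j))"
    by (simp add: diff_divide_distrib sum_divide_distrib)
  also have "\<dots> \<in> nonunits"
  proof (intro nonunits_add nonunits_uminus nonunits_sum nonunits_mult(1)[OF w])
    show "z / x j \<in> M"
      using less[of 0 j] nonunits_M M_1 x by (cases "j = 0") auto
    fix i assume i: "i \<in> {..N} - {j}"
    show "\<iota> (c (x i)) * (x i / x j) \<in> nonunits"
    proof (cases "i < j")
      case True
      then show ?thesis by (intro nonunits_mult(2) less M_embed)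
    next
      case False
      then show ?thesis using jmax[of i] i nonunits_0 by auto
    qed
  qed
  finally show False using j(2) by (simp add: embed_nonunits)
qed

text \<open>If all \<open>f / t ^ k\<close> lay in \<open>M\<close>, the powers of \<open>t\<close>
  would be dependent modulo \<open>f * M\<close>. The lowest surviving power \<open>t ^ j\<close>
  would then be a combination of elements of higher value, as \<open>f\<close> is divisible by
  \<open>t ^ Suc j\<close>.\<close>

lemma ex_order:
  assumes t: "t \<in> nonunits" "t \<noteq> 0" and f: "f \<noteq> 0"
  shows "\<exists>k. f / t ^ k \<notin> M"
proof (rule ccontr)
  assume "\<nexists>k. f / t ^ k \<notin> M"
  then have all: "f / t ^ k \<in> M" for k by blast
  have one: "1 \<notin> nonunits" using embed_nonunits[of 1] by (simp add: embed_one)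
  have pow: "t ^ Suc k \<in> nonunits" for k
    using nonunits_mult(1)[OF t(1) M_power[of t k]] t nonunits_M by simp
  have inj: "inj (\<lambda>i. t ^ i)"
  proof (rule linorder_injI)
    fix i j :: nat assume ij: "i < j"
    then have "t ^ j = t ^ i * t ^ Suc (j - i - 1)" by (simp flip: power_add power_Suc)
    then show "t ^ i \<noteq> t ^ j" using pow[of "j - i - 1"] one t by auto
  qed
  obtain N where N: "rank_le f N" using ex_rank_le by blast
  let ?Z = "(\<lambda>i. t ^ i) ` {..N}"
  have "\<exists>c. (\<exists>u\<in>?Z. c u \<noteq> 0) \<and> (\<exists>w\<in>M. (\<Sum>u\<in>?Z. \<iota> (c u) * u) = f * w)"
    using all[of 0] f inj M_power[OF nonunits_M[OF t(1)]]
    by (intro dependent_mod[OF N] M_0 M_add M_mult M_embed)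
      (auto simp: card_image inj_on_subset)
  then obtain c w where c: "\<exists>u\<in>?Z. c u \<noteq> 0" and w: "w \<in> M"
    and sum: "(\<Sum>i\<le>N. \<iota> (c (t ^ i)) * t ^ i) = f * w"
    using inj by (auto simp: sum.reindex inj_on_subset)
  let ?J = "{i. i \<le> N \<and> c (t ^ i) \<noteq> 0}"
  define j where "j = Min ?J"
  have fin: "finite ?J" and ne: "?J \<noteq> {}" using c by auto
  have j: "j \<le> N" "c (t ^ j) \<noteq> 0" using Min_in[OF fin ne] by (auto simp: j_def)
  have jmin: "c (t ^ i) = 0" if "i < j" for i
    using Min_le[OF fin, of i] that j(1) unfolding j_def[symmetric] by auto
  have "(\<Sum>i\<le>N. \<iota> (c (t ^ i)) * t ^ i)
      = \<iota> (c (t ^ j)) * t ^ j + (\<Sum>i\<in>{..N} - {j}. \<iota> (c (t ^ i)) * t ^ i)"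
    using j by (subst sum.remove[of _ j]) auto
  then have "\<iota> (c (t ^ j)) * t ^ j = f * w - (\<Sum>i\<in>{..N} - {j}. \<iota> (c (t ^ i)) * t ^ i)"
    using sum by (simp add: algebra_simps)
  then have "\<iota> (c (t ^ j)) = (f * w - (\<Sum>i\<in>{..N} - {j}. \<iota> (c (t ^ i)) * t ^ i)) / t ^ j"
    using t by (simp add: field_simps)
  also have "\<dots> = t * (f / t ^ Suc j * w) + - (\<Sum>i\<in>{..N} - {j}. \<iota> (c (t ^ i)) * (t ^ i / t ^ j))"
    using t by (simp add: diff_divide_distrib sum_divide_distrib)
  also have "\<dots> \<in> nonunits"
  proof (intro nonunits_add nonunits_uminus nonunits_sum nonunits_mult(1)[OF t(1)] M_mult all w)
    fix i assume i: "i \<in> {..N} - {j}"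
    show "\<iota> (c (t ^ i)) * (t ^ i / t ^ j) \<in> nonunits"
    proof (cases "j < i")
      case True
      then have "i = j + Suc (i - j - 1)" by simp
      then have "t ^ i / t ^ j = t ^ Suc (i - j - 1)"
        using t by (metis nonzero_mult_div_cancel_left power_add power_not_zero)
      then show ?thesis using nonunits_mult(2)[OF pow M_embed] by simp
    next
      case False
      then show ?thesis using jmin[of i] i nonunits_0 by auto
    qed
  qed
  finally show False using j(2) by (simp add: embed_nonunits)
qed

text \<open>A principal maximal ideal and finite orders write every nonzero \<open>f\<close> as a
  power of \<open>t\<close> times a unit of \<open>M\<close>; the exponent is the required
  normalized valuation.\<close>

lemma ex_point:
  assumes z: "z \<in> nonunits" "z \<noteq> 0"
  shows "\<exists>v\<in>points \<iota>. 0 < v z"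
proof -
  obtain t where t: "t \<in> nonunits" "t \<noteq> 0" "\<And>u. u \<in> nonunits \<Longrightarrow> u / t \<in> M"
    using ex_uniformizer[OF z] by blast
  define U where "U = {u. u \<noteq> 0 \<and> u \<in> M \<and> inverse u \<in> M}"
  have U_mult: "a * b \<in> U" if "a \<in> U" "b \<in> U" for a b
    using that by (auto simp: U_def M_mult)
  have U_inv: "inverse a \<in> U" if "a \<in> U" for a
    using that by (auto simp: U_def)
  have U_nonunit: "a \<notin> nonunits" if "a \<in> U" for a
    using that by (auto simp: U_def nonunits_def)
  have tM: "t powi k \<in> M" if "0 \<le> k" for k
    using that t(1) by (auto simp: power_int_def intro: M_power nonunits_M)
  have tnon: "t powi k \<in> nonunits" if "0 < k" for k
  proof -
    have "t powi k = t * t powi (k - 1)"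
      using t(2) power_int_add[of t 1 "k - 1"] by simp
    then show ?thesis using nonunits_mult(1)[OF t(1) tM[of "k - 1"]] that by simp
  qed
  have uniq: "k = 0" if "t powi k \<in> U" for k
  proof (rule ccontr)
    assume "k \<noteq> 0"
    then consider "0 < k" | "0 < - k" by linarith
    then show False
      using tnon[of k] tnon[of "- k"] U_nonunit that U_inv[OF that]
      by cases (auto simp: power_int_minus)
  qed
  have exM: "\<exists>k\<ge>0. f * t powi (- k) \<in> U" if f: "f \<in> M" "f \<noteq> 0" for f
  proof -
    \<comment> \<open>The last quotient \<open>f / t ^ k\<close> still in \<open>M\<close> is a
      unit: as a nonunit it could be divided by \<open>t\<close> once more.\<close>
    obtain n where n: "f / t ^ n \<notin> M" and least: "\<And>i. i < n \<Longrightarrow> f / t ^ i \<in> M"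
      using ex_order[OF t(1,2) f(2)] exists_least_iff[of "\<lambda>k. f / t ^ k \<notin> M"] by blast
    then have "n \<noteq> 0" using f by (metis div_by_1 power_0)
    then obtain k where k: "n = Suc k" using not0_implies_Suc by blast
    have "f / t ^ k / t \<notin> M" using n by (simp add: k mult.commute)
    then have "f / t ^ k \<notin> nonunits" using t(3) by blast
    then have "f / t ^ k \<in> U" using least[of k] f t(2) by (auto simp: k U_def nonunits_def)
    moreover have "f / t ^ k = f * t powi (- int k)"
      by (simp add: power_int_minus divide_inverse)
    ultimately show ?thesis by (intro exI[of _ "int k"]) auto
  qed
  have ex: "\<exists>k. f * t powi (- k) \<in> U" if f: "f \<noteq> 0" for f
  proof (cases "f \<in> M")
    case False
    then obtain k where "inverse f * t powi (- k) \<in> U"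
      using exM[of "inverse f"] f M_total[of f] by auto
    then have "f * t powi (- (- k)) \<in> U"
      using U_inv by (fastforce simp: power_int_minus)
    then show ?thesis by blast
  qed (use exM f in blast)
  \<comment> \<open>The value \<open>0\<close> at \<open>0\<close> is the junk value demanded by
    \<open>points\<close>.\<close>
  define v where "v f = (if f = 0 then 0 else THE k. f * t powi (- k) \<in> U)" for f
  have vI: "v f = k" if "f * t powi (- k) \<in> U" for f k
  proof -
    have "f \<noteq> 0" using that by (auto simp: U_def)
    moreover have "k' = k" if k': "f * t powi (- k') \<in> U" for k'
    proof -
      have "f * t powi (- k) * inverse (f * t powi (- k')) \<in> U"
        by (rule U_mult[OF \<open>f * t powi (- k) \<in> U\<close> U_inv[OF k']])
      moreover have "f * t powi (- k) * inverse (f * t powi (- k')) = t powi (- k) * t powi k'"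
        using \<open>f \<noteq> 0\<close> by (simp add: power_int_minus)
      moreover have "\<dots> = t powi (- k + k')"
        using t(2) by (intro power_int_add[symmetric]) simp
      ultimately have "t powi (- k + k') \<in> U" by metis
      then show ?thesis using uniq[of "- k + k'"] by linarith
    qed
    ultimately have "(THE k. f * t powi (- k) \<in> U) = k"
      using that by (rule_tac the_equality)
    then show ?thesis using \<open>f \<noteq> 0\<close> by (simp only: v_def if_False)
  qed
  have vU: "f * t powi (- v f) \<in> U" if f: "f \<noteq> 0" for f
  proof -
    obtain k where k: "f * t powi (- k) \<in> U" using ex[OF f] by blast
    then show ?thesis by (simp only: vI[OF k])
  qed
  have vM: "0 \<le> v f" if f: "f \<in> M" "f \<noteq> 0" for f
  proof -
    obtain k where k: "0 \<le> k" "f * t powi (- k) \<in> U" using exM[OF f] by blast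
    then show ?thesis by (simp only: vI[OF k(2)])
  qed
  have decomp: "\<exists>u\<in>U. f = t powi v f * u" if "f \<noteq> 0" for f
  proof (rule bexI)
    show "f = t powi v f * (f * t powi (- v f))"
      using t(2) by (simp add: power_int_minus)
  qed (rule vU[OF that])
  have mult: "v (f * h) = v f + v h" if "f \<noteq> 0" "h \<noteq> 0" for f h
  proof (rule vI)
    have "f * h * t powi (- (v f + v h)) = (f * t powi (- v f)) * (h * t powi (- v h))"
      using t(2) power_int_add[of t "- v f" "- v h"] by simp
    then show "f * h * t powi (- (v f + v h)) \<in> U"
      using U_mult[OF vU[OF that(1)] vU[OF that(2)]] by (simp only:)
  qed
  have vt: "v (t powi k) = k" for k
    using t(2) by (intro vI) (simp add: U_def M_1 power_int_minus)
  have add: "min (v f) (v h) \<le> v (f + h)" if fh: "f \<noteq> 0" "h \<noteq> 0" "f + h \<noteq> 0" for f h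
  proof -
    have *: "v f \<le> v (f + h)" if fh: "f \<noteq> 0" "h \<noteq> 0" "f + h \<noteq> 0" "v f \<le> v h" for f h
    proof -
      obtain u where u: "u \<in> U" "f = t powi v f * u" using decomp fh(1) by blast
      obtain u' where u': "u' \<in> U" "h = t powi v h * u'" using decomp fh(2) by blast
      \<comment> \<open>The smaller power of \<open>t\<close> is factored out of
        \<open>f + h\<close>; the cofactor \<open>y\<close> lies in \<open>M\<close> and so has
        nonnegative value.\<close>
      define y where "y = u + t powi (v h - v f) * u'"
      have yM: "y \<in> M"
        unfolding y_def using u(1) u'(1) fh(4) by (intro M_add M_mult tM) (simp_all add: U_def)
      have "t powi v h = t powi v f * t powi (v h - v f)"
        using t(2) power_int_add[of t "v f" "v h - v f"] by simp
      then have "t powi v f * y = t powi v f * u + t powi v h * u'"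
        by (simp add: y_def distrib_left mult.assoc)
      then have eq: "t powi v f * y = f + h" using u(2) u'(2) by simp
      then have "y \<noteq> 0" using fh(3) by auto
      have "t powi v f \<noteq> 0" using t(2) by simp
      from mult[OF this \<open>y \<noteq> 0\<close>] have "v (f + h) = v f + v y"
        by (simp only: eq vt)
      then show ?thesis using vM[OF yM \<open>y \<noteq> 0\<close>] by simp
    qed
    show ?thesis
      using *[of f h] *[of h f] fh by (cases "v f \<le> v h") (auto simp: add.commute)
  qed
  have "v (\<iota> c) = 0" if "c \<noteq> 0" for c
    using that M_embed[of "inverse c"] by (intro vI) (auto simp: U_def M_embed embed_inverse)
  moreover have "v t = 1" using vt[of 1] by simp
  ultimately have "v \<in> points \<iota>"
    unfolding points_def using mult add t(2) v_def[of 0]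
    by (intro CollectI conjI allI impI exI[of _ t]) simp_all
  moreover have "0 < v z"
  proof -
    have "v z \<noteq> 0"
    proof
      assume "v z = 0"
      then have "z \<in> U" using vU[OF z(2)] by simp
      then show False using U_nonunit z(1) by blast
    qed
    moreover have "0 \<le> v z" by (rule vM[OF nonunits_M[OF z(1)] z(2)])
    ultimately show ?thesis by linarith
  qed
  ultimately show ?thesis by blast
qed

end

context curve
begin

section \<open>Chevalley's construction of a valuation ring\<close>

definition adjoin :: "'a set \<Rightarrow> 'a \<Rightarrow> 'a set" where
  "adjoin M u = {poly p u | p. \<forall>i. coeff p i \<in> M}"

text \<open>Chevalley's reduction: the highest term of the first relation is eliminated by means of the
  second one.\<close>

lemma reduce_relation:
  fixes M :: "'a set"
  assumes M: "0 \<in> M" "1 \<in> M" "\<And>a b. a \<in> M \<Longrightarrow> b \<in> M \<Longrightarrow> a + b \<in> M"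
      "\<And>a b. a \<in> M \<Longrightarrow> b \<in> M \<Longrightarrow> a * b \<in> M" "\<And>a. a \<in> M \<Longrightarrow> - a \<in> M"
    and z: "z \<in> M" "inverse z \<notin> M" and u: "u \<noteq> 0"
    and p: "\<forall>i. coeff p i \<in> M" "1 = z * poly p u"
    and r: "\<forall>i. coeff r i \<in> M" "1 = z * poly r (inverse u)"
    and deg: "degree r \<le> degree p"
  shows "\<exists>p'. (\<forall>i. coeff p' i \<in> M) \<and> 1 = z * poly p' u \<and> degree p' < degree p"
proof -
  define n where "n = degree p"
  have n: "0 < n"
  proof (rule ccontr)
    assume "\<not> 0 < n"
    then obtain a where "p = [:a:]" by (metis n_def degree_eq_zeroE neq0_conv)
    then have "1 = z * a" "a \<in> M" using p by (auto dest: spec[of _ 0])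
    then show False using z(2) inverse_unique[of z a] by simp
  qed
  \<comment> \<open>\<open>rs(u)\<close> is \<open>u ^ n * r(1/u)\<close> without its term
    \<open>coeff r 0 * u ^ n\<close>; it is a polynomial as \<open>degree r \<le> n\<close>. The
    second relation becomes \<open>(1 - z * coeff r 0) * u ^ n = z * rs(u)\<close>, which rewrites
    the top term of \<open>p\<close> in lower degree.\<close>
  define rs where "rs = (\<Sum>i\<in>{1..degree r}. monom (coeff r i) (n - i))"
  define pl where "pl = p - monom (coeff p n) n"
  \<comment> \<open>The first relation enters with weight \<open>1 - z * coeff r 0\<close>, which
    the constant term completes to \<open>1\<close>.\<close>
  define p' where "p' = [:coeff r 0:] + smult (1 - z * coeff r 0) pl + smult (coeff p n * z) rs"
  have sumM: "sum h A \<in> M" if "\<And>i. i \<in> A \<Longrightarrow> h i \<in> M" for h :: "nat \<Rightarrow> 'a" and A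
    by (rule sum_closed[OF M(1,3) that])
  have diffM: "a - b \<in> M" if "a \<in> M" "b \<in> M" for a b
    using M(3)[OF that(1) M(5)[OF that(2)]] by simp
  have rsM: "coeff rs i \<in> M" for i
    using r(1) M(1) by (auto simp: rs_def coeff_sum intro!: sumM)
  have plM: "coeff pl i \<in> M" for i
    using p(1) M(1) by (auto simp: pl_def intro!: diffM)
  have "coeff p' i \<in> M" for i
    using r(1) p(1) M(1,2) z(1) rsM plM
    by (auto simp: p'_def coeff_pCons split: nat.splits intro!: M(3,4) diffM)
  moreover have "degree p' < n"
  proof -
    have "degree rs \<le> n - 1"
      unfolding rs_def by (intro degree_sum_le) (auto intro: order.trans[OF degree_monom_le])
    moreover have "degree pl < n"
    proof -
      have "degree pl \<le> n" unfolding pl_def n_def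
        by (intro degree_diff_le) (auto simp: degree_monom_le)
      moreover have "coeff pl n = 0" by (simp add: pl_def)
      ultimately show ?thesis using n by (metis degree_0 eq_zero_or_degree_less)
    qed
    ultimately show ?thesis using n unfolding p'_def
      by (intro degree_add_less) (auto intro: le_less_trans[OF degree_smult_le])
  qed
  moreover have "1 = z * poly p' u"
  proof -
    have "u ^ n * poly r (inverse u) = (\<Sum>i\<le>degree r. coeff r i * (u ^ n * inverse u ^ i))"
      by (simp add: poly_altdef sum_distrib_left ac_simps)
    also have "\<dots> = (\<Sum>i\<le>degree r. coeff r i * u ^ (n - i))"
      using u deg by (intro sum.cong refl)
        (auto simp: n_def power_diff power_inverse divide_inverse)
    also have "\<dots> = coeff r 0 * u ^ n + (\<Sum>i\<in>{1..degree r}. coeff r i * u ^ (n - i))"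
      by (simp add: atLeast1_atMost_eq_remove0 sum.remove[of "{..degree r}" 0])
    also have "(\<Sum>i\<in>{1..degree r}. coeff r i * u ^ (n - i)) = poly rs u"
      by (simp add: rs_def poly_sum poly_monom)
    finally have "u ^ n = z * (coeff r 0 * u ^ n + poly rs u)"
      using r(2) by (metis mult.commute mult.assoc mult_1)
    then have top: "(1 - z * coeff r 0) * u ^ n = z * poly rs u"
      by (simp add: algebra_simps)
    have low: "poly p u = poly pl u + coeff p n * u ^ n"
      by (simp add: pl_def poly_monom)
    have "z * poly p' u = z * coeff r 0 + (1 - z * coeff r 0) * (z * poly pl u)
        + coeff p n * z * (z * poly rs u)"
      by (simp add: p'_def algebra_simps)
    also have "\<dots> = z * coeff r 0 + (1 - z * coeff r 0) * (z * poly p u)"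
      unfolding top[symmetric] low by (simp add: algebra_simps)
    also have "\<dots> = 1" using p(2) by simp
    finally show ?thesis by simp
  qed
  ultimately show ?thesis by (auto simp: n_def)
qed

text \<open>Descent on the sum of the degrees: the relation of larger degree is shortened by the
  other, exchanging \<open>u\<close> and \<open>inverse u\<close> if need be.\<close>

lemma no_two_relations:
  fixes M :: "'a set"
  assumes M: "0 \<in> M" "1 \<in> M" "\<And>a b. a \<in> M \<Longrightarrow> b \<in> M \<Longrightarrow> a + b \<in> M"
      "\<And>a b. a \<in> M \<Longrightarrow> b \<in> M \<Longrightarrow> a * b \<in> M" "\<And>a. a \<in> M \<Longrightarrow> - a \<in> M"
    and z: "z \<in> M" "inverse z \<notin> M"
  shows "\<lbrakk>u \<noteq> 0; \<forall>i. coeff p i \<in> M; 1 = z * poly p u; \<forall>i. coeff r i \<in> M;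
    1 = z * poly r (inverse u)\<rbrakk> \<Longrightarrow> False"
proof (induction "degree p + degree r" arbitrary: u p r rule: less_induct)
  case less
  show ?case
  proof (cases "degree r \<le> degree p")
    case True
    then obtain p' where "\<forall>i. coeff p' i \<in> M" "1 = z * poly p' u" "degree p' < degree p"
      using reduce_relation[OF M z less.prems] by blast
    then show ?thesis using less.hyps[of p' r u] less.prems by simp
  next
    case False
    moreover have "inverse u \<noteq> 0" "1 = z * poly p (inverse (inverse u))"
      using less.prems by simp_all
    ultimately obtain r' where
      "\<forall>i. coeff r' i \<in> M" "1 = z * poly r' (inverse u)" "degree r' < degree r"
      using reduce_relation[OF M z, of "inverse u" r p] less.prems by (meson linear)
    then show ?thesis using less.hyps[of p r' u] less.prems by simp
  qed
qed

text \<open>Zorn's lemma gives a subring maximal among those containing \<open>z\<close> but not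
  \<open>inverse z\<close>; Chevalley's argument shows it to be a valuation ring, and
  \<open>z\<close> is a nonunit in it.\<close>

lemma ex_zero:
  assumes z: "\<not> algebraic_elt \<iota> z"
  shows "\<exists>v\<in>points \<iota>. 0 < v z"
proof -
  have z0: "z \<noteq> 0"
    using ev_nonzero[OF z, of "[:0, 1:]"] by (simp add: embed_one)
  \<comment> \<open>Negatives come from the constant \<open>-1\<close>.\<close>
  define subr where "subr R \<longleftrightarrow> range \<iota> \<subseteq> R \<and> (\<forall>a\<in>R. \<forall>b\<in>R. a + b \<in> R \<and> a * b \<in> R)" for R
  define \<A> where "\<A> = {R. subr R \<and> z \<in> R \<and> inverse z \<notin> R}"
  \<comment> \<open>The family is nonempty: \<open>K[z]\<close> lacks \<open>inverse z\<close>, as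
    \<open>inverse z = p(z)\<close> would be an algebraic equation for \<open>z\<close>.\<close>
  have "range (\<lambda>p. ev p z) \<in> \<A>"
  proof -
    have "\<iota> c \<in> range (\<lambda>p. ev p z)" for c
      by (rule image_eqI[of _ _ "[:c:]"]) auto
    moreover have "z \<in> range (\<lambda>p. ev p z)"
      by (rule image_eqI[of _ _ "[:0, 1:]"]) (auto simp: embed_one)
    moreover have "inverse z \<noteq> ev p z" for p
    proof
      assume "inverse z = ev p z"
      then have "ev (pCons (-1) p) z = 0"
        using z0 by (simp add: embed_uminus embed_one flip: \<open>inverse z = ev p z\<close>)
      then show False using ev_nonzero[OF z, of "pCons (-1) p"] by simp
    qed
    moreover have "ev p z + ev q z \<in> range (\<lambda>p. ev p z)" "ev p z * ev q z \<in> range (\<lambda>p. ev p z)" for p q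
      by (auto simp flip: ev_add ev_mult)
    ultimately show ?thesis unfolding \<A>_def subr_def by auto
  qed
  then have "\<exists>M\<in>\<A>. \<forall>X\<in>\<A>. M \<subseteq> X \<longrightarrow> X = M"
  proof (intro subset_Zorn_nonempty)
    fix \<C> assume ne: "\<C> \<noteq> {}" and chain: "subset.chain \<A> \<C>"
    have sub: "\<C> \<subseteq> \<A>" using chain by (simp add: subset_chain_def)
    have "a + b \<in> \<Union>\<C> \<and> a * b \<in> \<Union>\<C>" if ab: "a \<in> \<Union>\<C>" "b \<in> \<Union>\<C>" for a b
    proof -
      obtain X Y where "X \<in> \<C>" "Y \<in> \<C>" "a \<in> X" "b \<in> Y" using ab by blast
      moreover from this have "X \<subseteq> Y \<or> Y \<subseteq> X" using chain by (simp add: subset_chain_def)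
      ultimately obtain X where X: "X \<in> \<C>" "a \<in> X" "b \<in> X" by blast
      then have "subr X" using sub by (auto simp: \<A>_def)
      then show ?thesis using X by (auto simp: subr_def)
    qed
    moreover have "inverse z \<notin> \<Union>\<C>" using sub by (auto simp: \<A>_def)
    moreover obtain X where "X \<in> \<C>" "X \<in> \<A>" using ne sub by blast
    then have "range \<iota> \<subseteq> \<Union>\<C>" "z \<in> \<Union>\<C>" by (auto simp: \<A>_def subr_def)
    ultimately show "\<Union>\<C> \<in> \<A>" by (simp add: \<A>_def subr_def)
  qed auto
  then obtain M where M\<A>: "M \<in> \<A>" and max: "\<And>X. X \<in> \<A> \<Longrightarrow> M \<subseteq> X \<Longrightarrow> X = M"
    by blast
  have zM: "z \<in> M" "inverse z \<notin> M" and emb: "\<iota> c \<in> M" for c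
    using M\<A> by (auto simp: \<A>_def subr_def)
  have add: "a + b \<in> M" and mult: "a * b \<in> M" if "a \<in> M" "b \<in> M" for a b
    using M\<A> that by (auto simp: \<A>_def subr_def)
  have zero: "0 \<in> M" and one: "1 \<in> M"
    using emb[of 0] emb[of 1] by (auto simp: embed_one)
  have neg: "- a \<in> M" if "a \<in> M" for a
    using mult[OF emb[of "-1"] that] by (simp add: embed_uminus embed_one)
  \<comment> \<open>By maximality \<open>M[u]\<close> contains \<open>inverse z\<close>; the
    expression for it, multiplied by \<open>z\<close>, is the relation that the descent
    uses.\<close>
  have relation: "\<exists>p. (\<forall>i. coeff p i \<in> M) \<and> 1 = z * poly p u" if "u \<notin> M" for u
  proof -
    have sub: "M \<subseteq> adjoin M u"
      by (auto simp: adjoin_def coeff_pCons zero split: nat.splits intro!: exI[of _ "[:a:]" for a])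
    have "u \<in> adjoin M u"
      by (auto simp: adjoin_def coeff_pCons zero one split: nat.splits intro!: exI[of _ "[:0, 1:]"])
    then have "adjoin M u \<notin> \<A>" using max sub that by blast
    moreover have "subr (adjoin M u)"
    proof -
      have "poly p u + poly q u \<in> adjoin M u \<and> poly p u * poly q u \<in> adjoin M u"
        if pq: "\<forall>i. coeff p i \<in> M" "\<forall>i. coeff q i \<in> M" for p q
      proof -
        have "\<forall>i. coeff (p + q) i \<in> M" using pq add by simp
        moreover have "\<forall>i. coeff (p * q) i \<in> M"
          unfolding coeff_mult using pq by (auto intro!: sum_closed zero add mult)
        ultimately show ?thesis unfolding adjoin_def poly_add[symmetric] poly_mult[symmetric]
          by blast
      qed
      then have "\<forall>a\<in>adjoin M u. \<forall>b\<in>adjoin M u. a + b \<in> adjoin M u \<and> a * b \<in> adjoin M u"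
        unfolding adjoin_def[of M u] by blast
      then show ?thesis using sub emb by (auto simp: subr_def)
    qed
    ultimately have "inverse z \<in> adjoin M u" using sub zM by (auto simp: \<A>_def)
    then obtain p where "\<forall>i. coeff p i \<in> M" "inverse z = poly p u" by (auto simp: adjoin_def)
    then show ?thesis using z0 by (metis right_inverse)
  qed
  have total: "u \<in> M \<or> inverse u \<in> M" for u
  proof (rule ccontr)
    assume u: "\<not> (u \<in> M \<or> inverse u \<in> M)"
    then have u0: "u \<noteq> 0" using zero by auto
    obtain p where p: "\<forall>i. coeff p i \<in> M" "1 = z * poly p u" using relation u by blast
    obtain r where r: "\<forall>i. coeff r i \<in> M" "1 = z * poly r (inverse u)"
      using relation u by blast
    show False
      by (rule no_two_relations[of M z u p r]) (fact zero one zM u0 p r | rule add mult neg, assumption+)+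
  qed
  interpret val_ring \<iota> M
    by unfold_locales (use emb add mult total in auto)
  show ?thesis using zM z0 by (intro ex_point) (auto simp: nonunits_def)
qed

end

section \<open>Points and weak approximation\<close>

definition ord_ge :: "('a::field \<Rightarrow> int) \<Rightarrow> int \<Rightarrow> 'a set" where
  "ord_ge v n = {f. f = 0 \<or> n \<le> v f}"

lemma local_ring_eq_ord_ge: "local_ring v = ord_ge v 0"
  by (simp add: local_ring_def ord_ge_def)

lemma maximal_ideal_eq_ord_ge: "maximal_ideal v = ord_ge v 1"
  by (auto simp: maximal_ideal_def ord_ge_def)

lemma ord_ge_zero [simp]: "0 \<in> ord_ge v n"
  by (simp add: ord_ge_def)

lemma ord_ge_iff: "f \<noteq> 0 \<Longrightarrow> f \<in> ord_ge v n \<longleftrightarrow> n \<le> v f"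
  by (simp add: ord_ge_def)

lemma ord_ge_mono: "f \<in> ord_ge v n \<Longrightarrow> m \<le> n \<Longrightarrow> f \<in> ord_ge v m"
  by (auto simp: ord_ge_def)

context curve
begin

section \<open>Arithmetic of normalized valuations\<close>

lemma pt_zero: "v \<in> points \<iota> \<Longrightarrow> v 0 = 0"
  by (simp add: points_def)

lemma pt_mult: "v \<in> points \<iota> \<Longrightarrow> f \<noteq> 0 \<Longrightarrow> h \<noteq> 0 \<Longrightarrow> v (f * h) = v f + v h"
  by (simp add: points_def)

lemma pt_add: "v \<in> points \<iota> \<Longrightarrow> f \<noteq> 0 \<Longrightarrow> h \<noteq> 0 \<Longrightarrow> f + h \<noteq> 0 \<Longrightarrow> min (v f) (v h) \<le> v (f + h)"
  by (simp add: points_def)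

lemma pt_embed: "v \<in> points \<iota> \<Longrightarrow> v (\<iota> c) = 0"
  by (cases "c = 0") (simp_all add: points_def)

lemma pt_uniformizer:
  assumes "v \<in> points \<iota>"
  obtains t where "t \<noteq> 0" "v t = 1"
  using assms by (auto simp: points_def)

lemma pt_one: "v \<in> points \<iota> \<Longrightarrow> v 1 = 0"
  using pt_embed[of v 1] by (simp add: embed_one)

lemma pt_uminus: "v \<in> points \<iota> \<Longrightarrow> v (- f) = v f"
  using pt_mult[of v "\<iota> (-1)" f] pt_embed[of v "-1"]
  by (cases "f = 0") (simp_all add: embed_uminus embed_one)

lemma pt_inverse: "v \<in> points \<iota> \<Longrightarrow> v (inverse f) = - v f"
  using pt_mult[of v f "inverse f"] pt_one[of v] pt_zero[of v] by (cases "f = 0") simp_all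

lemma pt_divide: "v \<in> points \<iota> \<Longrightarrow> f \<noteq> 0 \<Longrightarrow> h \<noteq> 0 \<Longrightarrow> v (f / h) = v f - v h"
  using pt_mult[of v f "inverse h"] pt_inverse[of v h] by (simp add: divide_inverse)

lemma pt_power: "v \<in> points \<iota> \<Longrightarrow> v (f ^ n) = int n * v f"
  by (induction n; cases "f = 0") (auto simp: pt_one pt_zero pt_mult algebra_simps)

lemma pt_powi: "v \<in> points \<iota> \<Longrightarrow> v (f powi n) = n * v f"
  by (simp add: power_int_def pt_power pt_inverse)

lemma pt_prod:
  "v \<in> points \<iota> \<Longrightarrow> (\<And>i. i \<in> A \<Longrightarrow> h i \<noteq> 0) \<Longrightarrow> v (prod h A) = (\<Sum>i\<in>A. v (h i))"
  by (induction A rule: infinite_finite_induct) (auto simp: pt_one pt_mult)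

lemma ord_ge_add:
  assumes v: "v \<in> points \<iota>" and "f \<in> ord_ge v n" "h \<in> ord_ge v n"
  shows "f + h \<in> ord_ge v n"
proof -
  consider "f = 0" | "h = 0" | "f + h = 0" | "f \<noteq> 0" "h \<noteq> 0" "f + h \<noteq> 0" by blast
  then show ?thesis using assms pt_add[OF v, of f h] by cases (auto simp: ord_ge_def)
qed

lemma ord_ge_mult:
  "v \<in> points \<iota> \<Longrightarrow> f \<in> ord_ge v n \<Longrightarrow> h \<in> ord_ge v m \<Longrightarrow> f * h \<in> ord_ge v (n + m)"
  by (cases "f = 0 \<or> h = 0") (auto simp: ord_ge_def pt_mult)

lemma ord_ge_mult_iff:
  "v \<in> points \<iota> \<Longrightarrow> u \<noteq> 0 \<Longrightarrow> u * f \<in> ord_ge v (v u + n) \<longleftrightarrow> f \<in> ord_ge v n"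
  by (cases "f = 0") (auto simp: ord_ge_def pt_mult)

lemma ord_ge_embed: "v \<in> points \<iota> \<Longrightarrow> f \<in> ord_ge v n \<Longrightarrow> \<iota> c * f \<in> ord_ge v n"
  by (cases "c = 0 \<or> f = 0") (auto simp: ord_ge_def pt_mult pt_embed)

lemma ord_ge_uminus: "v \<in> points \<iota> \<Longrightarrow> f \<in> ord_ge v n \<Longrightarrow> - f \<in> ord_ge v n"
  by (auto simp: ord_ge_def pt_uminus)

lemma ord_ge_diff: "v \<in> points \<iota> \<Longrightarrow> f \<in> ord_ge v n \<Longrightarrow> h \<in> ord_ge v n \<Longrightarrow> f - h \<in> ord_ge v n"
  using ord_ge_add[of v f n "- h"] ord_ge_uminus by simp

lemma pt_add_eq:
  assumes v: "v \<in> points \<iota>" and "f \<noteq> 0" "h \<noteq> 0" "v f < v h"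
  shows "f + h \<noteq> 0" "v (f + h) = v f"
proof -
  show ne: "f + h \<noteq> 0"
  proof
    assume "f + h = 0"
    then have "f = - h" by (simp add: eq_neg_iff_add_eq_0)
    then show False using assms pt_uminus[OF v, of h] by simp
  qed
  have "v f \<le> v (f + h)" using pt_add[OF v, of f h] assms ne by simp
  moreover have "v (f + h) \<le> v f"
  proof (rule ccontr)
    assume neg: "\<not> ?thesis"
    have "min (v (f + h)) (v (- h)) \<le> v (f + h + - h)"
      using assms ne by (intro pt_add[OF v]) auto
    then show False using neg assms(4) pt_uminus[OF v, of h] by simp
  qed
  ultimately show "v (f + h) = v f" by simp
qed

lemma one_notin_ord_ge_1: "v \<in> points \<iota> \<Longrightarrow> 1 \<notin> ord_ge v 1"
  by (simp add: ord_ge_def pt_one)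

lemma ev_ord_ge:
  assumes v: "v \<in> points \<iota>" and x: "x \<in> ord_ge v 0"
  shows "ev p x \<in> ord_ge v 0"
  using ev_closed[of "ord_ge v 0" x 1 p] ord_ge_add[OF v, of _ 0] ord_ge_embed[OF v, of _ 0]
    ord_ge_mult[OF v x, of _ 0] pt_one[OF v] by (simp add: ord_ge_def[of v 0])

text \<open>At a pole of \<open>x\<close> the leading term dominates: in each Horner step the added
  constant has larger value than \<open>x * ev p x\<close>.\<close>

lemma ev_pole:
  assumes v: "v \<in> points \<iota>" and x: "x \<noteq> 0" "v x < 0" and "p \<noteq> 0"
  shows "ev p x \<noteq> 0 \<and> v (ev p x) = int (degree p) * v x"
  using \<open>p \<noteq> 0\<close>
proof (induction p)
  case (pCons c p)
  show ?case
  proof (cases "p = 0")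
    case True
    then show ?thesis using pCons by (simp add: pt_embed[OF v])
  next
    case False
    then have IH: "ev p x \<noteq> 0" "v (ev p x) = int (degree p) * v x" using pCons by auto
    have xe: "x * ev p x \<noteq> 0" "v (x * ev p x) = int (degree (pCons c p)) * v x"
      using False IH x by (auto simp: pt_mult[OF v] algebra_simps)
    have "v (x * ev p x) < 0" using x False by (simp add: xe mult_less_0_iff)
    then show ?thesis
      using pt_add_eq[OF v xe(1), of "\<iota> c"] xe pt_embed[OF v, of c]
      by (cases "c = 0") (simp_all add: add.commute)
  qed
qed simp

section \<open>Residue fields and degrees of points\<close>

definition independent_mod :: "'a set \<Rightarrow> 'a set \<Rightarrow> bool" where
  "independent_mod Z I \<longleftrightarrow> (\<forall>c. (\<Sum>z\<in>Z. \<iota> (c z) * z) \<in> I \<longrightarrow> (\<forall>z\<in>Z. c z = 0))"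

lemma independent_modD:
  "independent_mod Z I \<Longrightarrow> (\<Sum>z\<in>Z. \<iota> (c z) * z) \<in> I \<Longrightarrow> \<forall>z\<in>Z. c z = 0"
  by (simp add: independent_mod_def)

text \<open>Uniqueness of the coefficients at \<open>f = 0\<close> is independence, and differences
  of two expansions reduce the general case to it.\<close>

lemma residue_basis_iff:
  assumes v: "v \<in> points \<iota>"
  shows "residue_basis \<iota> v S \<longleftrightarrow> finite S \<and> S \<subseteq> ord_ge v 0 \<and> independent_mod S (ord_ge v 1) \<and>
    (\<forall>f\<in>ord_ge v 0. \<exists>c. f - (\<Sum>s\<in>S. \<iota> (c s) * s) \<in> ord_ge v 1)"
    (is "?L \<longleftrightarrow> ?R")
proof
  assume L: ?L
  then have ex1: "\<And>f. f \<in> ord_ge v 0 \<Longrightarrow>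
      \<exists>!c. c \<in> S \<rightarrow>\<^sub>E UNIV \<and> f - (\<Sum>s\<in>S. \<iota> (c s) * s) \<in> ord_ge v 1"
    and S: "finite S" "S \<subseteq> ord_ge v 0"
    by (auto simp: residue_basis_def local_ring_eq_ord_ge maximal_ideal_eq_ord_ge)
  have "\<forall>z\<in>S. c z = 0" if c: "(\<Sum>z\<in>S. \<iota> (c z) * z) \<in> ord_ge v 1" for c
  proof -
    let ?c = "restrict c S" and ?z = "restrict (\<lambda>_. 0) S"
    have "0 - (\<Sum>s\<in>S. \<iota> (?c s) * s) \<in> ord_ge v 1"
      using ord_ge_uminus[OF v c] by simp
    moreover have "0 - (\<Sum>s\<in>S. \<iota> (?z s) * s) \<in> ord_ge v 1" by simp
    moreover have "?c \<in> S \<rightarrow>\<^sub>E UNIV" "?z \<in> S \<rightarrow>\<^sub>E UNIV" by auto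
    ultimately have "?c = ?z" using ex1[OF ord_ge_zero] by blast
    then show ?thesis by (metis restrict_apply')
  qed
  moreover have "\<forall>f\<in>ord_ge v 0. \<exists>c. f - (\<Sum>s\<in>S. \<iota> (c s) * s) \<in> ord_ge v 1"
    using ex1 by blast
  ultimately show ?R using S by (simp add: independent_mod_def)
next
  assume R: ?R
  have "\<exists>!c. c \<in> S \<rightarrow>\<^sub>E UNIV \<and> f - (\<Sum>s\<in>S. \<iota> (c s) * s) \<in> ord_ge v 1"
    if f: "f \<in> ord_ge v 0" for f
  proof -
    obtain c where c: "f - (\<Sum>s\<in>S. \<iota> (c s) * s) \<in> ord_ge v 1" using R f by blast
    show ?thesis
    proof (rule ex1I[of _ "restrict c S"])
      show "restrict c S \<in> S \<rightarrow>\<^sub>E UNIV \<and> f - (\<Sum>s\<in>S. \<iota> (restrict c S s) * s) \<in> ord_ge v 1"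
        using c by simp
    next
      fix d assume d: "d \<in> S \<rightarrow>\<^sub>E UNIV \<and> f - (\<Sum>s\<in>S. \<iota> (d s) * s) \<in> ord_ge v 1"
      have "(f - (\<Sum>s\<in>S. \<iota> (c s) * s)) - (f - (\<Sum>s\<in>S. \<iota> (d s) * s)) \<in> ord_ge v 1"
        using ord_ge_diff[OF v c] d by blast
      also have "(f - (\<Sum>s\<in>S. \<iota> (c s) * s)) - (f - (\<Sum>s\<in>S. \<iota> (d s) * s))
          = (\<Sum>s\<in>S. \<iota> (d s - c s) * s)"
        by (simp add: embed_diff left_diff_distrib sum_subtractf)
      finally have "\<forall>s\<in>S. d s - c s = 0"
        using R independent_modD[of S _ "\<lambda>s. d s - c s"] by blast
      then have "\<And>s. s \<in> S \<Longrightarrow> d s = restrict c S s" by simp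
      then show "d = restrict c S" using d by (intro PiE_ext[of d S "\<lambda>_. UNIV"]) auto
    qed
  qed
  then show ?L using R
    by (simp add: residue_basis_def local_ring_eq_ord_ge maximal_ideal_eq_ord_ge)
qed

text \<open>Applied to a uniformizer, \<open>dependent_mod\<close> bounds sets independent modulo
  the maximal ideal, so a largest one exists and spans. Hence \<open>point_degree\<close> never
  takes its default value at a point.\<close>

lemma ex_residue_basis:
  assumes v: "v \<in> points \<iota>"
  shows "\<exists>S. residue_basis \<iota> v S"
proof -
  obtain t where t: "t \<noteq> 0" "v t = 1" using pt_uniformizer[OF v] .
  obtain N where N: "rank_le t N" using ex_rank_le by blast
  define good where "good Z \<longleftrightarrow> finite Z \<and> Z \<subseteq> ord_ge v 0 \<and> independent_mod Z (ord_ge v 1)" for Z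
  have bound: "card Z \<le> N" if Z: "good Z" for Z
  proof (rule ccontr)
    assume "\<not> card Z \<le> N"
    then have "\<exists>c. (\<exists>z\<in>Z. c z \<noteq> 0) \<and> (\<exists>w\<in>ord_ge v 0. (\<Sum>z\<in>Z. \<iota> (c z) * z) = t * w)"
      using Z t ord_ge_mult[OF v, of t 0 _ 0]
      by (intro dependent_mod[OF N t(1)] ord_ge_add[OF v] ord_ge_embed[OF v])
        (auto simp: good_def ord_ge_def[of v 0])
    then obtain c w where c: "\<exists>z\<in>Z. c z \<noteq> 0" "w \<in> ord_ge v 0" "(\<Sum>z\<in>Z. \<iota> (c z) * z) = t * w"
      by blast
    have "t * w \<in> ord_ge v 1"
      using ord_ge_mult[OF v, of t 1 w 0] c(2) t by (simp add: ord_ge_def[of v 1])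
    then show False using Z c(1,3) unfolding good_def independent_mod_def by metis
  qed
  have "good {}" by (simp add: good_def independent_mod_def)
  then obtain S where S: "good S" and max: "\<And>Z. good Z \<Longrightarrow> card Z \<le> card S"
    using ex_has_greatest_nat[of good "{}" card "Suc N"] bound le_imp_less_Suc by metis
  have "\<exists>c. f - (\<Sum>s\<in>S. \<iota> (c s) * s) \<in> ord_ge v 1" if f: "f \<in> ord_ge v 0" for f
  proof (cases "f \<in> S")
    case True
    have "(\<Sum>s\<in>S. \<iota> (if s = f then 1 else 0) * s) = (\<Sum>s\<in>S. if s = f then s else 0)"
      by (intro sum.cong) (auto simp: embed_one)
    also have "\<dots> = f" using S True by (simp add: good_def)
    finally show ?thesis by (intro exI[of _ "\<lambda>s. if s = f then 1 else 0"]) simp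
  next
    case False
    have finS: "finite S" using S by (simp add: good_def)
    have "\<not> good (insert f S)" using max[of "insert f S"] False finS by auto
    then have "\<not> independent_mod (insert f S) (ord_ge v 1)"
      using S f by (simp add: good_def)
    then obtain c where c: "(\<Sum>s\<in>insert f S. \<iota> (c s) * s) \<in> ord_ge v 1" "\<exists>s\<in>insert f S. c s \<noteq> 0"
      unfolding independent_mod_def by blast
    have sum: "\<iota> (c f) * f + (\<Sum>s\<in>S. \<iota> (c s) * s) \<in> ord_ge v 1" using c(1) False finS by simp
    have cf: "c f \<noteq> 0"
    proof
      assume "c f = 0"
      then have "\<forall>s\<in>S. c s = 0" using S sum by (simp add: good_def independent_mod_def)
      then show False using c(2) \<open>c f = 0\<close> by blast
    qed
    have eq: "f - (\<Sum>s\<in>S. \<iota> (- c s / c f) * s) = \<iota> (inverse (c f)) * (\<iota> (c f) * f + (\<Sum>s\<in>S. \<iota> (c s) * s))"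
    proof -
      have "\<iota> (- c s / c f) * s = - (\<iota> (inverse (c f)) * (\<iota> (c s) * s))" for s
        by (simp add: divide_inverse embed_mult embed_uminus)
      moreover have "\<iota> (inverse (c f)) * (\<iota> (c f) * f) = f"
        using cf by (simp add: embed_inverse)
      ultimately show ?thesis by (simp add: distrib_left sum_distrib_left sum_negf)
    qed
    have "f - (\<Sum>s\<in>S. \<iota> (- c s / c f) * s) \<in> ord_ge v 1"
      unfolding eq by (rule ord_ge_embed[OF v sum])
    then show ?thesis by (rule exI[of _ "\<lambda>s. - c s / c f"])
  qed
  then show ?thesis using S by (auto simp: residue_basis_iff[OF v] good_def)
qed

lemma point_degree_basis:
  assumes v: "v \<in> points \<iota>"
  obtains S where "finite S" "S \<subseteq> ord_ge v 0" "independent_mod S (ord_ge v 1)"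
    "\<And>f. f \<in> ord_ge v 0 \<Longrightarrow> \<exists>c. f - (\<Sum>s\<in>S. \<iota> (c s) * s) \<in> ord_ge v 1"
    "card S = point_degree \<iota> v"
proof -
  let ?S = "SOME S. residue_basis \<iota> v S"
  have "residue_basis \<iota> v ?S" using ex_residue_basis[OF v] by (rule someI_ex)
  moreover have "card ?S = point_degree \<iota> v"
    using ex_residue_basis[OF v] by (simp add: point_degree_def)
  ultimately show thesis using that[of ?S] by (auto simp: residue_basis_iff[OF v])
qed

lemma point_degree_pos: "v \<in> points \<iota> \<Longrightarrow> 0 < point_degree \<iota> v"
proof -
  assume v: "v \<in> points \<iota>"
  obtain S where S: "finite S" "\<And>f. f \<in> ord_ge v 0 \<Longrightarrow> \<exists>c. f - (\<Sum>s\<in>S. \<iota> (c s) * s) \<in> ord_ge v 1"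
    "card S = point_degree \<iota> v" using point_degree_basis[OF v] by metis
  have "1 \<in> ord_ge v 0" by (simp add: ord_ge_def pt_one[OF v])
  then obtain c where "1 - (\<Sum>s\<in>S. \<iota> (c s) * s) \<in> ord_ge v 1" using S(2) by blast
  then have "S \<noteq> {}" using one_notin_ord_ge_1[OF v] by auto
  then show ?thesis using S by (metis card_gt_0_iff)
qed

section \<open>Separation of points and weak approximation\<close>

lemma point_eqI:
  assumes v: "v \<in> points \<iota>" and w: "w \<in> points \<iota>"
    and le: "\<And>f. f \<noteq> 0 \<Longrightarrow> 0 \<le> v f \<Longrightarrow> 0 \<le> w f"
  shows "v = w"
proof -
  obtain t where t: "t \<noteq> 0" "v t = 1" using pt_uniformizer[OF v] .
  obtain s where s: "s \<noteq> 0" "w s = 1" using pt_uniformizer[OF w] .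
  have eq0: "w f = 0" if "f \<noteq> 0" "v f = 0" for f
    using le[of f] le[of "inverse f"] that pt_inverse[OF v, of f] pt_inverse[OF w, of f] by simp
  \<comment> \<open>Units of \<open>v\<close> are units of \<open>w\<close>, so \<open>w\<close> is
    \<open>w t\<close> times \<open>v\<close>; the value \<open>w s = 1\<close> then forces
    \<open>w t = 1\<close>.\<close>
  have wt: "w f = v f * w t" if f: "f \<noteq> 0" for f
  proof -
    have "v (f * t powi (- v f)) = 0"
      using f t by (simp add: pt_mult[OF v] pt_powi[OF v])
    then have "w (f * t powi (- v f)) = 0" using f t by (intro eq0) auto
    then show ?thesis using f t by (simp add: pt_mult[OF w] pt_powi[OF w])
  qed
  have "0 \<le> w t" using le[OF t(1)] t(2) by simp
  then have "w t = 1" using wt[OF s(1)] s(2) by (metis zmult_eq_1_iff mult.commute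
    add.inverse_inverse neg_equal_iff_equal neg_0_le_iff_le not_one_le_zero)
  then show ?thesis using wt pt_zero[OF v] pt_zero[OF w] by (intro ext) (metis mult.right_neutral)
qed

text \<open>Neither valuation ring contains the other, by \<open>point_eqI\<close>; the quotient of
  the two witnesses separates.\<close>

lemma separate_two_points:
  assumes v: "v \<in> points \<iota>" and w: "w \<in> points \<iota>" and "v \<noteq> w"
  shows "\<exists>f. f \<noteq> 0 \<and> 0 < v f \<and> w f < 0"
proof -
  obtain f where f: "f \<noteq> 0" "0 \<le> v f" "w f < 0"
    using point_eqI[OF v w] \<open>v \<noteq> w\<close> by (metis not_le)
  obtain h where h: "h \<noteq> 0" "0 \<le> w h" "v h < 0"
    using point_eqI[OF w v] \<open>v \<noteq> w\<close> by (metis not_le)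
  show ?thesis
    using f h by (intro exI[of _ "f / h"]) (simp add: pt_divide[OF v] pt_divide[OF w])
qed

lemma separate_points:
  assumes v: "v \<in> points \<iota>" and "finite V" "V \<subseteq> points \<iota>" "v \<notin> V"
  shows "\<exists>f. f \<noteq> 0 \<and> 0 < v f \<and> (\<forall>w\<in>V. w f < 0)"
  using assms(2-4)
proof (induction V rule: finite_induct)
  case empty
  then show ?case using pt_uniformizer[OF v] by (metis empty_iff zero_less_one)
next
  case (insert w V)
  then obtain f where f: "f \<noteq> 0" "0 < v f" "\<And>w. w \<in> V \<Longrightarrow> w f < 0" by auto
  have w: "w \<in> points \<iota>" using insert by simp
  obtain h where h: "h \<noteq> 0" "0 < v h" "w h < 0"
    using separate_two_points[OF v w] insert by blast
  show ?case
  proof (cases "w f < 0")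
    case True
    then show ?thesis using f by (intro exI[of _ f]) auto
  next
    case False
    \<comment> \<open>Adding \<open>h ^ m\<close> to \<open>f\<close> creates a pole at
      \<open>w\<close>. As \<open>m\<close> exceeds every \<open>\<bar>u f\<bar>\<close>, the values
      \<open>u f\<close> and \<open>m * u h\<close> differ at the old points, so the poles of
      \<open>f\<close> there cannot cancel.\<close>
    define m where "m = nat (\<Sum>u\<in>V. \<bar>u f\<bar>) + 1"
    have hm: "h ^ m \<noteq> 0" using h by simp
    have "0 < m" by (simp add: m_def)
    then have m: "0 < int m" by (simp only: of_nat_0_less_iff)
    have "f + h ^ m \<noteq> 0 \<and> w (f + h ^ m) < 0"
    proof -
      have "w (h ^ m) < 0" unfolding pt_power[OF w] using m h(3) by (rule mult_pos_neg)
      then show ?thesis using pt_add_eq[OF w hm f(1)] False by (simp add: add.commute)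
    qed
    moreover have "0 < v (f + h ^ m)"
    proof -
      have "0 < v (h ^ m)" unfolding pt_power[OF v] using m h(2) by (rule mult_pos_pos)
      then have "h ^ m \<in> ord_ge v 1" "f \<in> ord_ge v 1" using f by (auto simp: ord_ge_def)
      then show ?thesis
        using ord_ge_add[OF v, of f 1 "h ^ m"] calculation by (simp add: ord_ge_def)
    qed
    moreover have "u (f + h ^ m) < 0" if u: "u \<in> V" for u
    proof -
      have up: "u \<in> points \<iota>" using u insert by auto
      have "\<bar>u f\<bar> \<le> (\<Sum>u\<in>V. \<bar>u f\<bar>)"
        using u insert.hyps by (intro member_le_sum) auto
      then have um: "\<bar>u f\<bar> < int m" by (simp add: m_def)
      have "u f \<noteq> u (h ^ m)"
      proof
        assume eq: "u f = u (h ^ m)"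
        then have "u h \<noteq> 0" using f(3)[OF u] by (auto simp: pt_power[OF up])
        then have "int m * 1 \<le> int m * \<bar>u h\<bar>" by (intro mult_left_mono) auto
        then show False using eq um by (simp add: pt_power[OF up] abs_mult)
      qed
      then consider "u f < u (h ^ m)" | "u (h ^ m) < u f" by linarith
      then show ?thesis
        using pt_add_eq(2)[OF up f(1) hm] pt_add_eq(2)[OF up hm f(1)] f(3)[OF u]
        by cases (simp_all add: add.commute)
    qed
    ultimately show ?thesis by (intro exI[of _ "f + h ^ m"]) auto
  qed
qed

text \<open>If \<open>f\<close> vanishes at \<open>v\<close> and has poles on \<open>V\<close>, then
  \<open>1 / (1 + f ^ m)\<close> is a unit at \<open>v\<close> and has zeros of order at least
  \<open>m\<close> on \<open>V\<close>.\<close>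

lemma approximate_indicator:
  assumes v: "v \<in> points \<iota>" and V: "finite V" "V \<subseteq> points \<iota>" "v \<notin> V"
  shows "\<exists>e. e \<noteq> 0 \<and> v e = 0 \<and> (\<forall>w\<in>V. n \<le> w e)"
proof -
  obtain f where f: "f \<noteq> 0" "0 < v f" "\<And>w. w \<in> V \<Longrightarrow> w f < 0"
    using separate_points[OF v V] by blast
  define m where "m = nat n + 1"
  have fm: "f ^ m \<noteq> 0" using f by simp
  have m: "0 < m" "n \<le> int m" by (auto simp: m_def)
  have "v 1 < v (f ^ m)"
    using f(2) m by (simp add: pt_power[OF v] pt_one[OF v])
  then have v1: "1 + f ^ m \<noteq> 0" "v (1 + f ^ m) = 0"
    using pt_add_eq[OF v one_neq_zero fm] pt_one[OF v] by simp_all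
  have "n \<le> w (inverse (1 + f ^ m))" if w: "w \<in> V" for w
  proof -
    have wp: "w \<in> points \<iota>" using w V by blast
    have le: "int m * 1 \<le> int m * - w f" using f(3)[OF w] by (intro mult_left_mono) auto
    then have "w (f ^ m) < w 1"
      using m by (simp add: pt_power[OF wp] pt_one[OF wp])
    then have "w (f ^ m + 1) = w (f ^ m)"
      using pt_add_eq(2)[OF wp fm one_neq_zero] by simp
    then have "w (inverse (1 + f ^ m)) = int m * - w f"
      by (simp add: pt_inverse[OF wp] pt_power[OF wp] add.commute)
    then show ?thesis using le m(2) by linarith
  qed
  then show ?thesis
    using v1 by (intro exI[of _ "inverse (1 + f ^ m)"]) (auto simp: pt_inverse[OF v])
qed

section \<open>Zeros of a function and its degree\<close>

definition semi_local :: "('a \<Rightarrow> int) set \<Rightarrow> (('a \<Rightarrow> int) \<Rightarrow> nat) \<Rightarrow> 'a set" where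
  "semi_local V D = (\<Inter>v\<in>V. ord_ge v (int (D v)))"

lemma semi_local_closed:
  assumes "V \<subseteq> points \<iota>"
  shows "0 \<in> semi_local V D"
    "f \<in> semi_local V D \<Longrightarrow> h \<in> semi_local V D \<Longrightarrow> f + h \<in> semi_local V D"
    "f \<in> semi_local V D \<Longrightarrow> h \<in> semi_local V D \<Longrightarrow> f - h \<in> semi_local V D"
    "f \<in> semi_local V D \<Longrightarrow> \<iota> c * f \<in> semi_local V D"
  using assms ord_ge_add ord_ge_diff ord_ge_embed
  by (auto simp: semi_local_def subset_iff)

text \<open>A lower bound for the dimension of the semi-local ring modulo the ideal of vanishing
  orders \<open>D\<close>. Raising the order at \<open>v\<close> from \<open>D v - 1\<close> to
  \<open>D v\<close> adds a residue basis at \<open>v\<close>, multiplied by a function of order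
  exactly \<open>D v - 1\<close> at \<open>v\<close> and of high order on the rest of
  \<open>V\<close>.\<close>

lemma independent_mod_semi_local:
  assumes V: "finite V" "V \<subseteq> points \<iota>"
  shows "\<exists>Z. finite Z \<and> Z \<subseteq> semi_local V (\<lambda>_. 0) \<and> independent_mod Z (semi_local V D) \<and>
    card Z = (\<Sum>v\<in>V. D v * point_degree \<iota> v)"
proof (induction "\<Sum>v\<in>V. D v" arbitrary: D)
  case 0
  then have "\<forall>v\<in>V. D v = 0" using V by simp
  then show ?case by (intro exI[of _ "{}"]) (auto simp: independent_mod_def)
next
  case (Suc n)
  then obtain v where v: "v \<in> V" "0 < D v"
    by (metis Zero_not_Suc gr0I sum.neutral)
  have vp: "v \<in> points \<iota>" using v V by blast
  define E where "E = D(v := D v - 1)"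
  have sumD: "(\<Sum>u\<in>V. D u) = D v + (\<Sum>u\<in>V - {v}. D u)"
    and sumE: "(\<Sum>u\<in>V. E u) = D v - 1 + (\<Sum>u\<in>V - {v}. D u)"
    using v V by (simp_all add: sum.remove[of V v] E_def)
  then have "n = (\<Sum>u\<in>V. E u)" using Suc.hyps(2) v(2) by simp
  then obtain Z where Z: "finite Z" "Z \<subseteq> semi_local V (\<lambda>_. 0)" "independent_mod Z (semi_local V E)"
    "card Z = (\<Sum>v\<in>V. E v * point_degree \<iota> v)"
    using Suc.hyps(1)[of E] by blast
  obtain S where S: "finite S" "S \<subseteq> ord_ge v 0" "independent_mod S (ord_ge v 1)"
    "card S = point_degree \<iota> v" using point_degree_basis[OF vp] by metis
  obtain t where t: "t \<noteq> 0" "v t = 1" using pt_uniformizer[OF vp] .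
  \<comment> \<open>Large enough for \<open>e\<close> to outweigh any poles of
    \<open>t ^ E v\<close> and of the \<open>s\<close> at the other points and still leave order
    \<open>D w\<close>.\<close>
  define n where "n = (\<Sum>u\<in>V. int (D u) + \<bar>u (t ^ E v)\<bar> + (\<Sum>s\<in>S. \<bar>u s\<bar>))"
  obtain e where e: "e \<noteq> 0" "v e = 0" "\<And>w. w \<in> V - {v} \<Longrightarrow> n \<le> w e"
    using approximate_indicator[OF vp, of "V - {v}" n] V by blast
  define u where "u = t ^ E v * e"
  have u: "u \<noteq> 0" "v u = int (E v)"
    using t e by (simp_all add: u_def pt_mult[OF vp] pt_power[OF vp])
  have uw: "u * s \<in> ord_ge w (int (D w))" if w: "w \<in> V - {v}" and s: "s \<in> S" for w s
  proof (cases "s = 0")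
    case False
    have wp: "w \<in> points \<iota>" using w V by blast
    have "\<bar>w s\<bar> \<le> (\<Sum>s\<in>S. \<bar>w s\<bar>)"
      using s S(1) by (intro member_le_sum) auto
    moreover have "int (D w) + \<bar>w (t ^ E v)\<bar> + (\<Sum>s\<in>S. \<bar>w s\<bar>) \<le> n"
      unfolding n_def using w V by (intro member_le_sum) (auto simp: sum_nonneg)
    moreover have "w (u * s) = w (t ^ E v) + w e + w s"
      using False t e by (simp add: u_def pt_mult[OF wp])
    ultimately have "int (D w) \<le> w (u * s)" using e(3)[OF w] by linarith
    then show ?thesis by (simp add: ord_ge_def)
  qed simp
  have us: "u * s \<in> ord_ge v (int (E v))" if "s \<in> S" for s
    using ord_ge_mult_iff[OF vp u(1), of s 0] that S(2) u(2) by auto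
  let ?U = "(\<lambda>s. u * s) ` S"
  have UE: "?U \<subseteq> semi_local V E"
  proof -
    have "u * s \<in> ord_ge w (int (E w))" if "s \<in> S" "w \<in> V" for s w
      using uw[of w s] us[of s] that by (cases "w = v") (auto simp: E_def)
    then show ?thesis by (auto simp: semi_local_def)
  qed
  have injU: "inj_on (\<lambda>s. u * s) S" using u by (auto simp: inj_on_def)
  have disj: "Z \<inter> ?U = {}"
  proof (rule ccontr)
    assume "Z \<inter> ?U \<noteq> {}"
    then obtain z where z: "z \<in> Z" "z \<in> semi_local V E" using UE by blast
    have "(\<Sum>y\<in>Z. \<iota> (if y = z then 1 else 0) * y) = (\<Sum>y\<in>Z. if y = z then y else 0)"
      by (intro sum.cong) (auto simp: embed_one)
    then have "(\<Sum>y\<in>Z. \<iota> (if y = z then 1 else 0) * y) \<in> semi_local V E"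
      using z Z(1) by simp
    from Z(3)[unfolded independent_mod_def, rule_format, OF this z(1)] show False by simp
  qed
  have "independent_mod (Z \<union> ?U) (semi_local V D)"
    unfolding independent_mod_def
  proof (intro allI impI)
    fix c assume c: "(\<Sum>z\<in>Z \<union> ?U. \<iota> (c z) * z) \<in> semi_local V D"
    let ?b = "\<Sum>s\<in>S. \<iota> (c (u * s)) * (u * s)"
    have split: "(\<Sum>z\<in>Z \<union> ?U. \<iota> (c z) * z) = (\<Sum>z\<in>Z. \<iota> (c z) * z) + ?b"
      using Z(1) S(1) disj injU by (simp add: sum.union_disjoint sum.reindex)
    have DE: "semi_local V D \<subseteq> semi_local V E"
      by (auto simp: semi_local_def E_def intro: ord_ge_mono)
    have "?b \<in> semi_local V E"
      using UE by (intro sum_closed semi_local_closed[OF V(2)]) auto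
    then have "(\<Sum>z\<in>Z \<union> ?U. \<iota> (c z) * z) - ?b \<in> semi_local V E"
      using c DE by (intro semi_local_closed(3)[OF V(2)]) auto
    \<comment> \<open>Modulo \<open>E\<close> only the \<open>Z\<close>-part survives, so its
      coefficients vanish; the rest, divided by \<open>u\<close>, is then a residue relation at
      \<open>v\<close>.\<close>
    then have "(\<Sum>z\<in>Z. \<iota> (c z) * z) \<in> semi_local V E" unfolding split by simp
    then have cZ: "\<forall>z\<in>Z. c z = 0" using Z(3) by (simp add: independent_mod_def)
    then have "?b \<in> semi_local V D" using c unfolding split by simp
    then have "?b \<in> ord_ge v (int (D v))" using v by (auto simp: semi_local_def)
    moreover have "?b = u * (\<Sum>s\<in>S. \<iota> (c (u * s)) * s)"
      by (simp add: sum_distrib_left ac_simps)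
    moreover have "int (D v) = v u + 1" using v u by (simp add: E_def)
    ultimately have "(\<Sum>s\<in>S. \<iota> (c (u * s)) * s) \<in> ord_ge v 1"
      using ord_ge_mult_iff[OF vp u(1)] by simp
    then have "\<forall>s\<in>S. c (u * s) = 0" using independent_modD[OF S(3), of "\<lambda>s. c (u * s)"] by blast
    then show "\<forall>z\<in>Z \<union> ?U. c z = 0" using cZ by blast
  qed
  moreover have "card (Z \<union> ?U) = (\<Sum>v\<in>V. D v * point_degree \<iota> v)"
  proof -
    have "card (Z \<union> ?U) = card Z + card S"
      using Z(1) S(1) disj injU by (simp add: card_Un_disjoint card_image)
    also have "\<dots> = (\<Sum>w\<in>V. E w * point_degree \<iota> w) + point_degree \<iota> v"
      using Z(4) S(4) by simp
    also have "\<dots> = D v * point_degree \<iota> v + (\<Sum>w\<in>V - {v}. D w * point_degree \<iota> w)"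
      using v V by (simp add: sum.remove[of V v] E_def) (cases "D v"; simp)
    also have "\<dots> = (\<Sum>v\<in>V. D v * point_degree \<iota> v)"
      using v V by (simp add: sum.remove[of V v])
    finally show ?thesis .
  qed
  moreover have "semi_local V E \<subseteq> semi_local V (\<lambda>_. 0)"
    by (auto simp: semi_local_def intro: ord_ge_mono)
  ultimately show ?case
    using Z(1,2) S(1) UE by (intro exI[of _ "Z \<union> ?U"]) auto
qed

text \<open>Multiplication by \<open>y\<close> maps the semi-local ring of \<open>V\<close> into the
  ideal of orders \<open>v y\<close>. More than \<open>N\<close> elements independent modulo this
  ideal would contradict \<open>dependent_mod\<close>.\<close>

lemma zeros_le_rank:
  assumes y: "rank_le y N" "y \<noteq> 0" and V: "finite V" "V \<subseteq> points \<iota>" "\<And>v. v \<in> V \<Longrightarrow> 0 < v y"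
  shows "(\<Sum>v\<in>V. v y * int (point_degree \<iota> v)) \<le> int N"
proof -
  define D where "D v = nat (v y)" for v
  obtain Z where Z: "finite Z" "Z \<subseteq> semi_local V (\<lambda>_. 0)" "independent_mod Z (semi_local V D)"
    "card Z = (\<Sum>v\<in>V. D v * point_degree \<iota> v)"
    using independent_mod_semi_local[OF V(1,2)] by blast
  have mult: "y * w \<in> semi_local V D" if "w \<in> semi_local V (\<lambda>_. 0)" for w
  proof -
    have "y * w \<in> ord_ge v (int (D v))" if v: "v \<in> V" for v
      using V(2) V(3)[OF v] v \<open>w \<in> _\<close> ord_ge_mult_iff[of v y w 0] y(2)
      by (auto simp: semi_local_def D_def)
    then show ?thesis by (auto simp: semi_local_def)
  qed
  have "card Z \<le> N"
  proof (rule ccontr)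
    assume "\<not> card Z \<le> N"
    have "semi_local V D \<subseteq> semi_local V (\<lambda>_. 0)"
      by (auto simp: semi_local_def intro: ord_ge_mono)
    then have "\<exists>c. (\<exists>z\<in>Z. c z \<noteq> 0) \<and> (\<exists>w\<in>semi_local V (\<lambda>_. 0). (\<Sum>z\<in>Z. \<iota> (c z) * z) = y * w)"
      using Z \<open>\<not> card Z \<le> N\<close> mult
      by (intro dependent_mod[OF y] semi_local_closed[OF V(2)]) auto
    then obtain c w where "\<exists>z\<in>Z. c z \<noteq> 0" "w \<in> semi_local V (\<lambda>_. 0)"
      "(\<Sum>z\<in>Z. \<iota> (c z) * z) = y * w" by blast
    then show False using Z(3) mult unfolding independent_mod_def by metis
  qed
  moreover have "(\<Sum>v\<in>V. v y * int (point_degree \<iota> v)) = int (card Z)"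
    unfolding Z(4) using V(3) by (simp add: D_def less_imp_le)
  ultimately show ?thesis by simp
qed

text \<open>Every zero contributes at least one to the sum bounded by
  \<open>zeros_le_rank\<close>.\<close>

lemma finite_zeros:
  assumes "y \<noteq> 0"
  shows "finite {v \<in> points \<iota>. 0 < v y}"
proof (rule ccontr)
  assume inf: "infinite {v \<in> points \<iota>. 0 < v y}"
  obtain N where N: "rank_le y N" using ex_rank_le by blast
  obtain V where V: "finite V" "card V = Suc N" "V \<subseteq> {v \<in> points \<iota>. 0 < v y}"
    using infinite_arbitrarily_large[OF inf] by blast
  have "int (Suc N) = (\<Sum>v\<in>V. 1)" using V by simp
  also have "\<dots> \<le> (\<Sum>v\<in>V. v y * int (point_degree \<iota> v))"
  proof (rule sum_mono)
    fix v assume "v \<in> V"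
    then have "0 < v y * int (point_degree \<iota> v)"
      using V(3) point_degree_pos by (intro mult_pos_pos) auto
    then show "1 \<le> v y * int (point_degree \<iota> v)" by simp
  qed
  also have "\<dots> \<le> int N"
    using V(3) by (intro zeros_le_rank[OF N assms V(1)]) auto
  finally show False by simp
qed

lemma finite_support_principal:
  assumes "f \<noteq> 0"
  shows "finite {v \<in> points \<iota>. v f \<noteq> 0}"
proof -
  have "{v \<in> points \<iota>. v f \<noteq> 0} \<subseteq> {v \<in> points \<iota>. 0 < v f} \<union> {v \<in> points \<iota>. 0 < v (inverse f)}"
    by (auto simp: pt_inverse)
  then show ?thesis
    using finite_zeros[OF assms] finite_zeros[of "inverse f"] assms
    by (meson finite_UnI finite_subset inverse_nonzero_iff_nonzero)
qed

end

section \<open>Divisors and Riemann--Roch spaces\<close>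

context curve
begin

section \<open>Divisors and their degree\<close>

lemma divisors_zero: "0 \<in> divisors \<iota>"
  by (simp add: divisors_def)

lemma divisors_if_support_le:
  assumes "D \<in> divisors \<iota>" "E \<in> divisors \<iota>" "\<And>R. D R = 0 \<Longrightarrow> E R = 0 \<Longrightarrow> F R = 0"
  shows "F \<in> divisors \<iota>"
proof -
  have sub: "{R. F R \<noteq> 0} \<subseteq> {R. D R \<noteq> 0} \<union> {R. E R \<noteq> 0}" using assms(3) by blast
  then have "finite {R. F R \<noteq> 0}"
    using assms(1,2) by (intro finite_subset[OF sub]) (simp add: divisors_def)
  then show ?thesis using sub assms(1,2) unfolding divisors_def by blast
qed

lemma divisors_add: "D \<in> divisors \<iota> \<Longrightarrow> E \<in> divisors \<iota> \<Longrightarrow> D + E \<in> divisors \<iota>"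
  by (rule divisors_if_support_le[of D E]) auto

lemma divisors_diff: "D \<in> divisors \<iota> \<Longrightarrow> E \<in> divisors \<iota> \<Longrightarrow> D - E \<in> divisors \<iota>"
  by (rule divisors_if_support_le[of D E]) auto

lemma divisors_pt: "R \<in> points \<iota> \<Longrightarrow> pt n R \<in> divisors \<iota>"
  by (auto simp: divisors_def pt_def intro: finite_subset[of _ "{R}"])

lemma divisors_outside: "D \<in> divisors \<iota> \<Longrightarrow> R \<notin> points \<iota> \<Longrightarrow> D R = 0"
  by (auto simp: divisors_def)

lemma divisors_principal:
  assumes "f \<noteq> 0"
  shows "principal \<iota> f \<in> divisors \<iota>"
proof -
  have "{R. principal \<iota> f R \<noteq> 0} = {v \<in> points \<iota>. v f \<noteq> 0}" by (auto simp: principal_def)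
  then show ?thesis using finite_support_principal[OF assms] by (simp add: divisors_def)
qed

lemma deg_eq_sum:
  assumes "finite T" "{R. D R \<noteq> 0} \<subseteq> T"
  shows "deg \<iota> D = (\<Sum>R\<in>T. D R * int (point_degree \<iota> R))"
  unfolding deg_def using assms by (intro sum.mono_neutral_left) auto

lemma deg_add:
  assumes "D \<in> divisors \<iota>" "E \<in> divisors \<iota>"
  shows "deg \<iota> (D + E) = deg \<iota> D + deg \<iota> E"
proof -
  let ?T = "{R. D R \<noteq> 0} \<union> {R. E R \<noteq> 0}"
  have fin: "finite ?T" using assms by (simp add: divisors_def)
  have "deg \<iota> (D + E) = (\<Sum>R\<in>?T. (D + E) R * int (point_degree \<iota> R))"
    using fin by (intro deg_eq_sum) auto
  moreover have "deg \<iota> D = (\<Sum>R\<in>?T. D R * int (point_degree \<iota> R))"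
    using fin by (intro deg_eq_sum) auto
  moreover have "deg \<iota> E = (\<Sum>R\<in>?T. E R * int (point_degree \<iota> R))"
    using fin by (intro deg_eq_sum) auto
  ultimately show ?thesis by (simp add: distrib_right sum.distrib)
qed

lemma deg_diff:
  assumes "D \<in> divisors \<iota>" "E \<in> divisors \<iota>"
  shows "deg \<iota> (D - E) = deg \<iota> D - deg \<iota> E"
  using deg_add[OF divisors_diff[OF assms] assms(2)] by simp

lemma deg_zero [simp]: "deg \<iota> 0 = 0"
  by (simp add: deg_def)

lemma deg_pt: "deg \<iota> (pt n R) = n * int (point_degree \<iota> R)"
  by (subst deg_eq_sum[of "{R}"]) (auto simp: pt_def)

lemma deg_nonneg: "(\<And>R. 0 \<le> D R) \<Longrightarrow> 0 \<le> deg \<iota> D"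
  by (auto simp: deg_def intro!: sum_nonneg)

section \<open>The spaces \<open>L(E)\<close>\<close>

lemma L_iff:
  assumes "E \<in> divisors \<iota>"
  shows "f \<in> L \<iota> E \<longleftrightarrow> (\<forall>R\<in>points \<iota>. f \<in> ord_ge R (- E R))"
proof (cases "f = 0")
  case True
  then show ?thesis by (simp add: L_def)
next
  case False
  have "principal \<iota> f + E \<ge> 0 \<longleftrightarrow> (\<forall>R. 0 \<le> principal \<iota> f R + E R)"
    by (simp add: le_fun_def)
  also have "\<dots> \<longleftrightarrow> (\<forall>R\<in>points \<iota>. - E R \<le> R f)"
  proof -
    have "0 \<le> principal \<iota> f R + E R \<longleftrightarrow> (R \<in> points \<iota> \<longrightarrow> - E R \<le> R f)" for R
      using divisors_outside[OF assms, of R] by (auto simp: principal_def)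
    then show ?thesis by blast
  qed
  finally show ?thesis using False by (simp add: L_def ord_ge_iff)
qed

lemma L_zero_mem: "0 \<in> L \<iota> E"
  by (simp add: L_def)

lemma L_add: "E \<in> divisors \<iota> \<Longrightarrow> f \<in> L \<iota> E \<Longrightarrow> h \<in> L \<iota> E \<Longrightarrow> f + h \<in> L \<iota> E"
  by (simp add: L_iff ord_ge_add)

lemma L_diff: "E \<in> divisors \<iota> \<Longrightarrow> f \<in> L \<iota> E \<Longrightarrow> h \<in> L \<iota> E \<Longrightarrow> f - h \<in> L \<iota> E"
  by (simp add: L_iff ord_ge_diff)

lemma L_embed: "E \<in> divisors \<iota> \<Longrightarrow> f \<in> L \<iota> E \<Longrightarrow> \<iota> c * f \<in> L \<iota> E"
  by (simp add: L_iff ord_ge_embed)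

lemma L_mult:
  assumes "D \<in> divisors \<iota>" "E \<in> divisors \<iota>" "f \<in> L \<iota> D" "h \<in> L \<iota> E"
  shows "f * h \<in> L \<iota> (D + E)"
proof -
  have "f * h \<in> ord_ge R (- (D + E) R)" if R: "R \<in> points \<iota>" for R
    using ord_ge_mult[OF R, of f "- D R" h "- E R"] assms R by (simp add: L_iff)
  then show ?thesis using divisors_add[OF assms(1,2)] by (simp add: L_iff)
qed

lemma L_mono:
  assumes "D \<in> divisors \<iota>" "E \<in> divisors \<iota>" "\<And>R. D R \<le> E R"
  shows "L \<iota> D \<subseteq> L \<iota> E"
proof
  fix f assume f: "f \<in> L \<iota> D"
  have "f \<in> ord_ge R (- E R)" if R: "R \<in> points \<iota>" for R
    using f R assms(3)[of R] L_iff[OF assms(1), of f]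
    by (rule_tac ord_ge_mono[of f R "- D R"]) simp_all
  then show "f \<in> L \<iota> E" by (simp add: L_iff[OF assms(2)])
qed

text \<open>The divisor of \<open>f * h\<close> exceeds that of \<open>h\<close> by the divisor of
  \<open>f\<close>, so multiplication by \<open>f\<close> is a bijection between the two
  spaces.\<close>

lemma L_minus_principal:
  assumes D: "D \<in> divisors \<iota>" and f: "f \<noteq> 0"
  shows "L \<iota> (D - principal \<iota> f) = (\<lambda>h. f * h) ` L \<iota> D"
proof -
  have D': "D - principal \<iota> f \<in> divisors \<iota>"
    using D divisors_principal[OF f] by (rule divisors_diff)
  have key: "f * h \<in> L \<iota> (D - principal \<iota> f) \<longleftrightarrow> h \<in> L \<iota> D" for h
  proof -
    have "f * h \<in> ord_ge R (- (D - principal \<iota> f) R) \<longleftrightarrow> h \<in> ord_ge R (- D R)"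
      if R: "R \<in> points \<iota>" for R
      using ord_ge_mult_iff[OF R f, of h "- D R"] R by (simp add: principal_def)
    then show ?thesis by (simp add: L_iff[OF D] L_iff[OF D'])
  qed
  show ?thesis
  proof (intro equalityI subsetI)
    fix h assume "h \<in> L \<iota> (D - principal \<iota> f)"
    then have "h / f \<in> L \<iota> D" using key[of "h / f"] f by simp
    then show "h \<in> (\<lambda>h. f * h) ` L \<iota> D" using f by (intro image_eqI[of _ _ "h / f"]) auto
  qed (use key in auto)
qed

text \<open>A nonconstant \<open>f\<close> has a transcendental inverse, because the constant field
  is full; a zero of \<open>inverse f\<close> is a pole of \<open>f\<close>.\<close>

lemma L_zero: "L \<iota> 0 = range \<iota>"
proof (intro equalityI subsetI)
  fix f assume f: "f \<in> L \<iota> 0"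
  show "f \<in> range \<iota>"
  proof (cases "f = 0 \<or> algebraic_elt \<iota> (inverse f)")
    case True
    then show ?thesis
    proof
      assume "algebraic_elt \<iota> (inverse f)"
      then obtain c where "inverse f = \<iota> c" using full_constants by blast
      then have "f = \<iota> (inverse c)" by (metis embed_inverse inverse_inverse_eq)
      then show ?thesis by blast
    next
      assume "f = 0"
      then show ?thesis by (metis embed_zero rangeI)
    qed
  next
    case False
    then obtain v where v: "v \<in> points \<iota>" "0 < v (inverse f)" using ex_zero by blast
    then have "v f < 0" by (simp add: pt_inverse)
    moreover have "f \<in> ord_ge v 0" using f v(1) by (simp add: L_iff divisors_zero)
    ultimately show ?thesis using False by (simp add: ord_ge_def)
  qed
next
  fix f assume "f \<in> range \<iota>"
  then show "f \<in> L \<iota> 0" by (auto simp: L_iff divisors_zero ord_ge_def pt_embed)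
qed

section \<open>Dimensions by counting\<close>

interpretation vs: vector_space "\<lambda>c f. \<iota> c * f"
  by unfold_locales (simp_all add: embed_add embed_mult embed_one algebra_simps)

lemma card_subspace:
  assumes sub: "vs.subspace V" and fin: "finite V"
  shows "card V = CARD('k) ^ vs.dim V"
proof -
  obtain B where B: "B \<subseteq> V" "vs.independent B" "V \<subseteq> vs.span B" "card B = vs.dim V"
    using vs.basis_exists by blast
  have finB: "finite B" using B(1) fin by (rule finite_subset)
  have V: "V = vs.span B"
    using B sub vs.span_minimal by blast
  let ?e = "\<lambda>c. \<Sum>b\<in>B. \<iota> (c b) * b"
  let ?F = "B \<rightarrow>\<^sub>E (UNIV :: 'k set)"
  have inj: "inj_on ?e ?F"
  proof (rule inj_onI)
    fix c d assume c: "c \<in> ?F" and d: "d \<in> ?F" and eq: "?e c = ?e d"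
    have "(\<Sum>b\<in>B. \<iota> (c b - d b) * b) = 0"
      using eq by (simp add: embed_diff left_diff_distrib sum_subtractf)
    then have "\<forall>b\<in>B. c b - d b = 0"
      using B(2) unfolding vs.dependent_finite[OF finB] by (auto dest: spec[of _ "\<lambda>b. c b - d b"])
    then show "c = d" using c d by (intro PiE_ext[of c B "\<lambda>_. UNIV"]) auto
  qed
  have "V = ?e ` ?F"
  proof (intro equalityI subsetI)
    fix f assume "f \<in> V"
    then obtain c where c: "f = ?e c" unfolding V vs.span_finite[OF finB] by blast
    have "f = ?e (restrict c B)" unfolding c by (intro sum.cong) auto
    moreover have "restrict c B \<in> ?F" by simp
    ultimately show "f \<in> ?e ` ?F" by (rule image_eqI)
  next
    fix f assume "f \<in> ?e ` ?F"
    then show "f \<in> V" unfolding V vs.span_finite[OF finB] by blast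
  qed
  then have "card V = card ?F" using card_image[OF inj] by simp
  also have "\<dots> = CARD('k) ^ card B" using finB by (simp add: card_PiE)
  finally show ?thesis by (simp add: B(4))
qed

lemma card_L:
  assumes "E \<in> divisors \<iota>" "finite (L \<iota> E)"
  shows "card (L \<iota> E) = CARD('k) ^ ell \<iota> E"
  unfolding ell_def using assms L_add L_embed L_zero_mem
  by (intro card_subspace) (auto simp: vs.subspace_def)

lemma card_power_le_iff: "CARD('k) ^ a \<le> CARD('k) ^ b \<longleftrightarrow> a \<le> b"
  using card_constants_ge_2 by (intro power_increasing_iff) simp

text \<open>Up to \<open>L(A)\<close>, a function in \<open>L(A + R)\<close> is determined by its
  residue at \<open>R\<close> after scaling by \<open>t\<close>, that is by
  \<open>point_degree \<iota> R\<close> constants. This injects \<open>L(A + R)\<close> into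
  coordinates times \<open>L(A)\<close>.\<close>

lemma L_add_point:
  assumes A: "A \<in> divisors \<iota>" and R: "R \<in> points \<iota>" and fin: "finite (L \<iota> A)"
  shows "finite (L \<iota> (A + pt 1 R))" "ell \<iota> (A + pt 1 R) \<le> ell \<iota> A + point_degree \<iota> R"
proof -
  let ?A = "A + pt 1 R"
  have A': "?A \<in> divisors \<iota>" using A divisors_pt[OF R] by (rule divisors_add)
  obtain S where S: "finite S" "\<And>f. f \<in> ord_ge R 0 \<Longrightarrow> \<exists>c. f - (\<Sum>s\<in>S. \<iota> (c s) * s) \<in> ord_ge R 1"
    "card S = point_degree \<iota> R" using point_degree_basis[OF R] by metis
  obtain t0 where t0: "t0 \<noteq> 0" "R t0 = 1" using pt_uniformizer[OF R] .
  define t where "t = t0 powi (A R + 1)"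
  have t: "t \<noteq> 0" "R t = A R + 1" using t0 by (simp_all add: t_def pt_powi[OF R])
  let ?F = "S \<rightarrow>\<^sub>E (UNIV :: 'k set)"
  have "\<forall>f\<in>L \<iota> ?A. \<exists>c. c \<in> ?F \<and> t * f - (\<Sum>s\<in>S. \<iota> (c s) * s) \<in> ord_ge R 1"
  proof
    fix f assume f: "f \<in> L \<iota> ?A"
    have "f \<in> ord_ge R (- ?A R)" using f R by (simp only: L_iff[OF A'])
    then have "f \<in> ord_ge R (- (A R + 1))" by (simp add: pt_def)
    then have "t * f \<in> ord_ge R 0" using ord_ge_mult_iff[OF R t(1), of f "- (A R + 1)"] t(2) by simp
    then obtain c where "t * f - (\<Sum>s\<in>S. \<iota> (c s) * s) \<in> ord_ge R 1" using S(2) by blast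
    then show "\<exists>c. c \<in> ?F \<and> t * f - (\<Sum>s\<in>S. \<iota> (c s) * s) \<in> ord_ge R 1"
      by (intro exI[of _ "restrict c S"]) auto
  qed
  then obtain \<kappa> where
    "\<forall>f\<in>L \<iota> ?A. \<kappa> f \<in> ?F \<and> t * f - (\<Sum>s\<in>S. \<iota> (\<kappa> f s) * s) \<in> ord_ge R 1"
    unfolding bchoice_iff by (elim exE)
  then have \<kappa>: "\<And>f. f \<in> L \<iota> ?A \<Longrightarrow> \<kappa> f \<in> ?F"
    "\<And>f. f \<in> L \<iota> ?A \<Longrightarrow> t * f - (\<Sum>s\<in>S. \<iota> (\<kappa> f s) * s) \<in> ord_ge R 1" by blast+
  have fib: "f - h \<in> L \<iota> A" if f: "f \<in> L \<iota> ?A" and h: "h \<in> L \<iota> ?A" and eq: "\<kappa> f = \<kappa> h" for f h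
  proof -
    have "(t * f - (\<Sum>s\<in>S. \<iota> (\<kappa> f s) * s)) - (t * h - (\<Sum>s\<in>S. \<iota> (\<kappa> h s) * s)) \<in> ord_ge R 1"
      by (rule ord_ge_diff[OF R \<kappa>(2)[OF f] \<kappa>(2)[OF h]])
    then have "t * (f - h) \<in> ord_ge R 1" by (simp add: eq right_diff_distrib)
    then have "f - h \<in> ord_ge R (- A R)" using ord_ge_mult_iff[OF R t(1), of "f - h" "- A R"] t(2) by simp
    moreover have "f - h \<in> L \<iota> ?A" using A' f h by (rule L_diff)
    then have "f - h \<in> ord_ge R' (- ?A R')" if "R' \<in> points \<iota>" for R'
      using that by (simp only: L_iff[OF A'])
    then have "f - h \<in> ord_ge R' (- A R')" if "R' \<in> points \<iota>" "R' \<noteq> R" for R'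
      using that by (fastforce simp: pt_def)
    ultimately show ?thesis unfolding L_iff[OF A] by blast
  qed
  \<comment> \<open>One representative for each coordinate family in use; subtracting it lands in
    \<open>L(A)\<close>, and the pair determines \<open>f\<close>.\<close>
  define rep where "rep c = (SOME f. f \<in> L \<iota> ?A \<and> \<kappa> f = c)" for c
  have rep: "rep (\<kappa> f) \<in> L \<iota> ?A \<and> \<kappa> (rep (\<kappa> f)) = \<kappa> f" if "f \<in> L \<iota> ?A" for f
    unfolding rep_def by (rule someI[of "\<lambda>h. h \<in> L \<iota> ?A \<and> \<kappa> h = \<kappa> f" f]) (simp add: that)
  let ?g = "\<lambda>f. (\<kappa> f, f - rep (\<kappa> f))"
  have inj: "inj_on ?g (L \<iota> ?A)" by (rule inj_onI) auto
  have im: "?g ` L \<iota> ?A \<subseteq> ?F \<times> L \<iota> A"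
  proof (rule image_subsetI)
    fix f assume f: "f \<in> L \<iota> ?A"
    then have "f - rep (\<kappa> f) \<in> L \<iota> A" using rep[OF f] by (intro fib) simp_all
    then show "?g f \<in> ?F \<times> L \<iota> A" using \<kappa>(1)[OF f] by blast
  qed
  have finF: "finite (?F \<times> L \<iota> A)" using fin S(1) by (intro finite_cartesian_product finite_PiE) simp_all
  show fin': "finite (L \<iota> ?A)" by (rule inj_on_finite[OF inj im finF])
  have "CARD('k) ^ ell \<iota> ?A = card (L \<iota> ?A)" using card_L[OF A' fin'] by simp
  also have "\<dots> \<le> card (?F \<times> L \<iota> A)" by (rule card_inj_on_le[OF inj im finF])
  also have "\<dots> = CARD('k) ^ (ell \<iota> A + point_degree \<iota> R)"
    using S card_L[OF A fin] by (simp add: card_cartesian_product card_PiE power_add mult.commute)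
  finally show "ell \<iota> ?A \<le> ell \<iota> A + point_degree \<iota> R" by (simp only: card_power_le_iff)
qed

lemma L_increase:
  assumes A: "A \<in> divisors \<iota>" "finite (L \<iota> A)"
  shows "\<lbrakk>A' \<in> divisors \<iota>; \<And>R. A R \<le> A' R\<rbrakk> \<Longrightarrow>
    finite (L \<iota> A') \<and> int (ell \<iota> A') \<le> int (ell \<iota> A) + deg \<iota> (A' - A)"
proof (induction "nat (\<Sum>R | A R \<noteq> A' R. A' R - A R)" arbitrary: A')
  case 0
  have fin: "finite {R. A R \<noteq> A' R}"
    using divisors_diff[OF A(1) 0(2)] by (simp add: divisors_def)
  have "(\<Sum>R | A R \<noteq> A' R. A' R - A R) \<le> 0" using 0(1) by simp
  moreover have "0 \<le> (\<Sum>R | A R \<noteq> A' R. A' R - A R)"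
    using 0(3) by (intro sum_nonneg) auto
  ultimately have "(\<Sum>R | A R \<noteq> A' R. A' R - A R) = 0" by simp
  then have "\<forall>R\<in>{R. A R \<noteq> A' R}. A' R - A R = 0"
    using fin 0(3) by (subst (asm) sum_nonneg_eq_0_iff) auto
  then have "A' = A" by auto
  moreover have "A - A = 0" by (rule ext) simp
  ultimately show ?case using A by (simp only: deg_zero) simp
next
  case (Suc n)
  let ?s = "\<lambda>A'. \<Sum>R | A R \<noteq> A' R. A' R - A R"
  have fin: "finite {R. A R \<noteq> A' R}"
    using divisors_diff[OF A(1) Suc(3)] by (simp add: divisors_def)
  have "?s A' \<noteq> 0" using Suc(2) by auto
  then obtain R where R: "A R \<noteq> A' R" by (metis (mono_tags, lifting) mem_Collect_eq sum.neutral)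
  then have less: "A R < A' R" using Suc(4)[of R] by simp
  have Rp: "R \<in> points \<iota>"
    using R divisors_outside[OF A(1)] divisors_outside[OF Suc(3)] by metis
  define E where "E = A' - pt 1 R"
  have E: "E \<in> divisors \<iota>" unfolding E_def using Suc(3) divisors_pt[OF Rp] by (rule divisors_diff)
  have A'E: "A' = E + pt 1 R" by (simp add: E_def)
  have ge: "A R' \<le> E R'" for R' using Suc(4)[of R'] less by (simp add: E_def pt_def)
  \<comment> \<open>The measure weighs all points equally, so lowering \<open>A'\<close> by one
    point decreases it by exactly one, whatever the degree of \<open>R\<close>.\<close>
  have "?s A' = (\<Sum>R'\<in>{R. A R \<noteq> A' R}. (E R' - A R') + pt 1 R R')"
    by (simp add: A'E algebra_simps)
  also have "\<dots> = (\<Sum>R'\<in>{R. A R \<noteq> A' R}. E R' - A R') + 1"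
    using fin R by (simp add: sum.distrib pt_def sum.delta)
  also have "(\<Sum>R'\<in>{R. A R \<noteq> A' R}. E R' - A R') = ?s E"
    using fin less by (intro sum.mono_neutral_right) (auto simp: E_def pt_def split: if_splits)
  finally have "n = nat (?s E)" using Suc(2) by linarith
  then have IH: "finite (L \<iota> E)" "int (ell \<iota> E) \<le> int (ell \<iota> A) + deg \<iota> (E - A)"
    using Suc(1)[of E] E ge by blast+
  have "deg \<iota> (A' - A) = deg \<iota> (E - A) + int (point_degree \<iota> R)"
    using E A(1) Suc(3) divisors_pt[OF Rp, of 1]
    by (simp add: deg_diff A'E deg_add deg_pt)
  then show ?case using L_add_point[OF E Rp IH(1)] IH(2) by (simp add: A'E)
qed

text \<open>Enlarging \<open>A\<close> to its positive part reduces this to growth from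
  \<open>L(0)\<close>, the finite constant field.\<close>

lemma finite_L:
  assumes "A \<in> divisors \<iota>"
  shows "finite (L \<iota> A)"
proof -
  let ?A = "\<lambda>R. max (A R) 0"
  have A': "?A \<in> divisors \<iota>"
    using assms by (rule divisors_if_support_le[OF _ assms]) simp
  have "finite (L \<iota> 0)" by (simp add: L_zero)
  then have "finite (L \<iota> ?A)" using L_increase[OF divisors_zero _ A'] by simp
  moreover have "L \<iota> A \<subseteq> L \<iota> ?A" by (rule L_mono[OF assms A']) simp
  ultimately show ?thesis by (rule finite_subset[rotated])
qed

lemma card_L': "E \<in> divisors \<iota> \<Longrightarrow> card (L \<iota> E) = CARD('k) ^ ell \<iota> E"
  by (simp add: card_L finite_L)

lemma ell_increase:
  assumes "A \<in> divisors \<iota>" "A' \<in> divisors \<iota>" "\<And>R. A R \<le> A' R"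
  shows "int (ell \<iota> A') \<le> int (ell \<iota> A) + deg \<iota> (A' - A)"
  using L_increase[OF assms(1) finite_L[OF assms(1)] assms(2,3)] by simp

lemma ell_eqI:
  assumes "A \<in> divisors \<iota>" "A' \<in> divisors \<iota>" "card (L \<iota> A) = card (L \<iota> A')"
  shows "ell \<iota> A = ell \<iota> A'"
  using assms card_power_le_iff[of "ell \<iota> A" "ell \<iota> A'"] card_power_le_iff[of "ell \<iota> A'" "ell \<iota> A"]
  by (simp add: card_L')

lemma ell_zero: "ell \<iota> 0 = 1"
proof -
  have "inj \<iota>"
    by (rule injI) (metis embed_diff embed_eq_0_iff eq_iff_diff_eq_0)
  then have "CARD('k) ^ ell \<iota> 0 = CARD('k) ^ 1"
    using card_L'[OF divisors_zero] by (simp add: L_zero card_image)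
  then show ?thesis using card_power_le_iff by (metis antisym order_refl)
qed

lemma ell_minus_principal:
  assumes "D \<in> divisors \<iota>" "f \<noteq> 0"
  shows "ell \<iota> (D - principal \<iota> f) = ell \<iota> D"
proof (rule ell_eqI)
  have "inj_on (\<lambda>h. f * h) (L \<iota> D)" using assms(2) by (auto simp: inj_on_def)
  then show "card (L \<iota> (D - principal \<iota> f)) = card (L \<iota> D)"
    by (simp add: L_minus_principal[OF assms] card_image)
qed (use assms divisors_diff divisors_principal in auto)

end

section \<open>Riemann's inequality\<close>

context curve
begin

text \<open>For the pole divisor of \<open>f\<close>, this is applied to
  \<open>inverse f\<close>.\<close>

definition zero_divisor :: "'a \<Rightarrow> 'a divisor" where
  "zero_divisor f = (\<lambda>R. if R \<in> points \<iota> then max 0 (R f) else 0)"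

lemma divisors_zero_divisor: "f \<noteq> 0 \<Longrightarrow> zero_divisor f \<in> divisors \<iota>"
  by (rule divisors_if_support_le[OF divisors_principal divisors_principal, of f f])
    (auto simp: zero_divisor_def principal_def)

lemma deg_zero_divisor_le:
  assumes "rank_le f N" "f \<noteq> 0"
  shows "deg \<iota> (zero_divisor f) \<le> int N"
proof -
  let ?V = "{v \<in> points \<iota>. 0 < v f}"
  have "deg \<iota> (zero_divisor f) = (\<Sum>R\<in>?V. zero_divisor f R * int (point_degree \<iota> R))"
    using finite_zeros[OF assms(2)]
    by (intro deg_eq_sum) (auto simp: zero_divisor_def split: if_splits)
  also have "\<dots> = (\<Sum>R\<in>?V. R f * int (point_degree \<iota> R))"
    by (intro sum.cong) (auto simp: zero_divisor_def)
  also have "\<dots> \<le> int N"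
    by (rule zeros_le_rank[OF assms finite_zeros[OF assms(2)]]) auto
  finally show ?thesis .
qed

text \<open>The residue field is finite, so two powers of \<open>x\<close> have the same residue at
  \<open>R\<close>; the polynomial is \<open>X ^ i - X ^ j\<close>.\<close>

lemma ex_vanishing_poly:
  assumes R: "R \<in> points \<iota>" and x: "0 \<le> R x"
  shows "\<exists>p. p \<noteq> 0 \<and> ev p x \<in> ord_ge R 1"
proof -
  obtain S where S: "finite S" "\<And>f. f \<in> ord_ge R 0 \<Longrightarrow> \<exists>c. f - (\<Sum>s\<in>S. \<iota> (c s) * s) \<in> ord_ge R 1"
    using point_degree_basis[OF R] by metis
  let ?F = "S \<rightarrow>\<^sub>E (UNIV :: 'k set)"
  have "\<forall>i. \<exists>c. c \<in> ?F \<and> x ^ i - (\<Sum>s\<in>S. \<iota> (c s) * s) \<in> ord_ge R 1"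
  proof
    fix i :: nat
    have "x ^ i \<in> ord_ge R 0" using x by (simp add: ord_ge_def pt_power[OF R])
    then obtain c where "x ^ i - (\<Sum>s\<in>S. \<iota> (c s) * s) \<in> ord_ge R 1" using S(2) by blast
    then show "\<exists>c. c \<in> ?F \<and> x ^ i - (\<Sum>s\<in>S. \<iota> (c s) * s) \<in> ord_ge R 1"
      by (intro exI[of _ "restrict c S"]) auto
  qed
  then obtain c where c: "\<forall>i. c i \<in> ?F \<and> x ^ i - (\<Sum>s\<in>S. \<iota> (c i s) * s) \<in> ord_ge R 1"
    unfolding choice_iff by (elim exE)
  have "finite ?F" using S(1) by (intro finite_PiE) simp_all
  then have "finite (range c)" using c by (intro finite_subset[of "range c" ?F]) auto
  then have "\<not> inj c" using finite_imageD infinite_UNIV_nat by blast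
  then obtain i j where ij: "i \<noteq> j" "c i = c j" by (auto simp: inj_on_def)
  let ?p = "monom 1 i - monom (1 :: 'k) j"
  have "coeff ?p i = 1" using ij(1) by simp
  then have "?p \<noteq> 0" by (metis coeff_0 zero_neq_one)
  moreover have eq: "ev ?p x = (x ^ i - (\<Sum>s\<in>S. \<iota> (c i s) * s)) - (x ^ j - (\<Sum>s\<in>S. \<iota> (c j s) * s))"
    by (simp add: ev_diff ev_monom embed_one ij(2))
  have "ev ?p x \<in> ord_ge R 1" unfolding eq by (rule ord_ge_diff[OF R]) (use c in blast)+
  ultimately show ?thesis by blast
qed

lemma sum_divisors_apply: "(\<Sum>s\<in>T. (D s :: 'a divisor)) R = (\<Sum>s\<in>T. D s R)"
  by (induction T rule: infinite_finite_induct) simp_all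

lemma riemann_bound: "\<exists>\<gamma>. \<forall>A\<in>divisors \<iota>. deg \<iota> A - int (ell \<iota> A) \<le> \<gamma>"
proof -
  obtain x S where x: "\<not> algebraic_elt \<iota> x" and S: "spans x S"
    and indep: "\<forall>c. (\<Sum>s\<in>S. ev (c s) x * s) = 0 \<longrightarrow> (\<forall>s\<in>S. c s = 0)"
    using ex_basis .
  have finS: "finite S" using S by (simp add: spans_def)
  have x0: "x \<noteq> 0" using ev_nonzero[OF x, of "[:0, 1:]"] by (simp add: embed_one)
  have S0: "s \<noteq> 0" if s: "s \<in> S" for s
  proof
    assume "s = 0"
    then have "(\<Sum>r\<in>S. ev (if r = s then 1 else 0) x * r) = 0" by (intro sum.neutral) auto
    from indep[rule_format, OF this s] show False by simp
  qed
  \<comment> \<open>A divisor with every basis element in \<open>L(C)\<close>; it does not depend on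
    \<open>A\<close>, and the final bound is \<open>deg C - card S\<close>.\<close>
  define C where "C = (\<Sum>s\<in>S. zero_divisor (inverse s))"
  have Cdiv: "C \<in> divisors \<iota>" and Cs: "s \<in> S \<Longrightarrow> R \<in> points \<iota> \<Longrightarrow> - R s \<le> C R" for s R
  proof -
    have "T \<subseteq> S \<Longrightarrow> (\<Sum>s\<in>T. zero_divisor (inverse s)) \<in> divisors \<iota>" if "finite T" for T
      using that
    proof (induction T rule: finite_induct)
      case (insert s T)
      have "zero_divisor (inverse s) \<in> divisors \<iota>"
        using S0 insert by (intro divisors_zero_divisor) auto
      then show ?case unfolding sum.insert[OF insert.hyps]
        by (rule divisors_add) (use insert in blast)
    qed (simp add: divisors_zero)
    then show "C \<in> divisors \<iota>" using finS by (simp add: C_def)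
    assume s: "s \<in> S" and R: "R \<in> points \<iota>"
    have CR: "C R = (\<Sum>s\<in>S. max 0 (- R s))"
      unfolding C_def using R by (simp add: sum_divisors_apply zero_divisor_def pt_inverse[OF R])
    have "max 0 (- R s) \<le> (\<Sum>s\<in>S. max 0 (- R s))"
      using s finS by (intro member_le_sum) auto
    then show "- R s \<le> C R" using CR by simp
  qed
  have "deg \<iota> A - int (ell \<iota> A) \<le> deg \<iota> C - int (card S)" if A: "A \<in> divisors \<iota>" for A
  proof -
    \<comment> \<open>The support of \<open>A\<close> away from the poles of \<open>x\<close> will
      be covered by zeros of \<open>y = p(x)\<close>, the rest by \<open>k\<close> times the poles
      of \<open>x\<close>.\<close>
    define T where "T = {R. A R \<noteq> 0 \<and> 0 \<le> R x}"
    have finsupp: "finite {R. A R \<noteq> 0}" and supp: "{R. A R \<noteq> 0} \<subseteq> points \<iota>"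
      using A by (auto simp: divisors_def)
    have finT: "finite T" using finsupp by (simp add: T_def)
    have "\<forall>R\<in>T. \<exists>p. p \<noteq> 0 \<and> ev p x \<in> ord_ge R 1"
      using ex_vanishing_poly supp by (auto simp: T_def)
    then obtain pR where "\<forall>R\<in>T. pR R \<noteq> 0 \<and> ev (pR R) x \<in> ord_ge R 1"
      unfolding bchoice_iff by (elim exE)
    then have pR: "\<And>R. R \<in> T \<Longrightarrow> pR R \<noteq> 0" "\<And>R. R \<in> T \<Longrightarrow> ev (pR R) x \<in> ord_ge R 1" by blast+
    \<comment> \<open>\<open>nat\<close> turns negative coefficients of \<open>A\<close> into
      exponent zero, which suffices since \<open>R y\<close> is nonnegative on
      \<open>T\<close>.\<close>
    define p where "p = (\<Prod>R\<in>T. pR R ^ nat (A R))"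
    have p0: "p \<noteq> 0" using pR(1) finT by (simp add: p_def)
    define y where "y = ev p x"
    have y0: "y \<noteq> 0" unfolding y_def by (rule ev_nonzero[OF x p0])
    have vanish: "A R \<le> R y" if R: "R \<in> T" for R
    proof -
      have Rp: "R \<in> points \<iota>" and Rx: "0 \<le> R x" using R supp by (auto simp: T_def)
      have ne: "ev (pR R') x \<noteq> 0" if "R' \<in> T" for R' using ev_nonzero[OF x] pR(1) that by blast
      have nonneg: "0 \<le> R (ev (pR R') x)" if "R' \<in> T" for R'
        using ev_ord_ge[OF Rp, of x "pR R'"] Rx ne[OF that] by (simp add: ord_ge_def)
      have "R y = (\<Sum>R'\<in>T. R (ev (pR R') x ^ nat (A R')))"
        unfolding y_def p_def ev_prod ev_power using ne by (intro pt_prod[OF Rp]) auto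
      also have "\<dots> = (\<Sum>R'\<in>T. int (nat (A R')) * R (ev (pR R') x))"
        by (simp only: pt_power[OF Rp])
      also have "\<dots> \<ge> int (nat (A R)) * R (ev (pR R) x)"
        using finT R nonneg by (intro member_le_sum) auto
      moreover have "int (nat (A R)) * 1 \<le> int (nat (A R)) * R (ev (pR R) x)"
        using pR(2)[OF R] ne[OF R] by (intro mult_left_mono) (simp_all add: ord_ge_def)
      ultimately show ?thesis by linarith
    qed
    define k where "k = nat (\<Sum>R | A R \<noteq> 0. \<bar>A R\<bar>)"
    have Ak: "A R \<le> int k" for R
    proof (cases "A R = 0")
      case False
      then have "\<bar>A R\<bar> \<le> (\<Sum>R | A R \<noteq> 0. \<bar>A R\<bar>)"
        using finsupp by (intro member_le_sum) auto
      then show ?thesis by (simp add: k_def)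
    qed simp
    define E where "E = zero_divisor y + (\<lambda>R. int k * zero_divisor (inverse x) R)"
    have zy: "zero_divisor y \<in> divisors \<iota>" by (rule divisors_zero_divisor[OF y0])
    have zx: "zero_divisor (inverse x) \<in> divisors \<iota>" using x0 by (intro divisors_zero_divisor) simp
    have kzx: "(\<lambda>R. int k * zero_divisor (inverse x) R) \<in> divisors \<iota>"
      by (rule divisors_if_support_le[OF zx zx]) simp
    have E: "E \<in> divisors \<iota>" unfolding E_def using zy kzx by (rule divisors_add)
    have EC: "E + C \<in> divisors \<iota>" using E Cdiv by (rule divisors_add)
    have ER: "E R = max 0 (R y) + int k * max 0 (- R x)" if "R \<in> points \<iota>" for R
      using that by (simp add: E_def zero_divisor_def pt_inverse)
    have AE: "A R \<le> E R" for R
    proof (cases "A R = 0")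
      case True
      then show ?thesis
        using divisors_outside[OF E, of R] ER[of R] by (cases "R \<in> points \<iota>") simp_all
    next
      case False
      then have Rp: "R \<in> points \<iota>" using supp by blast
      show ?thesis
      proof (cases "0 \<le> R x")
        case True
        then have "R \<in> T" using False by (simp add: T_def)
        then show ?thesis using vanish[of R] ER[OF Rp] True by simp
      next
        case neg: False
        then have "int k * 1 \<le> int k * max 0 (- R x)" by (intro mult_left_mono) auto
        then show ?thesis using Ak[of R] ER[OF Rp] by simp
      qed
    qed
    \<comment> \<open>Degrees over rational subfields bound both parts:
      \<open>card S * degree p\<close> for \<open>K(y)\<close> and \<open>card S\<close> for
      \<open>K(inverse x)\<close>.\<close>
    have degE: "deg \<iota> E \<le> int (card S * degree p) + int k * int (card S)"
    proof -
      have "deg \<iota> (\<lambda>R. int k * zero_divisor (inverse x) R) = int k * deg \<iota> (zero_divisor (inverse x))"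
        using zx by (subst deg_eq_sum[of "{R. zero_divisor (inverse x) R \<noteq> 0}"])
          (auto simp: divisors_def deg_def sum_distrib_left mult.assoc)
      moreover have "deg \<iota> (zero_divisor (inverse x)) \<le> int (card S)"
        using x0 by (intro deg_zero_divisor_le rank_le_inverse[OF x S]) simp
      then have "int k * deg \<iota> (zero_divisor (inverse x)) \<le> int k * int (card S)"
        by (intro mult_left_mono) auto
      moreover have "deg \<iota> (zero_divisor y) \<le> int (card S * degree p)"
        unfolding y_def using y0[unfolded y_def] by (intro deg_zero_divisor_le rank_le_ev[OF x S])
      ultimately show ?thesis using deg_add[OF zy kzx] by (simp add: E_def)
    qed
    \<comment> \<open>At a pole of \<open>x\<close>, dividing by \<open>y\<close> cancels
      \<open>degree p\<close> factors \<open>x\<close>, so \<open>x ^ i / y\<close> has pole order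
      at most \<open>k\<close> times that of \<open>x\<close> as long as
      \<open>i \<le> m\<close>.\<close>
    define m where "m = degree p + k"
    have elts: "x ^ i * s / y \<in> L \<iota> (E + C)" if i: "i \<le> m" and s: "s \<in> S" for i s
    proof -
      have "x ^ i * s / y \<in> ord_ge R (- (E + C) R)" if Rp: "R \<in> points \<iota>" for R
      proof -
        have val: "R (x ^ i * s / y) = int i * R x + R s - R y"
          using x0 S0[OF s] y0 by (simp add: pt_divide[OF Rp] pt_mult[OF Rp] pt_power[OF Rp])
        have "- E R \<le> int i * R x - R y"
        proof (cases "0 \<le> R x")
          case True
          then have "0 \<le> int i * R x" "E R = max 0 (R y)" using ER[OF Rp] by simp_all
          then show ?thesis by linarith
        next
          case False
          then have "R y = int (degree p) * R x"
            unfolding y_def using ev_pole[OF Rp x0 _ p0] by simp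
          moreover from this have "max 0 (R y) = 0" using False by (simp add: mult_nonneg_nonpos)
          moreover have "(int i - int (degree p)) * (- R x) \<le> int k * (- R x)"
            using i False by (intro mult_right_mono) (auto simp: m_def)
          ultimately show ?thesis using ER[OF Rp] False by (simp add: algebra_simps)
        qed
        then show ?thesis using val Cs[OF s Rp] by (simp add: ord_ge_def)
      qed
      then show ?thesis by (simp only: L_iff[OF EC]) blast
    qed
    let ?D = "S \<times> {..m}"
    let ?F = "?D \<rightarrow>\<^sub>E (UNIV :: 'k set)"
    let ?e = "\<lambda>c. \<Sum>(s, i)\<in>?D. \<iota> (c (s, i)) * (x ^ i * s / y)"
    \<comment> \<open>After multiplication by \<open>y\<close>, equal images give a polynomial
      relation between the basis elements.\<close>
    have inj: "inj_on ?e ?F"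
    proof (rule inj_onI)
      fix c d assume c: "c \<in> ?F" and d: "d \<in> ?F" and eq: "?e c = ?e d"
      define a where "a s = (\<Sum>i\<le>m. monom (c (s, i) - d (s, i)) i)" for s
      have "(\<Sum>s\<in>S. ev (a s) x * s) = y * (?e c - ?e d)"
        using y0 by (simp add: a_def ev_sum ev_monom embed_diff sum_distrib_right sum_distrib_left
            sum.cartesian_product[symmetric] sum_subtractf algebra_simps)
      then have "(\<Sum>s\<in>S. ev (a s) x * s) = 0" using eq by simp
      then have a0: "\<forall>s\<in>S. a s = 0" by (rule indep[rule_format, THEN ballI])
      have "c (s, i) = d (s, i)" if "s \<in> S" "i \<le> m" for s i
      proof -
        have "coeff (a s) i = c (s, i) - d (s, i)"
          using that by (simp add: a_def coeff_sum if_distrib sum.delta cong: if_cong)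
        then show ?thesis using a0 that by simp
      qed
      then show "c = d" using c d by (intro PiE_ext[of c ?D "\<lambda>_. UNIV"]) auto
    qed
    have "?e ` ?F \<subseteq> L \<iota> (E + C)"
    proof (rule image_subsetI)
      fix c
      show "?e c \<in> L \<iota> (E + C)"
        using L_embed[OF EC elts]
        by (intro sum_closed L_zero_mem L_add[OF EC]) (auto simp del: times_divide_eq_right)
    qed
    then have "card ?F \<le> card (L \<iota> (E + C))"
      by (rule card_inj_on_le[OF inj _ finite_L[OF EC]])
    then have "CARD('k) ^ (card S * (m + 1)) \<le> CARD('k) ^ ell \<iota> (E + C)"
      using finS by (simp add: card_L'[OF EC] card_PiE card_cartesian_product)
    then have "card S * (m + 1) \<le> ell \<iota> (E + C)" by (simp only: card_power_le_iff)
    then have 1: "int (card S) * (int m + 1) \<le> int (ell \<iota> (E + C))"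
      by (metis of_nat_1 of_nat_add of_nat_le_iff of_nat_mult)
    have 2: "int (ell \<iota> (E + C)) \<le> int (ell \<iota> E) + deg \<iota> C"
    proof -
      have "0 \<le> C R" for R
        by (simp add: C_def sum_divisors_apply zero_divisor_def sum_nonneg)
      then have "int (ell \<iota> (E + C)) \<le> int (ell \<iota> E) + deg \<iota> (E + C - E)"
        by (intro ell_increase E EC) simp
      then show ?thesis by simp
    qed
    have 3: "int (ell \<iota> E) \<le> int (ell \<iota> A) + deg \<iota> (E - A)"
      by (rule ell_increase[OF A E AE])
    \<comment> \<open>Since \<open>deg E \<le> card S * m\<close>, the terms in \<open>m\<close>
      cancel and leave \<open>deg C - card S\<close>.\<close>
    show ?thesis
      using 1 2 3 degE deg_diff[OF E A] by (simp add: m_def algebra_simps)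
  qed
  then show ?thesis by blast
qed

section \<open>Principal divisors and the genus\<close>

lemma deg_principal:
  assumes "f \<noteq> 0"
  shows "deg \<iota> (principal \<iota> f) = 0"
proof -
  obtain \<gamma> where \<gamma>: "\<And>A. A \<in> divisors \<iota> \<Longrightarrow> deg \<iota> A - int (ell \<iota> A) \<le> \<gamma>"
    using riemann_bound by blast
  have le: "0 \<le> deg \<iota> (principal \<iota> h)" if h: "h \<noteq> 0" for h
  proof (rule ccontr)
    assume neg: "\<not> 0 \<le> deg \<iota> (principal \<iota> h)"
    \<comment> \<open>The zero divisor shows \<open>\<gamma> \<ge> -1\<close>, so nothing is
      truncated. The negated divisor of \<open>h ^ n\<close> has degree at least \<open>n\<close>
      but \<open>ell\<close> equal to one, and \<open>n - 1 > \<gamma>\<close>.\<close>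
    define n where "n = nat (\<gamma> + 2)"
    have hn: "h ^ n \<noteq> 0" using h by simp
    let ?D = "0 - principal \<iota> (h ^ n)"
    have ph: "principal \<iota> (h ^ n) \<in> divisors \<iota>" by (rule divisors_principal[OF hn])
    have D: "?D \<in> divisors \<iota>" using divisors_zero ph by (rule divisors_diff)
    have "ell \<iota> ?D = 1" using ell_minus_principal[OF divisors_zero hn] ell_zero by simp
    moreover have "deg \<iota> ?D = int n * - deg \<iota> (principal \<iota> h)"
    proof -
      have fin: "finite {R. principal \<iota> h R \<noteq> 0}"
        using divisors_principal[OF h] by (simp add: divisors_def)
      have "deg \<iota> (principal \<iota> (h ^ n))
          = (\<Sum>R | principal \<iota> h R \<noteq> 0. principal \<iota> (h ^ n) R * int (point_degree \<iota> R))"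
        by (rule deg_eq_sum[OF fin]) (auto simp: principal_def pt_power)
      also have "\<dots> = int n * deg \<iota> (principal \<iota> h)"
        unfolding deg_def sum_distrib_left
        by (intro sum.cong) (auto simp: principal_def pt_power)
      finally show ?thesis using deg_diff[OF divisors_zero ph] by simp
    qed
    moreover have "int n * 1 \<le> int n * - deg \<iota> (principal \<iota> h)"
      using neg by (intro mult_left_mono) auto
    ultimately have "int n - 1 \<le> \<gamma>" using \<gamma>[OF D] by linarith
    then show False using \<gamma>[OF divisors_zero] ell_zero by (simp add: n_def)
  qed
  have pf: "principal \<iota> f \<in> divisors \<iota>" by (rule divisors_principal[OF assms])
  have "principal \<iota> (inverse f) = 0 - principal \<iota> f"
    by (rule ext) (simp add: principal_def pt_inverse)
  then have "deg \<iota> (principal \<iota> (inverse f)) = - deg \<iota> (principal \<iota> f)"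
    using deg_diff[OF divisors_zero pf] by simp
  then show ?thesis using le[OF assms] le[of "inverse f"] assms by simp
qed

lemma L_trivial_if_deg_neg:
  assumes A: "A \<in> divisors \<iota>" and "deg \<iota> A < 0"
  shows "L \<iota> A = {0}"
proof (rule ccontr)
  assume "L \<iota> A \<noteq> {0}"
  then obtain f where f: "f \<in> L \<iota> A" "f \<noteq> 0" using L_zero_mem[of A] by blast
  have pf: "principal \<iota> f \<in> divisors \<iota>" by (rule divisors_principal[OF f(2)])
  have "0 \<le> principal \<iota> f + A" using f by (simp add: L_def)
  then have "0 \<le> deg \<iota> (principal \<iota> f + A)"
    by (intro deg_nonneg) (simp add: le_fun_def)
  then show False using deg_add[OF pf A] deg_principal[OF f(2)] assms(2) by simp
qed

text \<open>Boundedness of \<open>deg A - ell A\<close> makes the \<open>GREATEST\<close> in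
  \<open>genus\<close> an attained maximum.\<close>

lemma ell_ge_genus:
  assumes "A \<in> divisors \<iota>"
  shows "deg \<iota> A + 1 - genus \<iota> \<le> int (ell \<iota> A)"
proof -
  obtain \<gamma> where \<gamma>: "\<And>A. A \<in> divisors \<iota> \<Longrightarrow> deg \<iota> A - int (ell \<iota> A) \<le> \<gamma>"
    using riemann_bound by blast
  define P where "P n \<longleftrightarrow> (\<exists>A\<in>divisors \<iota>. n = deg \<iota> A - int (ell \<iota> A) + 1)" for n
  have bound: "n \<le> \<gamma> + 1" if "P n" for n using that \<gamma> by (force simp: P_def)
  obtain n0 where n0: "P n0" using assms by (auto simp: P_def)
  have "\<exists>n. P n \<and> (\<forall>m. P m \<longrightarrow> nat (\<gamma> + 1 - n) \<le> nat (\<gamma> + 1 - m))"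
    using ex_has_least_nat[of P n0 "\<lambda>n. nat (\<gamma> + 1 - n)"] n0 by blast
  then obtain n where n: "P n" and least: "\<And>m. P m \<Longrightarrow> nat (\<gamma> + 1 - n) \<le> nat (\<gamma> + 1 - m)"
    by blast
  have max: "m \<le> n" if "P m" for m
    using least[OF that] bound[OF that] bound[OF n] by linarith
  have "genus \<iota> = n"
    unfolding genus_def P_def[symmetric] using n max by (rule Greatest_equality)
  moreover have "P (deg \<iota> A - int (ell \<iota> A) + 1)" using assms by (auto simp: P_def)
  ultimately show ?thesis using max by fastforce
qed

lemma genus_nonneg: "0 \<le> genus \<iota>"
  using ell_ge_genus[OF divisors_zero] ell_zero by simp

end

section \<open>Discrepancies\<close>

context curve
begin

section \<open>The sets \<open>Gam\<close> and their witnesses\<close>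

lemma Gam_iff:
  assumes A: "A \<in> divisors \<iota>" and P: "P \<in> points \<iota>"
  shows "A \<in> Gam \<iota> P \<longleftrightarrow> (\<exists>f\<in>L \<iota> A. f \<noteq> 0 \<and> P f = - A P)"
proof -
  let ?A = "A - pt 1 P"
  have A': "?A \<in> divisors \<iota>" using A divisors_pt[OF P] by (rule divisors_diff)
  have sub: "L \<iota> ?A \<subseteq> L \<iota> A" by (rule L_mono[OF A' A]) (simp add: pt_def)
  \<comment> \<open>Within \<open>L(A)\<close>, passing to \<open>L(A - P)\<close> excludes exactly
    the functions with the extreme pole order \<open>A P\<close> at \<open>P\<close>.\<close>
  have key: "f \<in> L \<iota> ?A \<longleftrightarrow> f = 0 \<or> P f \<noteq> - A P" if f: "f \<in> L \<iota> A" for f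
  proof (cases "f = 0")
    case False
    have ge: "- A R \<le> R f" if "R \<in> points \<iota>" for R
      using f that False by (simp add: L_iff[OF A] ord_ge_def)
    have "f \<in> L \<iota> ?A \<longleftrightarrow> (\<forall>R\<in>points \<iota>. - ?A R \<le> R f)"
      using False by (simp add: L_iff[OF A'] ord_ge_def)
    also have "\<dots> \<longleftrightarrow> P f \<noteq> - A P"
    proof
      assume "\<forall>R\<in>points \<iota>. - ?A R \<le> R f"
      then show "P f \<noteq> - A P" using P by (auto simp: pt_def dest!: bspec[of _ _ P])
    next
      assume "P f \<noteq> - A P"
      then have "- A P < P f" using ge[OF P] by simp
      then show "\<forall>R\<in>points \<iota>. - ?A R \<le> R f" using ge by (simp add: pt_def)
    qed
    finally show ?thesis using False by simp
  qed (simp add: L_zero_mem)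
  have "A \<in> Gam \<iota> P \<longleftrightarrow> (\<exists>f\<in>L \<iota> A. f \<notin> L \<iota> ?A)"
    using A sub by (auto simp: Gam_def)
  then show ?thesis using key by blast
qed

text \<open>The product of two witnesses attains the sum of their extreme pole orders.\<close>

lemma Gam_add:
  assumes D: "D \<in> divisors \<iota>" "D \<in> Gam \<iota> P" and E: "E \<in> divisors \<iota>" "E \<in> Gam \<iota> P"
    and P: "P \<in> points \<iota>"
  shows "D + E \<in> Gam \<iota> P"
proof -
  obtain f where f: "f \<in> L \<iota> D" "f \<noteq> 0" "P f = - D P" using D Gam_iff[OF D(1) P] by blast
  obtain h where h: "h \<in> L \<iota> E" "h \<noteq> 0" "P h = - E P" using E Gam_iff[OF E(1) P] by blast
  have "f * h \<in> L \<iota> (D + E)" by (rule L_mult[OF D(1) E(1) f(1) h(1)])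
  moreover have "P (f * h) = - (D + E) P" using f h by (simp add: pt_mult[OF P])
  ultimately show ?thesis
    unfolding Gam_iff[OF divisors_add[OF D(1) E(1)] P]
    using f(2) h(2) by (intro bexI[of _ "f * h"]) auto
qed

text \<open>The same witness serves, as \<open>n Q\<close> leaves the coefficient at
  \<open>P\<close> unchanged.\<close>

lemma Gam_add_point:
  assumes A: "A \<in> divisors \<iota>" "A \<in> Gam \<iota> P" and P: "P \<in> points \<iota>"
    and Q: "Q \<in> points \<iota>" "P \<noteq> Q" and "0 \<le> n"
  shows "A + pt n Q \<in> Gam \<iota> P"
proof -
  let ?A = "A + pt n Q"
  have A': "?A \<in> divisors \<iota>" using A(1) divisors_pt[OF Q(1)] by (rule divisors_add)
  obtain f where f: "f \<in> L \<iota> A" "f \<noteq> 0" "P f = - A P" using A Gam_iff[OF A(1) P] by blast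
  have "L \<iota> A \<subseteq> L \<iota> ?A" using \<open>0 \<le> n\<close> by (intro L_mono A A') (simp add: pt_def)
  moreover have "- ?A P = - A P" using Q(2) by (simp add: pt_def)
  ultimately show ?thesis using f unfolding Gam_iff[OF A' P] by auto
qed

lemma not_Gam_if_deg_neg:
  assumes "A \<in> divisors \<iota>" "deg \<iota> A < 0" "P \<in> points \<iota>"
  shows "A \<notin> Gam \<iota> P"
  using Gam_iff[OF assms(1,3)] L_trivial_if_deg_neg[OF assms(1,2)] by blast

lemma rational_pointD:
  assumes "P \<in> rational_points \<iota>"
  shows "P \<in> points \<iota>" "point_degree \<iota> P = 1"
  using assms by (auto simp: rational_points_def)

text \<open>At a rational point one element \<open>s\<close> spans the residue field; expanding
  \<open>1\<close> in it as well replaces \<open>s\<close> by the constant \<open>1\<close>.\<close>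

lemma residue_constant:
  assumes P: "P \<in> rational_points \<iota>" and f: "f \<in> ord_ge P 0"
  shows "\<exists>c. f - \<iota> c \<in> ord_ge P 1"
proof -
  have Pp: "P \<in> points \<iota>" by (rule rational_pointD[OF P])
  obtain S where S: "\<And>f. f \<in> ord_ge P 0 \<Longrightarrow> \<exists>c. f - (\<Sum>s\<in>S. \<iota> (c s) * s) \<in> ord_ge P 1"
    "card S = point_degree \<iota> P" using point_degree_basis[OF Pp] by metis
  then obtain s where s: "S = {s}" using rational_pointD(2)[OF P] card_1_singletonE by metis
  obtain c where c: "f - \<iota> (c s) * s \<in> ord_ge P 1" using S(1)[OF f] s by auto
  have "1 \<in> ord_ge P 0" by (simp add: ord_ge_def pt_one[OF Pp])
  then obtain d where d: "1 - \<iota> (d s) * s \<in> ord_ge P 1" using S(1)[of 1] s by auto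
  have d0: "d s \<noteq> 0"
  proof
    assume "d s = 0"
    then show False using d one_notin_ord_ge_1[OF Pp] by simp
  qed
  have "(f - \<iota> (c s) * s) - \<iota> (c s / d s) * (1 - \<iota> (d s) * s) \<in> ord_ge P 1"
    by (intro ord_ge_diff[OF Pp c] ord_ge_embed[OF Pp d])
  moreover have "\<iota> (c s / d s) * (\<iota> (d s) * s) = \<iota> (c s) * s"
    using d0 by (simp flip: embed_mult mult.assoc)
  ultimately have "f - \<iota> (c s / d s) \<in> ord_ge P 1" by (simp add: right_diff_distrib)
  then show ?thesis by blast
qed

text \<open>A function in \<open>L(A - P)\<close> with full pole at \<open>Q\<close> would cancel the pole at \<open>Q\<close> of a
  witness for \<open>A \<in> \<Gamma>\<^sub>P\<close> without affecting its pole at \<open>P\<close>, so that \<open>A - Q \<in> \<Gamma>\<^sub>P\<close>.\<close>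

lemma discrepancy_swap:
  assumes A: "A \<in> divisors \<iota>" and P: "P \<in> points \<iota>" and Q: "Q \<in> rational_points \<iota>"
    and "P \<noteq> Q" and disc: "A \<in> Gam \<iota> P" "A - pt 1 Q \<notin> Gam \<iota> P"
  shows "A \<in> Gam \<iota> Q" "A - pt 1 P \<notin> Gam \<iota> Q"
proof -
  have Qp: "Q \<in> points \<iota>" by (rule rational_pointD[OF Q])
  have AQ: "A - pt 1 Q \<in> divisors \<iota>" using A divisors_pt[OF Qp] by (rule divisors_diff)
  have AP: "A - pt 1 P \<in> divisors \<iota>" using A divisors_pt[OF P] by (rule divisors_diff)
  \<comment> \<open>Otherwise \<open>h\<close> would lie in \<open>L(A - Q)\<close> and be a witness
    for \<open>A - Q\<close> in \<open>Gam \<iota> P\<close>.\<close>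
  have full: "Q h = - A Q" if h: "h \<in> L \<iota> A" "h \<noteq> 0" "P h = - A P" for h
  proof (rule ccontr)
    assume ne: "Q h \<noteq> - A Q"
    have ge: "- A R \<le> R h" if "R \<in> points \<iota>" for R
      using h(1,2) that by (simp add: L_iff[OF A] ord_ge_def)
    have "- (A - pt 1 Q) R \<le> R h" if "R \<in> points \<iota>" for R
      using ge[OF that] ne by (cases "R = Q") (simp_all add: pt_def)
    then have "h \<in> L \<iota> (A - pt 1 Q)" by (simp add: L_iff[OF AQ] ord_ge_def)
    moreover have "P h = - (A - pt 1 Q) P" using h(3) \<open>P \<noteq> Q\<close> by (simp add: pt_def)
    ultimately show False using disc(2) h(2) Gam_iff[OF AQ P] by blast
  qed
  obtain h where h: "h \<in> L \<iota> A" "h \<noteq> 0" "P h = - A P" using disc(1) Gam_iff[OF A P] by blast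
  show "A \<in> Gam \<iota> Q" using h full[OF h] Gam_iff[OF A Qp] by blast
  show "A - pt 1 P \<notin> Gam \<iota> Q"
  proof
    assume "A - pt 1 P \<in> Gam \<iota> Q"
    then obtain f where f: "f \<in> L \<iota> (A - pt 1 P)" "f \<noteq> 0" "Q f = - (A - pt 1 P) Q"
      using Gam_iff[OF AP Qp] by blast
    have Qf: "Q f = - A Q" using f(3) \<open>P \<noteq> Q\<close> by (simp add: pt_def)
    have "f \<in> ord_ge P (- (A - pt 1 P) P)" using f(1) P by (simp only: L_iff[OF AP])
    then have Pf: "P h < P f" using f(2) h(3) by (simp add: ord_ge_def pt_def)
    have "L \<iota> (A - pt 1 P) \<subseteq> L \<iota> A" by (rule L_mono[OF AP A]) (simp add: pt_def)
    then have fA: "f \<in> L \<iota> A" using f(1) by blast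
    have "h / f \<in> ord_ge Q 0" using h(2) f(2) Qf full[OF h] by (simp add: ord_ge_def pt_divide[OF Qp])
    then obtain c where c: "h / f - \<iota> c \<in> ord_ge Q 1" using residue_constant[OF Q] by blast
    \<comment> \<open>\<open>c\<close> is the residue of \<open>h / f\<close> at \<open>Q\<close>,
      so \<open>w\<close> has a smaller pole order there; \<open>f\<close> has smaller pole order
      than \<open>h\<close> at \<open>P\<close>, so \<open>w\<close> keeps that of
      \<open>h\<close>.\<close>
    define w where "w = h - \<iota> c * f"
    have wA: "w \<in> L \<iota> A" unfolding w_def by (rule L_diff[OF A h(1) L_embed[OF A fA]])
    have "w \<noteq> 0 \<and> P w = P h"
    proof (cases "c = 0")
      case True
      then show ?thesis using h by (simp add: w_def)
    next
      case False
      then have ne: "- (\<iota> c * f) \<noteq> 0" using f(2) by simp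
      have "P (- (\<iota> c * f)) = P f"
        using False f(2) by (simp add: pt_uminus[OF P] pt_mult[OF P] pt_embed[OF P])
      then show ?thesis using pt_add_eq[OF P h(2) ne] Pf by (simp add: w_def)
    qed
    then have w: "w \<noteq> 0" "P w = - A P" using h(3) by simp_all
    have "w = f * (h / f - \<iota> c)" using f(2) by (simp add: w_def field_simps)
    then have "w \<in> ord_ge Q (Q f + 1)" using ord_ge_mult_iff[OF Qp f(2)] c by simp
    then have "Q w \<noteq> - A Q" using w(1) Qf by (simp add: ord_ge_def)
    then show False using full[OF wA w] by blast
  qed
qed

text \<open>Passing from \<open>A - s P\<close> to \<open>A - (s + 1) P\<close> costs at most one
  dimension, since \<open>P\<close> is rational, and none outside
  \<open>Gam \<iota> P\<close>.\<close>

lemma ell_le_Gam_count: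
  assumes A: "A \<in> divisors \<iota>" and P: "P \<in> rational_points \<iota>"
  shows "ell \<iota> A \<le> ell \<iota> (A - pt (int n) P) + card {s. s < n \<and> A - pt (int s) P \<in> Gam \<iota> P}"
proof (induction n)
  case 0
  have "A - pt (int 0) P = A" by (rule ext) (simp add: pt_def)
  then show ?case by simp
next
  case (Suc n)
  have Pp: "P \<in> points \<iota>" by (rule rational_pointD[OF P])
  define E where "E = A - pt (int n) P"
  define F where "F = A - pt (int (Suc n)) P"
  have E: "E \<in> divisors \<iota>" unfolding E_def using A divisors_pt[OF Pp] by (rule divisors_diff)
  have F: "F \<in> divisors \<iota>" unfolding F_def using A divisors_pt[OF Pp] by (rule divisors_diff)
  have FE: "F = E - pt 1 P" by (rule ext) (simp add: E_def F_def pt_def)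
  have "ell \<iota> E \<le> ell \<iota> F + (if E \<in> Gam \<iota> P then 1 else 0)"
  proof (cases "E \<in> Gam \<iota> P")
    case True
    have "int (ell \<iota> E) \<le> int (ell \<iota> F) + deg \<iota> (E - F)"
      by (rule ell_increase[OF F E]) (simp add: FE pt_def)
    moreover have "deg \<iota> (E - F) = 1"
      using rational_pointD(2)[OF P] by (simp add: FE deg_pt)
    ultimately show ?thesis using True by simp
  next
    case False
    then have "L \<iota> E = L \<iota> F" using E by (simp add: Gam_def FE)
    then show ?thesis by (simp add: ell_def)
  qed
  moreover have "card {s. s < Suc n \<and> A - pt (int s) P \<in> Gam \<iota> P}
      = (if E \<in> Gam \<iota> P then 1 else 0) + card {s. s < n \<and> A - pt (int s) P \<in> Gam \<iota> P}"
  proof -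
    have "{s. s < Suc n \<and> A - pt (int s) P \<in> Gam \<iota> P}
        = (if E \<in> Gam \<iota> P then insert n else id) {s. s < n \<and> A - pt (int s) P \<in> Gam \<iota> P}"
      by (auto simp: less_Suc_eq E_def)
    then show ?thesis by simp
  qed
  ultimately show ?case using Suc.IH unfolding E_def[symmetric] F_def[symmetric] by linarith
qed

text \<open>For \<open>0 \<le> s \<le> k = deg A\<close> the divisors \<open>s P\<close> and \<open>A - s P\<close> do not both lie in \<open>\<Gamma>\<^sub>P\<close>, unless
  their sum \<open>A\<close> does. As at least \<open>k + 1 - g\<close> of the \<open>s P\<close> and as many of the \<open>A - s P\<close> lie in
  \<open>\<Gamma>\<^sub>P\<close>, this forces \<open>2 (k + 1 - g) \<le> k + 1\<close>.\<close>

lemma Gam_if_deg_ge: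
  assumes A: "A \<in> divisors \<iota>" and P: "P \<in> rational_points \<iota>" and deg: "2 * genus \<iota> \<le> deg \<iota> A"
  shows "A \<in> Gam \<iota> P"
proof (rule ccontr)
  assume neg: "A \<notin> Gam \<iota> P"
  have Pp: "P \<in> points \<iota>" by (rule rational_pointD[OF P])
  have deg_pt1: "deg \<iota> (pt n P) = n" for n by (simp add: deg_pt rational_pointD(2)[OF P])
  define k where "k = nat (deg \<iota> A)"
  have k: "deg \<iota> A = int k" using deg genus_nonneg by (simp add: k_def)
  \<comment> \<open>After \<open>k + 1\<close> steps the degree is negative and \<open>ell\<close>
    is zero, so Riemann's inequality bounds from below the number of steps that cost a
    dimension.\<close>
  have count: "int k + 1 - genus \<iota> \<le> int (card {s. s < Suc k \<and> D - pt (int s) P \<in> Gam \<iota> P})"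
    if D: "D \<in> divisors \<iota>" and degD: "deg \<iota> D = int k" for D
  proof -
    let ?D = "D - pt (int (Suc k)) P"
    have D': "?D \<in> divisors \<iota>" using D divisors_pt[OF Pp] by (rule divisors_diff)
    have "deg \<iota> ?D < 0" using deg_diff[OF D divisors_pt[OF Pp]] degD deg_pt1 by simp
    then have "CARD('k) ^ ell \<iota> ?D = 1"
      using card_L'[OF D'] L_trivial_if_deg_neg[OF D'] by simp
    then have "ell \<iota> ?D = 0" using card_constants_ge_2 by simp
    then show ?thesis
      using ell_ge_genus[OF D] ell_le_Gam_count[OF D P, of "Suc k"] degD by linarith
  qed
  let ?S = "{s. s < Suc k \<and> A - pt (int s) P \<in> Gam \<iota> P}"
  let ?T = "{s. s < Suc k \<and> pt (int k) P - pt (int s) P \<in> Gam \<iota> P}"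
  \<comment> \<open>Reflection turns \<open>(k - s) P\<close> into \<open>s P\<close>, so a common
    element of \<open>?S\<close> and \<open>?T'\<close> writes \<open>A\<close> as a sum of two
    members of \<open>Gam \<iota> P\<close>.\<close>
  let ?T' = "(\<lambda>s. k - s) ` ?T"
  have "?S \<inter> ?T' = {}"
  proof (rule ccontr)
    assume "?S \<inter> ?T' \<noteq> {}"
    then obtain s where s: "s \<le> k" "A - pt (int (k - s)) P \<in> Gam \<iota> P"
      "pt (int k) P - pt (int s) P \<in> Gam \<iota> P" by (auto simp: less_Suc_eq_le)
    have "(A - pt (int (k - s)) P) + (pt (int k) P - pt (int s) P) \<in> Gam \<iota> P"
      using s(2,3) by (intro Gam_add[OF _ _ _ _ Pp] divisors_diff A divisors_pt Pp)
    moreover have "(A - pt (int (k - s)) P) + (pt (int k) P - pt (int s) P) = A"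
      by (rule ext) (use s(1) in \<open>simp add: pt_def of_nat_diff\<close>)
    ultimately show False using neg by simp
  qed
  moreover have "inj_on (\<lambda>s. k - s) ?T" by (rule inj_onI) auto
  then have "card ?T' = card ?T" by (rule card_image)
  moreover have "card (?S \<union> ?T') \<le> card {..k}" by (intro card_mono) auto
  ultimately have "card ?S + card ?T \<le> k + 1" by (simp add: card_Un_disjoint)
  then show False
    using count[OF A k] count[OF divisors_pt[OF Pp] deg_pt1] deg k by linarith
qed

end

section \<open>The thresholds \<open>sigma\<close> and \<open>tau\<close>\<close>

lemma ex_threshold:
  fixes U :: "int \<Rightarrow> bool"
  assumes up: "\<And>j j'. U j \<Longrightarrow> j \<le> j' \<Longrightarrow> U j'" and ne: "U a" and below: "\<And>j. j < b \<Longrightarrow> \<not> U j"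
  shows "\<exists>s. \<forall>j. U j \<longleftrightarrow> j \<ge> s"
proof -
  \<comment> \<open>Members of \<open>U\<close> are at least \<open>b\<close>, so \<open>nat\<close>
    truncates nothing on them and the least one can be sought among naturals.\<close>
  obtain s where s: "U s" and least: "\<And>j. U j \<Longrightarrow> nat (s - b) \<le> nat (j - b)"
    using ex_has_least_nat[of U a "\<lambda>j. nat (j - b)"] ne by blast
  have "s \<le> j" if "U j" for j
    using least[OF that] below[of s] below[of j] s that by (cases "s < b"; cases "j < b") auto
  then show ?thesis using up s by blast
qed

text \<open>Statements on \<open>tau\<close> are thereby read off from those on \<open>sigma\<close>
  with the points exchanged.\<close>

lemma tau_eq_sigma: "tau \<iota> B P Q = sigma \<iota> B Q P"
proof
  fix j
  have "B + pt i P + pt j Q = B + pt j Q + pt i P" for i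
    by (simp add: add.assoc add.commute[of "pt i P"])
  then show "tau \<iota> B P Q j = sigma \<iota> B Q P j" unfolding tau_def sigma_def by (simp only:)
qed

context curve
begin

lemma divisors_grid:
  "B \<in> divisors \<iota> \<Longrightarrow> P \<in> points \<iota> \<Longrightarrow> Q \<in> points \<iota> \<Longrightarrow> B + pt i P + pt j Q \<in> divisors \<iota>"
  by (intro divisors_add divisors_pt)

lemma deg_grid:
  assumes "B \<in> divisors \<iota>" "P \<in> rational_points \<iota>" "Q \<in> rational_points \<iota>"
  shows "deg \<iota> (B + pt i P + pt j Q) = deg \<iota> B + i + j"
  using assms rational_pointD by (simp add: deg_add divisors_add divisors_pt deg_pt)

text \<open>For fixed \<open>i\<close> the admissible \<open>j\<close> form an up-set that avoids
  negative degrees and contains degree \<open>2 g\<close>, so the definite description in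
  \<open>sigma\<close> is met.\<close>

lemma sigma_iff:
  assumes B: "B \<in> divisors \<iota>" and P: "P \<in> rational_points \<iota>" and Q: "Q \<in> rational_points \<iota>"
    and "P \<noteq> Q"
  shows "B + pt i P + pt j Q \<in> Gam \<iota> P \<longleftrightarrow> sigma \<iota> B P Q i \<le> j"
proof -
  have Pp: "P \<in> points \<iota>" and Qp: "Q \<in> points \<iota>" using P Q by (auto dest: rational_pointD)
  note grid = divisors_grid[OF B Pp Qp]
  let ?U = "\<lambda>j. B + pt i P + pt j Q \<in> Gam \<iota> P"
  have "\<exists>s. \<forall>j. ?U j \<longleftrightarrow> j \<ge> s"
  proof (rule ex_threshold)
    fix j j' :: int assume j: "?U j" "j \<le> j'"
    have "B + pt i P + pt j Q + pt (j' - j) Q \<in> Gam \<iota> P"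
      using j \<open>P \<noteq> Q\<close> by (intro Gam_add_point[OF grid j(1) Pp Qp]) auto
    moreover have "B + pt i P + pt j Q + pt (j' - j) Q = B + pt i P + pt j' Q"
      by (rule ext) (simp add: pt_def)
    ultimately show "?U j'" by simp
  next
    show "?U (2 * genus \<iota> - i - deg \<iota> B)"
      by (rule Gam_if_deg_ge[OF grid P]) (simp add: deg_grid[OF B P Q])
  next
    fix j assume "j < - i - deg \<iota> B"
    then show "\<not> ?U j"
      by (intro not_Gam_if_deg_neg[OF grid _ Pp]) (simp add: deg_grid[OF B P Q])
  qed
  then obtain s where s: "\<forall>j. ?U j \<longleftrightarrow> j \<ge> s" by blast
  have "sigma \<iota> B P Q i = s"
    unfolding sigma_def
  proof (rule the_equality)
    show "\<forall>j. ?U j \<longleftrightarrow> j \<ge> s" by (rule s)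
  next
    fix s' assume s': "\<forall>j. ?U j \<longleftrightarrow> j \<ge> s'"
    then have "s \<ge> s'" "s' \<ge> s" using s by (metis order_refl)+
    then show "s' = s" by simp
  qed
  then show ?thesis using s by simp
qed

lemma sigma_bounds:
  assumes B: "B \<in> divisors \<iota>" and P: "P \<in> rational_points \<iota>" and Q: "Q \<in> rational_points \<iota>"
    and "P \<noteq> Q" and "deg \<iota> B = 0"
  shows "- i \<le> sigma \<iota> B P Q i" "sigma \<iota> B P Q i \<le> 2 * genus \<iota> - i"
proof -
  have Pp: "P \<in> points \<iota>" and Qp: "Q \<in> points \<iota>" using P Q by (auto dest: rational_pointD)
  note grid = divisors_grid[OF B Pp Qp]
  note iff = sigma_iff[OF B P Q \<open>P \<noteq> Q\<close>]
  show "- i \<le> sigma \<iota> B P Q i"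
    using not_Gam_if_deg_neg[OF grid _ Pp, of i "sigma \<iota> B P Q i"] iff[of i "sigma \<iota> B P Q i"]
      deg_grid[OF B P Q] \<open>deg \<iota> B = 0\<close> by force
  have "B + pt i P + pt (2 * genus \<iota> - i) Q \<in> Gam \<iota> P"
    using \<open>deg \<iota> B = 0\<close> by (intro Gam_if_deg_ge[OF grid P]) (simp add: deg_grid[OF B P Q])
  then show "sigma \<iota> B P Q i \<le> 2 * genus \<iota> - i" by (simp only: iff)
qed

lemma discrepancy_divisors_iff:
  assumes "Q \<in> points \<iota>"
  shows "A \<in> discrepancy_divisors \<iota> P Q \<longleftrightarrow>
    A \<in> divisors \<iota> \<and> A \<in> Gam \<iota> P \<and> A - pt 1 Q \<notin> Gam \<iota> P"
  using divisors_diff[OF _ divisors_pt[OF assms, of 1]]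
  by (auto simp: discrepancy_divisors_def Gam_def)

lemma discrepancy_divisors_commute:
  assumes P: "P \<in> rational_points \<iota>" and Q: "Q \<in> rational_points \<iota>" and "P \<noteq> Q"
  shows "discrepancy_divisors \<iota> P Q = discrepancy_divisors \<iota> Q P"
proof -
  have Pp: "P \<in> points \<iota>" and Qp: "Q \<in> points \<iota>" using P Q by (auto dest: rational_pointD)
  show ?thesis
    using discrepancy_swap[OF _ Pp Q] discrepancy_swap[OF _ Qp P] \<open>P \<noteq> Q\<close>
    unfolding set_eq_iff discrepancy_divisors_iff[OF Pp] discrepancy_divisors_iff[OF Qp] by metis
qed

text \<open>The two defining conditions become \<open>j \<ge> \<sigma> i\<close> and not
  \<open>j - 1 \<ge> \<sigma> i\<close>.\<close>

lemma grid_discrepancy_iff: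
  assumes B: "B \<in> divisors \<iota>" and P: "P \<in> rational_points \<iota>" and Q: "Q \<in> rational_points \<iota>"
    and "P \<noteq> Q"
  shows "B + pt i P + pt j Q \<in> discrepancy_divisors \<iota> P Q \<longleftrightarrow> j = sigma \<iota> B P Q i"
proof -
  have Pp: "P \<in> points \<iota>" and Qp: "Q \<in> points \<iota>" using P Q by (auto dest: rational_pointD)
  have eq: "B + pt i P + pt j Q - pt 1 Q = B + pt i P + pt (j - 1) Q"
    by (rule ext) (simp add: pt_def)
  show ?thesis
    unfolding discrepancy_divisors_iff[OF Qp] eq sigma_iff[OF assms]
    using divisors_grid[OF B Pp Qp, of i j] by auto
qed

lemma grid_discrepancy_iff_tau:
  assumes B: "B \<in> divisors \<iota>" and P: "P \<in> rational_points \<iota>" and Q: "Q \<in> rational_points \<iota>"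
    and "P \<noteq> Q"
  shows "B + pt i P + pt j Q \<in> discrepancy_divisors \<iota> P Q \<longleftrightarrow> i = tau \<iota> B P Q j"
proof -
  have "B + pt i P + pt j Q = B + pt j Q + pt i P"
    by (simp add: add.assoc add.commute[of "pt i P"])
  then show ?thesis
    using grid_discrepancy_iff[OF B Q P, of j i] \<open>P \<noteq> Q\<close>
    by (simp only: tau_eq_sigma discrepancy_divisors_commute[OF P Q \<open>P \<noteq> Q\<close>])
qed

section \<open>Invariance under linear equivalence\<close>

lemma Gam_lin_equiv:
  assumes equiv: "(A, A') \<in> lin_equiv \<iota>" and P: "P \<in> points \<iota>"
  shows "A \<in> Gam \<iota> P \<longleftrightarrow> A' \<in> Gam \<iota> P"
proof -
  obtain f where A: "A \<in> divisors \<iota>" "A' \<in> divisors \<iota>" and f: "f \<noteq> 0" "A - A' = principal \<iota> f"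
    using equiv by (auto simp: lin_equiv_def)
  \<comment> \<open>Multiplication by \<open>f\<close> carries \<open>L(A)\<close> and
    \<open>L(A - P)\<close> onto \<open>L(A')\<close> and \<open>L(A' - P)\<close>; being injective,
    it reflects their equality.\<close>
  have inj: "inj (\<lambda>h. f * h)" using f(1) by (auto simp: inj_on_def)
  have A'eq: "A' = A - principal \<iota> f" using f(2) by (simp add: algebra_simps)
  have "A' - pt 1 P = A - pt 1 P - principal \<iota> f" by (simp add: A'eq algebra_simps)
  then have "L \<iota> (A' - pt 1 P) = (\<lambda>h. f * h) ` L \<iota> (A - pt 1 P)"
    by (simp only: L_minus_principal[OF divisors_diff[OF A(1) divisors_pt[OF P]] f(1)])
  moreover have "L \<iota> A' = (\<lambda>h. f * h) ` L \<iota> A"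
    unfolding A'eq by (rule L_minus_principal[OF A(1) f(1)])
  ultimately show ?thesis using A by (simp add: Gam_def inj_image_eq_iff[OF inj])
qed

lemma lin_equiv_refl: "A \<in> divisors \<iota> \<Longrightarrow> (A, A) \<in> lin_equiv \<iota>"
proof -
  assume A: "A \<in> divisors \<iota>"
  have "A - A = principal \<iota> 1" by (rule ext) (simp add: principal_def pt_one)
  then show ?thesis using A unfolding lin_equiv_def by (auto intro!: exI[of _ 1])
qed

lemma lin_equiv_sym:
  assumes "(A, A') \<in> lin_equiv \<iota>"
  shows "(A', A) \<in> lin_equiv \<iota>"
proof -
  obtain f where A: "A \<in> divisors \<iota>" "A' \<in> divisors \<iota>" and f: "f \<noteq> 0" "A - A' = principal \<iota> f"
    using assms by (auto simp: lin_equiv_def)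
  have "A' - A = principal \<iota> (inverse f)"
  proof
    fix R
    have "(A - A') R = principal \<iota> f R" by (simp only: f(2))
    then show "(A' - A) R = principal \<iota> (inverse f) R"
      by (simp add: principal_def pt_inverse split: if_splits)
  qed
  then show ?thesis using A f(1) unfolding lin_equiv_def by (auto intro!: exI[of _ "inverse f"])
qed

lemma discrepancy_divisors_lin_equiv:
  assumes "A \<in> discrepancy_divisors \<iota> P Q" "(A, A') \<in> lin_equiv \<iota>" "P \<in> points \<iota>" "Q \<in> points \<iota>"
  shows "A' \<in> discrepancy_divisors \<iota> P Q"
proof -
  have A: "A \<in> divisors \<iota>" "A' \<in> divisors \<iota>" using assms(2) by (auto simp: lin_equiv_def)
  have "A - pt 1 Q - (A' - pt 1 Q) = A - A'" by simp
  then have "(A - pt 1 Q, A' - pt 1 Q) \<in> lin_equiv \<iota>"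
    using assms(2) divisors_diff[OF A(1) divisors_pt[OF assms(4)]]
      divisors_diff[OF A(2) divisors_pt[OF assms(4)]] by (simp add: lin_equiv_def)
  then show ?thesis
    using assms(1) A Gam_lin_equiv[OF assms(2,3)] Gam_lin_equiv[OF _ assms(3)]
    by (simp add: discrepancy_divisors_iff[OF assms(4)])
qed

text \<open>Discrepancies are stable under linear equivalence, so if a grid class contains one, its
  grid divisor is one too. This moves the problem from classes to divisors.\<close>

lemma discrepancies_on_eq:
  assumes B: "B \<in> divisors \<iota>" and P: "P \<in> points \<iota>" and Q: "Q \<in> points \<iota>"
  shows "discrepancies_on \<iota> B P Q
    = div_class \<iota> ` ({B + pt i P + pt j Q | i j. True} \<inter> discrepancy_divisors \<iota> P Q)"
proof (intro equalityI subsetI)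
  fix X assume "X \<in> discrepancies_on \<iota> B P Q"
  then obtain i j A where X: "X = div_class \<iota> (B + pt i P + pt j Q)" "X = div_class \<iota> A"
    "A \<in> discrepancy_divisors \<iota> P Q"
    by (auto simp: discrepancies_on_def discrepancies_def)
  have "B + pt i P + pt j Q \<in> div_class \<iota> (B + pt i P + pt j Q)"
    using lin_equiv_refl[OF divisors_grid[OF B P Q]] by (simp add: div_class_def)
  then have "(A, B + pt i P + pt j Q) \<in> lin_equiv \<iota>" using X(1,2) by (auto simp: div_class_def)
  then have "B + pt i P + pt j Q \<in> discrepancy_divisors \<iota> P Q"
    by (rule discrepancy_divisors_lin_equiv[OF X(3) _ P Q])
  then show "X \<in> div_class \<iota> ` ({B + pt i P + pt j Q | i j. True} \<inter> discrepancy_divisors \<iota> P Q)"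
    using X(1) by blast
next
  fix X assume "X \<in> div_class \<iota> ` ({B + pt i P + pt j Q | i j. True} \<inter> discrepancy_divisors \<iota> P Q)"
  then show "X \<in> discrepancies_on \<iota> B P Q"
    unfolding discrepancies_on_def discrepancies_def by blast
qed

text \<open>\<open>B + (i + m) P + j Q\<close> and \<open>B + i P + (j + m) Q\<close> are linearly
  equivalent, hence lie in \<open>Gam \<iota> P\<close> together.\<close>

lemma sigma_shift:
  assumes B: "B \<in> divisors \<iota>" and P: "P \<in> rational_points \<iota>" and Q: "Q \<in> rational_points \<iota>"
    and "P \<noteq> Q" and m: "(pt m P, pt m Q) \<in> lin_equiv \<iota>"
  shows "sigma \<iota> B P Q (i + m) = sigma \<iota> B P Q i - m"
proof -
  have Pp: "P \<in> points \<iota>" and Qp: "Q \<in> points \<iota>" using P Q by (auto dest: rational_pointD)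
  note iff = sigma_iff[OF B P Q \<open>P \<noteq> Q\<close>]
  have "sigma \<iota> B P Q (i + m) \<le> j \<longleftrightarrow> sigma \<iota> B P Q i \<le> j + m" for j
  proof -
    let ?A = "B + pt (i + m) P + pt j Q" and ?A' = "B + pt i P + pt (j + m) Q"
    have "?A - ?A' = pt m P - pt m Q" by (rule ext) (simp add: pt_def)
    then have "(?A, ?A') \<in> lin_equiv \<iota>"
      using m divisors_grid[OF B Pp Qp] by (simp add: lin_equiv_def)
    from Gam_lin_equiv[OF this Pp] show ?thesis by (simp only: iff)
  qed
  \<comment> \<open>Evaluating the equivalence at both thresholds gives the two
    inequalities.\<close>
  from this[of "sigma \<iota> B P Q (i + m)"] this[of "sigma \<iota> B P Q i - m"] show ?thesis by simp
qed

end

section \<open>Periodicity modulo \<open>m\<close>\<close>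

lemma shift_periodicI:
  assumes step: "\<And>i. s (i + m) = s i - m"
  shows "shift_periodic m s"
proof -
  \<comment> \<open>Induction covers nonnegative multiples of \<open>m\<close>; for a negative one
    the roles of \<open>i\<close> and \<open>i'\<close> are exchanged below.\<close>
  have nat: "i + int k * m + s (i + int k * m) = i + s i" for i k
  proof (induction k)
    case (Suc k)
    then show ?case using step[of "i + int k * m"] by (simp add: algebra_simps)
  qed simp
  show ?thesis
    unfolding shift_periodic_def
  proof (intro allI impI)
    fix i i' assume "[i = i'] (mod m)"
    then obtain k where k: "i' = i + m * k" by (auto simp: cong_iff_lin)
    show "i + s i = i' + s i'"
    proof (cases "0 \<le> k")
      case True
      then show ?thesis using nat[of i "nat k"] k by (simp add: mult.commute)
    next
      case False
      then have "i = i' + int (nat (- k)) * m" using k by (simp add: mult.commute)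
      then show ?thesis using nat[of i' "nat (- k)"] by simp
    qed
  qed
qed

lemma shift_periodic_determined:
  assumes "shift_periodic m s" "shift_periodic m s'" "full_representatives m S" "\<forall>r\<in>S. s r = s' r"
  shows "s = s'"
proof
  fix i
  obtain r where r: "r \<in> S" "[r = i] (mod m)"
    using assms(3) unfolding full_representatives_def by blast
  then have "r + s r = i + s i" "r + s' r = i + s' i"
    using assms(1,2) unfolding shift_periodic_def by blast+
  then show "s i = s' i" using assms(4) r(1) by simp
qed

text \<open>When \<open>m P\<close> and \<open>m Q\<close> are equivalent for some nonzero
  \<open>m\<close>, distinct grid divisors can share a class. The equalities are therefore stated
  for divisors beside those for classes, and the inverse relation is drawn from the
  divisors.\<close>

theorem theorem8p5:
  fixes \<iota> :: "'k::{field,finite} \<Rightarrow> 'a::field"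
    and P Q :: "'a \<Rightarrow> int" and B :: "'a divisor" and g :: int
    and \<sigma> \<tau> :: "int \<Rightarrow> int"
  assumes "curve \<iota>" and "genus \<iota> = g"
    and "P \<in> rational_points \<iota>" and "Q \<in> rational_points \<iota>" and "P \<noteq> Q"
    and "B \<in> divisors \<iota>"
  defines "\<sigma> \<equiv> sigma \<iota> B P Q" and "\<tau> \<equiv> tau \<iota> B P Q"
  shows "discrepancies_on \<iota> B P Q = {div_class \<iota> (B + pt i P + pt (\<sigma> i) Q) | i. True}
    \<and> discrepancies_on \<iota> B P Q = {div_class \<iota> (B + pt (\<tau> j) P + pt j Q) | j. True}
    \<and> {B + pt i P + pt j Q | i j. True} \<inter> discrepancy_divisors \<iota> P Q
        = {B + pt i P + pt (\<sigma> i) Q | i. True}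
    \<and> {B + pt i P + pt j Q | i j. True} \<inter> discrepancy_divisors \<iota> P Q
        = {B + pt (\<tau> j) P + pt j Q | j. True}
    \<and> bij \<sigma> \<and> bij \<tau> \<and> \<sigma> \<circ> \<tau> = id \<and> \<tau> \<circ> \<sigma> = id
    \<and> (deg \<iota> B = 0 \<longrightarrow>
        (\<forall>i. - i \<le> \<sigma> i \<and> \<sigma> i \<le> 2 * g - i \<and> - i \<le> \<tau> i \<and> \<tau> i \<le> 2 * g - i))
    \<and> (\<forall>m. (pt m P, pt m Q) \<in> lin_equiv \<iota> \<longrightarrow>
        shift_periodic m \<sigma> \<and> shift_periodic m \<tau>
        \<and> (\<forall>S. full_representatives m S \<longrightarrow>
            (\<forall>s. shift_periodic m s \<and> (\<forall>r\<in>S. s r = \<sigma> r) \<longrightarrow> s = \<sigma>) \<and>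
            (\<forall>t. shift_periodic m t \<and> (\<forall>r\<in>S. t r = \<tau> r) \<longrightarrow> t = \<tau>)))"
proof -
  interpret curve \<iota> by (rule assms(1))
  note P = assms(3) and Q = assms(4) and PQ = assms(5) and B = assms(6)
  have Pp: "P \<in> points \<iota>" and Qp: "Q \<in> points \<iota>" using P Q by (auto dest: rational_pointD)
  have \<tau>: "\<tau> = sigma \<iota> B Q P" by (simp add: \<tau>_def tau_eq_sigma)
  let ?G = "{B + pt i P + pt j Q | i j. True} \<inter> discrepancy_divisors \<iota> P Q"
  have iff\<sigma>: "B + pt i P + pt j Q \<in> discrepancy_divisors \<iota> P Q \<longleftrightarrow> j = \<sigma> i" for i j
    unfolding \<sigma>_def by (rule grid_discrepancy_iff[OF B P Q PQ])
  have iff\<tau>: "B + pt i P + pt j Q \<in> discrepancy_divisors \<iota> P Q \<longleftrightarrow> i = \<tau> j" for i j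
    unfolding \<tau>_def by (rule grid_discrepancy_iff_tau[OF B P Q PQ])
  have G\<sigma>: "?G = {B + pt i P + pt (\<sigma> i) Q | i. True}" using iff\<sigma> by fastforce
  have G\<tau>: "?G = {B + pt (\<tau> j) P + pt j Q | j. True}" using iff\<tau> by fastforce
  have cls: "discrepancies_on \<iota> B P Q = div_class \<iota> ` ?G"
    by (rule discrepancies_on_eq[OF B Pp Qp])
  have C\<sigma>: "discrepancies_on \<iota> B P Q = {div_class \<iota> (B + pt i P + pt (\<sigma> i) Q) | i. True}"
    unfolding cls G\<sigma> by blast
  have C\<tau>: "discrepancies_on \<iota> B P Q = {div_class \<iota> (B + pt (\<tau> j) P + pt j Q) | j. True}"
    unfolding cls G\<tau> by blast
  \<comment> \<open>Both functions describe the same grid discrepancies, one for given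
    \<open>i\<close> and the other for given \<open>j\<close>.\<close>
  have inv: "j = \<sigma> i \<longleftrightarrow> i = \<tau> j" for i j using iff\<sigma> iff\<tau> by blast
  have \<sigma>\<tau>: "\<sigma> \<circ> \<tau> = id" and \<tau>\<sigma>: "\<tau> \<circ> \<sigma> = id"
    using inv[of x "\<tau> x" for x] inv[of "\<sigma> x" x for x] by (simp_all add: fun_eq_iff)
  have bij: "bij \<sigma>" "bij \<tau>" using o_bij[OF \<tau>\<sigma> \<sigma>\<tau>] o_bij[OF \<sigma>\<tau> \<tau>\<sigma>] by auto
  have bounds: "- i \<le> \<sigma> i \<and> \<sigma> i \<le> 2 * g - i \<and> - i \<le> \<tau> i \<and> \<tau> i \<le> 2 * g - i"
    if "deg \<iota> B = 0" for i
    unfolding \<sigma>_def \<tau> assms(2)[symmetric]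
    using sigma_bounds[OF B P Q PQ that] sigma_bounds[OF B Q P PQ[symmetric] that] by blast
  have per: "shift_periodic m \<sigma>" "shift_periodic m \<tau>" if m: "(pt m P, pt m Q) \<in> lin_equiv \<iota>" for m
    unfolding \<sigma>_def \<tau>
    by (rule shift_periodicI, rule sigma_shift[OF B P Q PQ m],
        rule shift_periodicI, rule sigma_shift[OF B Q P PQ[symmetric] lin_equiv_sym[OF m]])
  have "shift_periodic m \<sigma> \<and> shift_periodic m \<tau> \<and> (\<forall>S. full_representatives m S \<longrightarrow>
      (\<forall>s. shift_periodic m s \<and> (\<forall>r\<in>S. s r = \<sigma> r) \<longrightarrow> s = \<sigma>) \<and>
      (\<forall>t. shift_periodic m t \<and> (\<forall>r\<in>S. t r = \<tau> r) \<longrightarrow> t = \<tau>))"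
    if m: "(pt m P, pt m Q) \<in> lin_equiv \<iota>" for m
    using per[OF m] shift_periodic_determined[OF _ per(1)[OF m]]
      shift_periodic_determined[OF _ per(2)[OF m]] by simp
  then show ?thesis
    by (intro conjI allI impI C\<sigma> C\<tau> G\<sigma> G\<tau> bij \<sigma>\<tau> \<tau>\<sigma>) (simp_all add: bounds)
qed

end
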